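(* There exists a complete Pick space $\mathcal{H}$ on the closed unit disc $\overline{\mathbb{D}} \subset \mathbb{C}$ such that $\overline{\mathbb{D}}$ is a maximal domain for $\mathcal{H}$, with a reproducing kernel of the form $$ k(z,w) = \sum_{n=0}^\infty a_n (z\overline{w})^n, $$ and such that the one-function corona theorem for $\mathrm{Mult}(\mathcal{H})$ fails. In particular, $\overline{\mathbb{D}}$ (identified with the set of characters of point evaluation) is a proper compact subset of the maximal ideal space of $\mathrm{Mult}(\mathcal{H})$.
   Context: For a reproducing kernel Hilbert space $\mathcal{H}$ of complex-valued functions on a set $X$ with reproducing kernel $k$ (assumed not to vanish on the diagonal), the multiplier algebra is $\mathrm{Mult}(\mathcal{H}) = \{\varphi : X \to \mathbb{C} : \varphi f \in \mathcal{H} \text{ for all } f \in \mathcal{H}\}$; each $\varphi \in \mathrm{Mult}(\mathcal{H})$ gives a bounded multiplication operator $M_\varphi$ on $\mathcal{H}$, and $\|\varphi\|_{\mathrm{Mult}(\mathcal{H})} = \|M_\varphi\|$. $\mathcal{H}$ is a complete Pick space if for every $r \in \mathbb{N}$ and every finite collection of points $z_1,\ldots,z_n \in X$ and matrices $W_1,\ldots,W_n \in M_r(\mathbb{C})$, positive semidefiniteness of the $nr \times nr$ block matrix $[k(z_i,z_j)(I_{\mathbb{C}^r} - W_i W_j^* )]_{i,j=1}^n$ implies that there exists $\Phi \in M_r(\mathrm{Mult}(\mathcal{H}))$ of norm at most $1$ (as a multiplication operator on $\mathcal{H} \otimes \mathbb{C}^r$) with $\Phi(z_i) = W_i$ for $i=1,\ldots,n$.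 A non-zero bounded linear functional $\rho$ on $\mathcal{H}$ is partially multiplicative if $\rho(fg) = \rho(f)\rho(g)$ whenever $f,g \in \mathcal{H}$ are such that $fg \in \mathcal{H}$. $X$ is a maximal domain for $\mathcal{H}$ if every partially multiplicative functional on $\mathcal{H}$ is given by evaluation at a point in $X$. The one-function corona theorem holds for $\mathrm{Mult}(\mathcal{H})$ if whenever $\varphi \in \mathrm{Mult}(\mathcal{H})$ and $\inf_{x \in X}|\varphi(x)| > 0$, then $1/\varphi \in \mathrm{Mult}(\mathcal{H})$; it fails otherwise. The maximal ideal space of $\mathrm{Mult}(\mathcal{H})$ is the set of characters (non-zero multiplicative linear functionals) on $\mathrm{Mult}(\mathcal{H})$ with the Gelfand topology. When $\mathrm{Mult}(\mathcal{H})$ separates the points of $X$, $X$ is identified with a subset of it via point evaluations. *)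

theory Defs
  imports
    "HOL-Analysis.Analysis"
    "Jordan_Normal_Form.Matrix"
    "Jordan_Normal_Form.Schur_Decomposition"
begin

(* A complex-valued function on a set X is represented by a total function that is 0
   outside X, so that equality of such functions is HOL equality. *)
definition functions_on :: "'a set \<Rightarrow> ('a \<Rightarrow> complex) set" where
  "functions_on X = {f. \<forall>x. x \<notin> X \<longrightarrow> f x = 0}"

definition ip_norm :: "(('a \<Rightarrow> complex) \<Rightarrow> ('a \<Rightarrow> complex) \<Rightarrow> complex) \<Rightarrow> ('a \<Rightarrow> complex) \<Rightarrow> real" where
  "ip_norm ip f = sqrt (Re (ip f f))"

(* The inner product is linear in its first argument. Since the functions in H vanish
   outside X, kernel_in forces k z w = 0 for w in X and z outside X. *)
locale rkhs =
  fixes X :: "'a set"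
    and H :: "('a \<Rightarrow> complex) set"
    and ip :: "('a \<Rightarrow> complex) \<Rightarrow> ('a \<Rightarrow> complex) \<Rightarrow> complex"
    and k :: "'a \<Rightarrow> 'a \<Rightarrow> complex"
  assumes subset_functions: "H \<subseteq> functions_on X"
    and zero_in: "(\<lambda>x. 0) \<in> H"
    and add_in: "\<And>f g. f \<in> H \<Longrightarrow> g \<in> H \<Longrightarrow> (\<lambda>x. f x + g x) \<in> H"
    and scale_in: "\<And>c f. f \<in> H \<Longrightarrow> (\<lambda>x. c * f x) \<in> H"
    and ip_add: "\<And>f g h. f \<in> H \<Longrightarrow> g \<in> H \<Longrightarrow> h \<in> H \<Longrightarrow>
                   ip (\<lambda>x. f x + g x) h = ip f h + ip g h"
    and ip_scale: "\<And>c f h. f \<in> H \<Longrightarrow> h \<in> H \<Longrightarrow> ip (\<lambda>x. c * f x) h = c * ip f h"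
    and ip_commute: "\<And>f g. f \<in> H \<Longrightarrow> g \<in> H \<Longrightarrow> ip g f = cnj (ip f g)"
    and ip_nonneg: "\<And>f. f \<in> H \<Longrightarrow> 0 \<le> Re (ip f f)"
    and ip_definite: "\<And>f. f \<in> H \<Longrightarrow> ip f f = 0 \<Longrightarrow> f = (\<lambda>x. 0)"
    and complete: "\<And>u. (\<And>n. u n \<in> H) \<Longrightarrow>
           (\<And>e. e > 0 \<Longrightarrow> \<exists>N. \<forall>m\<ge>N. \<forall>n\<ge>N. ip_norm ip (\<lambda>x. u m x - u n x) < e) \<Longrightarrow>
           \<exists>f\<in>H. (\<lambda>n. ip_norm ip (\<lambda>x. u n x - f x)) \<longlonglongrightarrow> (0::real)"
    and kernel_in: "\<And>w. w \<in> X \<Longrightarrow> (\<lambda>z. k z w) \<in> H"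
    and reproducing: "\<And>f w. f \<in> H \<Longrightarrow> w \<in> X \<Longrightarrow> ip f (\<lambda>z. k z w) = f w"
    and kernel_diagonal: "\<And>x. x \<in> X \<Longrightarrow> k x x \<noteq> 0"

definition Mult :: "'a set \<Rightarrow> ('a \<Rightarrow> complex) set \<Rightarrow> ('a \<Rightarrow> complex) set" where
  "Mult X H = {\<phi> \<in> functions_on X. \<forall>f\<in>H. (\<lambda>x. \<phi> x * f x) \<in> H}"

definition positive_semidefinite_mat :: "complex mat \<Rightarrow> bool" where
  "positive_semidefinite_mat A \<longleftrightarrow> square_mat A \<and>
     (\<forall>v \<in> carrier_vec (dim_row A). 0 \<le> (A *\<^sub>v v) \<bullet>c v)"

(* The nr x nr matrix whose (i,j) block is k (z i) (z j) times I - W i (W j)^*;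
   the row (or column) index i * r + p denotes entry p of block i. *)
definition pick_matrix ::
  "('a \<Rightarrow> 'a \<Rightarrow> complex) \<Rightarrow> nat \<Rightarrow> nat \<Rightarrow> (nat \<Rightarrow> 'a) \<Rightarrow> (nat \<Rightarrow> complex mat) \<Rightarrow> complex mat" where
  "pick_matrix k r n z W = mat (n * r) (n * r) (\<lambda>(p, q).
     k (z (p div r)) (z (q div r)) *
     (1\<^sub>m r - W (p div r) * mat_adjoint (W (q div r))) $$ (p mod r, q mod r))"

(* The operator norm of multiplication by \<Phi> on the tensor product of H with C^r, i.e. on
   r-tuples of elements of H with the direct sum norm, is at most 1. *)
definition contractive_multiplier_mat ::
  "('a \<Rightarrow> complex) set \<Rightarrow> (('a \<Rightarrow> complex) \<Rightarrow> ('a \<Rightarrow> complex) \<Rightarrow> complex) \<Rightarrow> nat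
     \<Rightarrow> ('a \<Rightarrow> complex) mat \<Rightarrow> bool" where
  "contractive_multiplier_mat H ip r \<Phi> \<longleftrightarrow>
     (\<forall>F. (\<forall>q<r. F q \<in> H) \<longrightarrow>
        sqrt (\<Sum>p<r. (ip_norm ip (\<lambda>x. \<Sum>q<r. (\<Phi> $$ (p, q)) x * F q x))\<^sup>2)
          \<le> sqrt (\<Sum>q<r. (ip_norm ip (F q))\<^sup>2))"

definition complete_Pick_space ::
  "'a set \<Rightarrow> ('a \<Rightarrow> complex) set \<Rightarrow> (('a \<Rightarrow> complex) \<Rightarrow> ('a \<Rightarrow> complex) \<Rightarrow> complex)
     \<Rightarrow> ('a \<Rightarrow> 'a \<Rightarrow> complex) \<Rightarrow> bool" where
  "complete_Pick_space X H ip k \<longleftrightarrow> rkhs X H ip k \<and>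
     (\<forall>r n z W.
        (\<forall>i<n. z i \<in> X \<and> W i \<in> carrier_mat r r) \<longrightarrow>
        positive_semidefinite_mat (pick_matrix k r n z W) \<longrightarrow>
        (\<exists>\<Phi> \<in> carrier_mat r r.
           elements_mat \<Phi> \<subseteq> Mult X H \<and>
           contractive_multiplier_mat H ip r \<Phi> \<and>
           (\<forall>i<n. map_mat (\<lambda>\<phi>. \<phi> (z i)) \<Phi> = W i)))"

definition partially_multiplicative ::
  "('a \<Rightarrow> complex) set \<Rightarrow> (('a \<Rightarrow> complex) \<Rightarrow> ('a \<Rightarrow> complex) \<Rightarrow> complex)
     \<Rightarrow> (('a \<Rightarrow> complex) \<Rightarrow> complex) \<Rightarrow> bool" where
  "partially_multiplicative H ip \<rho> \<longleftrightarrow>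
     (\<forall>f\<in>H. \<forall>g\<in>H. \<rho> (\<lambda>x. f x + g x) = \<rho> f + \<rho> g) \<and>
     (\<forall>c. \<forall>f\<in>H. \<rho> (\<lambda>x. c * f x) = c * \<rho> f) \<and>
     (\<exists>C. \<forall>f\<in>H. cmod (\<rho> f) \<le> C * ip_norm ip f) \<and>
     (\<exists>f\<in>H. \<rho> f \<noteq> 0) \<and>
     (\<forall>f\<in>H. \<forall>g\<in>H. (\<lambda>x. f x * g x) \<in> H \<longrightarrow> \<rho> (\<lambda>x. f x * g x) = \<rho> f * \<rho> g)"

definition maximal_domain ::
  "'a set \<Rightarrow> ('a \<Rightarrow> complex) set \<Rightarrow> (('a \<Rightarrow> complex) \<Rightarrow> ('a \<Rightarrow> complex) \<Rightarrow> complex) \<Rightarrow> bool" where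
  "maximal_domain X H ip \<longleftrightarrow>
     (\<forall>\<rho>. partially_multiplicative H ip \<rho> \<longrightarrow> (\<exists>x\<in>X. \<forall>f\<in>H. \<rho> f = f x))"

(* Outside X the function 1 / \<phi> is 1 / 0 = 0, so it again represents a function on X. *)
definition one_function_corona :: "'a set \<Rightarrow> ('a \<Rightarrow> complex) set \<Rightarrow> bool" where
  "one_function_corona X H \<longleftrightarrow>
     (\<forall>\<phi> \<in> Mult X H. (INF x\<in>X. cmod (\<phi> x)) > 0 \<longrightarrow> (\<lambda>x. 1 / \<phi> x) \<in> Mult X H)"

(* Characters are made extensional, so that equality of characters is HOL equality and
   the characters form a subset of the topological product of copies of C over Mult X H. *)
definition characters :: "'a set \<Rightarrow> ('a \<Rightarrow> complex) set \<Rightarrow> (('a \<Rightarrow> complex) \<Rightarrow> complex) set" where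
  "characters X H = {\<eta> \<in> extensional (Mult X H).
     (\<forall>\<phi> \<in> Mult X H. \<forall>\<psi> \<in> Mult X H. \<eta> (\<lambda>x. \<phi> x + \<psi> x) = \<eta> \<phi> + \<eta> \<psi>) \<and>
     (\<forall>c. \<forall>\<phi> \<in> Mult X H. \<eta> (\<lambda>x. c * \<phi> x) = c * \<eta> \<phi>) \<and>
     (\<forall>\<phi> \<in> Mult X H. \<forall>\<psi> \<in> Mult X H. \<eta> (\<lambda>x. \<phi> x * \<psi> x) = \<eta> \<phi> * \<eta> \<psi>) \<and>
     (\<exists>\<phi> \<in> Mult X H. \<eta> \<phi> \<noteq> 0)}"

(* The Gelfand topology is the topology of pointwise convergence on Mult X H. *)
definition maximal_ideal_space ::
  "'a set \<Rightarrow> ('a \<Rightarrow> complex) set \<Rightarrow> (('a \<Rightarrow> complex) \<Rightarrow> complex) topology" where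
  "maximal_ideal_space X H =
     subtopology (product_topology (\<lambda>\<phi>. euclidean) (Mult X H)) (characters X H)"

definition point_evaluation ::
  "'a set \<Rightarrow> ('a \<Rightarrow> complex) set \<Rightarrow> 'a \<Rightarrow> ('a \<Rightarrow> complex) \<Rightarrow> complex" where
  "point_evaluation X H x = (\<lambda>\<phi> \<in> Mult X H. \<phi> x)"

definition separates_points :: "('a \<Rightarrow> complex) set \<Rightarrow> 'a set \<Rightarrow> bool" where
  "separates_points A X \<longleftrightarrow> (\<forall>x\<in>X. \<forall>y\<in>X. x \<noteq> y \<longrightarrow> (\<exists>\<phi>\<in>A. \<phi> x \<noteq> \<phi> y))"

end

theory Submission
  imports Defs
begin

text \<open>
  The kernel has the form \<open>k(z, w) = 1 / (1 - B(z cnj w))\<close>, where \<open>B(t) = b 1 t + b 2 t^2 + \<dots>\<close>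
  has nonnegative coefficients with sum at most \<open>1/2\<close>. The coefficients \<open>a n\<close> of \<open>1 / (1 - B)\<close>
  form the renewal sequence of \<open>b\<close>; they are positive and summable, and the space consists of the
  power series on the closed disc with \<open>\<Sum> |c n|^2 / a n < \<infinity>\<close>. Writing \<open>u l = sqrt (b l) z^l\<close>,
  multiplication by the row \<open>(u 1, u 2, \<dots>)\<close> is a contraction (row_contraction): this is
  Cauchy-Schwarz together with the recursion \<open>a n = \<Sum> b l a (n - l)\<close>. Both halves of the proof
  rest on this inequality.

  Every kernel of this kind has the complete Pick property. If the Pick matrix factors as
  \<open>\<Gamma> \<Gamma>^*\<close>, multiplying by \<open>1 - B\<close> turns the factorization into an equality of two Gram matrices. The
  partial isometry between the two families of vectors (lurking_isometry) supplies the coefficients of a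
  linear system whose transfer function interpolates the data (transfer_interpolates) and is a
  contractive multiplier: the system does not create energy, and the row contraction returns to the
  state no more than what is fed back (energy).

  The corona theorem fails for a lacunary choice of \<open>b\<close>: it is carried by letters \<open>\<nu> 0, \<nu> 1, \<dots>\<close> with
  \<open>b (\<nu> j) = 4^-(j+1)\<close>, each much larger than the one before. Then the functions
  \<open>v j = u (\<nu> j) = 2^-(j+1) z^(\<nu> j)\<close> behave, up to high degree, like independent variables, and the space behaves
  like the Drury-Arveson space of functions of \<open>(v 0, v 1, \<dots>)\<close>. The disc only sees points
  with \<open>|v j| \<le> 2^-(j+1)\<close>, whereas the Drury-Arveson space also admits evaluation at points with one
  coordinate \<open>v j\<close> near \<open>1\<close> and all the others \<open>0\<close>. Truncated to finite degree, these
  evaluations are functionals \<open>\<chi> j\<close> on the multiplier algebra that are uniformly bounded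
  (chi_bounded) and multiplicative up to an error tending to \<open>0\<close> (chi_approx_multiplicative), so that
  a cluster point of them is a character (exists_character).

  The multiplier that tells this character apart from the points of the disc is the sum over \<open>j\<close> of the averages
  of the powers \<open>v j, \<dots>, (v j)^(4^(j+1))\<close>. On the disc it is bounded by \<open>1/3\<close>, but each \<open>\<chi> j\<close>
  gives it real part at least \<open>1/2\<close>. It is a bounded multiplier since
  \<open>f = h + v j g\<close> splits each summand into one on which averaging gains the factor
  \<open>2^-(j+1)\<close> (prefix_bound) and one that starts with \<open>v j\<close>, and the latter add up by the row
  contraction (phi_bounded). Subtracting from this multiplier its value at the character gives a
  multiplier that is bounded below on the disc but lies in the kernel of a character.

  The bound on \<open>\<chi> j\<close> uses that multiplication by a multiplier is a bounded operator; this is proved by a gliding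
  hump (multiplication_bounded). The closed disc is a maximal domain because the power
  series \<open>\<Sum> a n t^n\<close> has radius of convergence \<open>1\<close> (unbounded_radius).
\<close>

section \<open>Absolutely convergent power series on the closed disc\<close>

definition disc_fun :: "(nat \<Rightarrow> complex) \<Rightarrow> complex \<Rightarrow> complex" where
  "disc_fun c z = (if z \<in> cball 0 1 then \<Sum>n. c n * z ^ n else 0)"

definition conv :: "(nat \<Rightarrow> complex) \<Rightarrow> (nat \<Rightarrow> complex) \<Rightarrow> nat \<Rightarrow> complex" where
  "conv c d n = (\<Sum>i\<le>n. c i * d (n - i))"

definition delta :: "nat \<Rightarrow> nat \<Rightarrow> complex" where
  "delta k n = (if n = k then 1 else 0)"

lemma disc_term_le:
  assumes "z \<in> cball 0 1"
  shows "cmod (c * z ^ n) \<le> cmod c"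
  using assms by (simp add: norm_mult norm_power mult_left_le power_le_one)

lemma disc_abs_summable:
  assumes "summable (\<lambda>n. cmod (c n))" "z \<in> cball 0 1"
  shows "summable (\<lambda>n. cmod (c n * z ^ n))"
  by (rule summable_comparison_test'[OF assms(1), of 0]) (use disc_term_le[OF assms(2)] in auto)

lemma disc_summable:
  assumes "summable (\<lambda>n. cmod (c n))" "z \<in> cball 0 1"
  shows "summable (\<lambda>n. c n * z ^ n)"
  using disc_abs_summable[OF assms] by (rule summable_norm_cancel)

lemma abs_summable_scale:
  assumes "summable (\<lambda>n. cmod (c n))"
  shows "summable (\<lambda>n. cmod (x * c n))"
  using summable_mult[OF assms, of "cmod x"] by (simp add: norm_mult)

lemma disc_fun_add:
  assumes "summable (\<lambda>n. cmod (c n))" "summable (\<lambda>n. cmod (d n))"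
  shows "disc_fun (\<lambda>n. c n + d n) = (\<lambda>z. disc_fun c z + disc_fun d z)"
  using disc_summable[OF assms(1)] disc_summable[OF assms(2)]
  by (auto simp: disc_fun_def fun_eq_iff ring_distribs suminf_add)

lemma disc_fun_scale:
  assumes "summable (\<lambda>n. cmod (c n))"
  shows "disc_fun (\<lambda>n. x * c n) = (\<lambda>z. x * disc_fun c z)"
  using disc_summable[OF assms] by (auto simp: disc_fun_def fun_eq_iff mult.assoc suminf_mult)

lemma disc_fun_diff:
  assumes "summable (\<lambda>n. cmod (c n))" "summable (\<lambda>n. cmod (d n))"
  shows "disc_fun (\<lambda>n. c n - d n) = (\<lambda>z. disc_fun c z - disc_fun d z)"
  using disc_summable[OF assms(1)] disc_summable[OF assms(2)]
  by (auto simp: disc_fun_def fun_eq_iff left_diff_distrib suminf_diff)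

lemma disc_fun_sum:
  assumes "\<And>i. i \<in> I \<Longrightarrow> summable (\<lambda>n. cmod (c i n))"
  shows "disc_fun (\<lambda>n. \<Sum>i\<in>I. c i n) = (\<lambda>z. \<Sum>i\<in>I. disc_fun (c i) z)"
  using disc_summable[OF assms]
  by (auto simp: disc_fun_def fun_eq_iff sum_distrib_right intro!: suminf_sum)

lemma conv_abs_summable:
  assumes "summable (\<lambda>n. cmod (c n))" "summable (\<lambda>n. cmod (d n))"
  shows "summable (\<lambda>n. cmod (conv c d n))"
proof -
  have s: "summable (\<lambda>n. \<Sum>i\<le>n. cmod (c i) * cmod (d (n - i)))"
    using summable_Cauchy_product[of "\<lambda>n. cmod (c n)" "\<lambda>n. cmod (d n)"] assms by simp
  show ?thesis
  proof (rule summable_comparison_test'[OF s, of 0])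
    fix n :: nat
    have "cmod (conv c d n) \<le> (\<Sum>i\<le>n. cmod (c i * d (n - i)))"
      unfolding conv_def by (rule norm_sum)
    then show "norm (cmod (conv c d n)) \<le> (\<Sum>i\<le>n. cmod (c i) * cmod (d (n - i)))"
      by (simp add: norm_mult)
  qed
qed

lemma disc_fun_conv:
  assumes "summable (\<lambda>n. cmod (c n))" "summable (\<lambda>n. cmod (d n))"
  shows "disc_fun (conv c d) = (\<lambda>z. disc_fun c z * disc_fun d z)"
proof
  fix z
  show "disc_fun (conv c d) z = disc_fun c z * disc_fun d z"
  proof (cases "z \<in> cball 0 1")
    case True
    have eq: "(\<Sum>i\<le>n. c i * z ^ i * (d (n - i) * z ^ (n - i))) = conv c d n * z ^ n" for n
      unfolding conv_def sum_distrib_right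
      by (rule sum.cong) (auto simp: power_add[symmetric] algebra_simps)
    show ?thesis
      using Cauchy_product_sums[OF disc_abs_summable[OF assms(1) True] disc_abs_summable[OF assms(2) True]] True
      by (simp add: eq disc_fun_def sums_iff)
  qed (auto simp: disc_fun_def)
qed

lemma conv_delta: "conv c (delta k) n = (if k \<le> n then c (n - k) else 0)"
proof -
  have "conv c (delta k) n = (\<Sum>i\<le>n. if i = n - k \<and> k \<le> n then c i else 0)"
    unfolding conv_def delta_def by (rule sum.cong) auto
  also have "\<dots> = (if k \<le> n then c (n - k) else 0)"
    by (cases "k \<le> n") (auto simp: sum.delta)
  finally show ?thesis .
qed

lemma conv_commute: "conv c d = conv d c"
proof
  fix n
  show "conv c d n = conv d c n"
    unfolding conv_def
    by (rule sum.reindex_bij_witness[where i="\<lambda>i. n - i" and j="\<lambda>i. n - i"]) auto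
qed

lemma delta_abs_summable: "summable (\<lambda>n. cmod (delta k n))"
  by (rule summable_finite[of "{k}"]) (auto simp: delta_def)

lemma disc_fun_delta: "disc_fun (delta k) = (\<lambda>z. if z \<in> cball 0 1 then z ^ k else 0)"
proof
  fix z :: complex
  have "(\<Sum>n. delta k n * z ^ n) = (\<Sum>n\<in>{k}. delta k n * z ^ n)"
    by (rule suminf_finite) (auto simp: delta_def)
  then show "disc_fun (delta k) z = (if z \<in> cball 0 1 then z ^ k else 0)"
    by (simp add: disc_fun_def delta_def)
qed

lemma disc_fun_cmod_le:
  assumes "summable (\<lambda>n. cmod (c n))"
  shows "cmod (disc_fun c z) \<le> (\<Sum>n. cmod (c n))"
proof (cases "z \<in> cball 0 1")
  case True
  have "cmod (disc_fun c z) \<le> (\<Sum>n. cmod (c n * z ^ n))"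
    using summable_norm[OF disc_abs_summable[OF assms True]] True by (simp add: disc_fun_def)
  also have "\<dots> \<le> (\<Sum>n. cmod (c n))"
    by (rule suminf_le[OF disc_term_le[OF True] disc_abs_summable[OF assms True] assms])
  finally show ?thesis .
qed (auto simp: disc_fun_def intro!: suminf_nonneg assms)

lemma continuous_on_disc_fun:
  assumes "summable (\<lambda>n. cmod (c n))"
  shows "continuous_on (cball 0 1) (disc_fun c)"
proof -
  have "uniform_limit (cball 0 1) (\<lambda>n z. \<Sum>i<n. c i * z ^ i) (\<lambda>z. \<Sum>i. c i * z ^ i) sequentially"
    by (rule Weierstrass_m_test[OF _ assms]) (use disc_term_le in blast)
  then have "continuous_on (cball 0 1) (\<lambda>z. \<Sum>i. c i * z ^ i)"
    by (rule uniform_limit_theorem[rotated]) (auto intro!: always_eventually continuous_intros)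
  then show ?thesis
    by (rule continuous_on_eq) (auto simp: disc_fun_def)
qed

lemma disc_fun_inj:
  assumes "summable (\<lambda>n. cmod (c n))" "summable (\<lambda>n. cmod (d n))" "disc_fun c = disc_fun d"
  shows "c = d"
proof -
  have r: "fps_conv_radius (Abs_fps x) > 0" if "summable (\<lambda>n. cmod (x n))" for x :: "nat \<Rightarrow> complex"
  proof -
    have "summable (\<lambda>n. x n * 1 ^ n)"
      using summable_norm_cancel[OF that] by simp
    from conv_radius_geI[OF this] have "1 \<le> conv_radius x" by (simp add: one_ereal_def)
    then have "0 < conv_radius x" by (rule less_le_trans[rotated]) simp
    then show ?thesis by (simp add: fps_conv_radius_def)
  qed
  have "Abs_fps c = Abs_fps d"
  proof (rule eval_fps_eqD[OF r[OF assms(1)] r[OF assms(2)]])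
    have "eventually (\<lambda>z. z \<in> ball (0::complex) 1) (nhds 0)"
      by (rule eventually_nhds_in_open) auto
    then show "\<forall>\<^sub>F z in nhds 0. eval_fps (Abs_fps c) z = eval_fps (Abs_fps d) z"
    proof eventually_elim
      case (elim z)
      then show ?case
        using fun_cong[OF assms(3), of z] by (auto simp: eval_fps_def disc_fun_def)
    qed
  qed
  then show ?thesis
    by (metis fps_nth_Abs_fps ext)
qed

lemma disc_fun_in_functions_on: "disc_fun c \<in> functions_on (cball 0 1)"
  by (auto simp: functions_on_def disc_fun_def)

lemma conv_cong: "(\<And>i. i \<le> n \<Longrightarrow> d i = d' i) \<Longrightarrow> conv c d n = conv c d' n"
  unfolding conv_def by (rule sum.cong) auto

lemma conv_sum_right: "conv c (\<lambda>n. \<Sum>j\<in>J. x j * d j n) n = (\<Sum>j\<in>J. x j * conv c (d j) n)"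
proof -
  have "conv c (\<lambda>n. \<Sum>j\<in>J. x j * d j n) n = (\<Sum>i\<le>n. \<Sum>j\<in>J. x j * (c i * d j (n - i)))"
    unfolding conv_def by (simp add: sum_distrib_left mult_ac)
  also have "\<dots> = (\<Sum>j\<in>J. \<Sum>i\<le>n. x j * (c i * d j (n - i)))" by (rule sum.swap)
  finally show ?thesis by (simp add: conv_def sum_distrib_left)
qed

lemma conv_add_right: "conv c (\<lambda>n. d n + e n) n = conv c d n + conv c e n"
  by (simp add: conv_def ring_distribs sum.distrib)

lemma conv_scale_right: "conv c (\<lambda>n. x * d n) n = x * conv c d n"
  by (simp add: conv_def sum_distrib_left mult_ac)

text \<open>
  The coefficients of \<open>z \<mapsto> c(t z)\<close>. Power series with bounded coefficients converge absolutely on the closed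
  disc only after such a dilation.
\<close>

definition dilate :: "real \<Rightarrow> (nat \<Rightarrow> complex) \<Rightarrow> nat \<Rightarrow> complex" where
  "dilate t c n = c n * complex_of_real t ^ n"

lemma dilate_conv: "dilate t (conv c d) n = conv (dilate t c) (dilate t d) n"
  unfolding dilate_def conv_def sum_distrib_right
  by (rule sum.cong) (auto simp: power_add[symmetric] mult_ac)

lemma disc_fun_dilate:
  assumes "0 \<le> t" "t \<le> 1" "z \<in> cball 0 1"
  shows "disc_fun (dilate t c) z = disc_fun c (complex_of_real t * z)"
proof -
  have "complex_of_real t * z \<in> cball 0 1"
    using assms by (simp add: norm_mult mult_le_one)
  then show ?thesis using assms by (simp add: disc_fun_def dilate_def power_mult_distrib mult_ac)
qed

lemma dilate_abs_summable_bounded: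
  assumes "\<And>n. cmod (c n) \<le> B" "0 \<le> t" "t < 1"
  shows "summable (\<lambda>n. cmod (dilate t c n))"
proof -
  have "summable (\<lambda>n. B * t ^ n)" using assms by (intro summable_mult summable_geometric) auto
  then show ?thesis
    by (rule summable_comparison_test'[of _ 0])
      (use assms in \<open>auto simp: dilate_def norm_mult norm_power intro!: mult_right_mono\<close>)
qed

lemma dilate_abs_summable:
  assumes "summable (\<lambda>n. cmod (c n))" "0 \<le> t" "t \<le> 1"
  shows "summable (\<lambda>n. cmod (dilate t c n))"
  by (rule summable_comparison_test'[OF assms(1), of 0])
    (use assms in \<open>auto simp: dilate_def norm_mult norm_power mult_left_le power_le_one\<close>)

section \<open>Weighted Hilbert spaces of power series\<close>

locale weight =
  fixes a :: "nat \<Rightarrow> real"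
  assumes a_pos: "0 < a n" and a_summable: "summable a"
begin

text \<open>
  The squared norm of the truncation to degree \<open>N\<close>. Multiplication operators are lower triangular, so norm
  inequalities can be proved degree by degree, as inequalities between finite sums that hold for arbitrary
  sequences.
\<close>

definition Q :: "nat \<Rightarrow> (nat \<Rightarrow> complex) \<Rightarrow> real" where
  "Q N c = (\<Sum>n\<le>N. (cmod (c n))\<^sup>2 / a n)"

definition ell :: "(nat \<Rightarrow> complex) set" where
  "ell = {c. summable (\<lambda>n. (cmod (c n))\<^sup>2 / a n)}"

definition nsq :: "(nat \<Rightarrow> complex) \<Rightarrow> real" where
  "nsq c = (\<Sum>n. (cmod (c n))\<^sup>2 / a n)"

definition inner :: "(nat \<Rightarrow> complex) \<Rightarrow> (nat \<Rightarrow> complex) \<Rightarrow> complex" where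
  "inner c d = (\<Sum>n. c n * cnj (d n) / complex_of_real (a n))"

definition space :: "(complex \<Rightarrow> complex) set" where
  "space = disc_fun ` ell"

definition coef :: "(complex \<Rightarrow> complex) \<Rightarrow> nat \<Rightarrow> complex" where
  "coef = inv_into ell disc_fun"

definition ip :: "(complex \<Rightarrow> complex) \<Rightarrow> (complex \<Rightarrow> complex) \<Rightarrow> complex" where
  "ip f g = inner (coef f) (coef g)"

definition ker :: "complex \<Rightarrow> complex \<Rightarrow> complex" where
  "ker z w = (if z \<in> cball 0 1 \<and> w \<in> cball 0 1
     then \<Sum>n. complex_of_real (a n) * (z * cnj w) ^ n else 0)"

lemma a_nonneg [simp]: "0 \<le> a n" and a_neq0 [simp]: "a n \<noteq> 0"
  using a_pos[of n] by auto

lemma Q_nonneg: "0 \<le> Q N c"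
  by (auto simp: Q_def intro!: sum_nonneg)

lemma Q_cong: "(\<And>n. n \<le> N \<Longrightarrow> c n = d n) \<Longrightarrow> Q N c = Q N d"
  by (simp add: Q_def)

lemma Q_scale: "Q N (\<lambda>n. x * c n) = (cmod x)\<^sup>2 * Q N c"
  by (simp add: Q_def norm_mult power_mult_distrib sum_distrib_left)

lemma Q_mono: "M \<le> N \<Longrightarrow> Q M c \<le> Q N c"
  unfolding Q_def by (rule sum_mono2) auto

lemma nsq_nonneg: "c \<in> ell \<Longrightarrow> 0 \<le> nsq c"
  unfolding nsq_def ell_def by (auto intro!: suminf_nonneg)

lemma Q_le_nsq: "c \<in> ell \<Longrightarrow> Q N c \<le> nsq c"
  unfolding Q_def nsq_def ell_def by (auto intro!: sum_le_suminf)

lemma term_le_nsq: "c \<in> ell \<Longrightarrow> (cmod (c n))\<^sup>2 / a n \<le> nsq c"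
  using sum_le_suminf[of "\<lambda>n. (cmod (c n))\<^sup>2 / a n" "{n}"] by (auto simp: nsq_def ell_def)

lemma ellI_bounded:
  assumes "\<And>N. Q N c \<le> B"
  shows "c \<in> ell" "nsq c \<le> B"
proof -
  have b: "(\<Sum>n<N. (cmod (c n))\<^sup>2 / a n) \<le> B" for N
  proof -
    have "(\<Sum>n<N. (cmod (c n))\<^sup>2 / a n) \<le> Q N c"
      unfolding Q_def by (rule sum_mono2) auto
    with assms[of N] show ?thesis by simp
  qed
  then have s: "summable (\<lambda>n. (cmod (c n))\<^sup>2 / a n)"
    by (intro summableI_nonneg_bounded[of _ B]) auto
  then show "c \<in> ell" by (simp add: ell_def)
  show "nsq c \<le> B"
    unfolding nsq_def by (rule suminf_le_const[OF s b])
qed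

text \<open>
  By the arithmetic-geometric mean inequality \<open>|c n|\<close> is at most \<open>|c n|^2 / a n + a n\<close>. Hence the series
  converge up to the boundary and the closed disc is a legitimate domain.
\<close>

lemma ell_abs_summable:
  assumes "c \<in> ell"
  shows "summable (\<lambda>n. cmod (c n))"
proof -
  have "summable (\<lambda>n. (cmod (c n))\<^sup>2 / a n + a n)"
    using assms a_summable by (auto simp: ell_def intro!: summable_add)
  then show ?thesis
  proof (rule summable_comparison_test'[of _ 0])
    fix n :: nat
    have "0 \<le> (cmod (c n) - a n)\<^sup>2 + (cmod (c n)) * a n" by simp
    then have "cmod (c n) * a n \<le> ((cmod (c n))\<^sup>2 + a n * a n)"
      by (simp add: power2_eq_square algebra_simps)
    then show "norm (cmod (c n)) \<le> (cmod (c n))\<^sup>2 / a n + a n"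
      using a_pos[of n] by (simp add: field_simps)
  qed
qed

lemma ell_add:
  assumes "c \<in> ell" "d \<in> ell"
  shows "(\<lambda>n. c n + d n) \<in> ell"
proof -
  have s: "summable (\<lambda>n. 2 * ((cmod (c n))\<^sup>2 / a n) + 2 * ((cmod (d n))\<^sup>2 / a n))"
    using assms unfolding ell_def mem_Collect_eq by (intro summable_add summable_mult)
  have "summable (\<lambda>n. (cmod (c n + d n))\<^sup>2 / a n)"
  proof (rule summable_comparison_test'[OF s, of 0])
    fix n :: nat
    have "(cmod (c n + d n))\<^sup>2 \<le> (cmod (c n) + cmod (d n))\<^sup>2"
      by (rule power_mono) (auto simp: norm_triangle_ineq)
    also have "\<dots> \<le> 2 * (cmod (c n))\<^sup>2 + 2 * (cmod (d n))\<^sup>2"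
      using zero_le_power2[of "cmod (c n) - cmod (d n)"] by (simp add: power2_eq_square algebra_simps)
    finally have "(cmod (c n + d n))\<^sup>2 / a n \<le> (2 * (cmod (c n))\<^sup>2 + 2 * (cmod (d n))\<^sup>2) / a n"
      by (rule divide_right_mono) simp
    then show "norm ((cmod (c n + d n))\<^sup>2 / a n) \<le> 2 * ((cmod (c n))\<^sup>2 / a n) + 2 * ((cmod (d n))\<^sup>2 / a n)"
      by (simp add: add_divide_distrib)
  qed
  then show ?thesis by (simp add: ell_def)
qed

lemma ell_scale: "c \<in> ell \<Longrightarrow> (\<lambda>n. x * c n) \<in> ell"
  using summable_mult[of "\<lambda>n. (cmod (c n))\<^sup>2 / a n" "(cmod x)\<^sup>2"]
  by (simp add: ell_def norm_mult power_mult_distrib)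

lemma ell_diff:
  assumes "c \<in> ell" "d \<in> ell"
  shows "(\<lambda>n. c n - d n) \<in> ell"
  using ell_add[OF assms(1) ell_scale[OF assms(2), of "-1"]] by simp

lemma ell_finite_support:
  assumes "\<And>n. n > N \<Longrightarrow> c n = 0"
  shows "c \<in> ell"
  unfolding ell_def mem_Collect_eq
  by (rule summable_finite[of "{..N}"]) (auto simp: assms)

lemma nsq_finite_support:
  assumes "\<And>n. n > N \<Longrightarrow> c n = 0"
  shows "nsq c = Q N c"
  unfolding nsq_def Q_def by (rule suminf_finite) (auto simp: assms)

lemma delta_ell: "delta k \<in> ell"
  by (rule ell_finite_support[of k]) (auto simp: delta_def)

lemma zero_ell: "(\<lambda>n. 0) \<in> ell"
  by (auto simp: ell_def)

lemma coef_disc_fun [simp]: "c \<in> ell \<Longrightarrow> coef (disc_fun c) = c"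
  unfolding coef_def
  by (rule inv_into_f_f) (auto intro!: inj_onI disc_fun_inj ell_abs_summable)

lemma coef_ell: "f \<in> space \<Longrightarrow> coef f \<in> ell"
  and disc_fun_coef [simp]: "f \<in> space \<Longrightarrow> disc_fun (coef f) = f"
  by (auto simp: space_def)

lemma disc_fun_in_space: "c \<in> ell \<Longrightarrow> disc_fun c \<in> space"
  by (auto simp: space_def)

lemma disc_fun_in_space_iff:
  assumes "summable (\<lambda>n. cmod (c n))"
  shows "disc_fun c \<in> space \<longleftrightarrow> c \<in> ell"
  using disc_fun_inj[OF assms] by (auto simp: space_def dest: ell_abs_summable)

lemma inner_abs_summable:
  assumes "c \<in> ell" "d \<in> ell"
  shows "summable (\<lambda>n. cmod (c n * cnj (d n) / complex_of_real (a n)))"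
proof -
  have s: "summable (\<lambda>n. (cmod (c n))\<^sup>2 / a n + (cmod (d n))\<^sup>2 / a n)"
    using assms by (auto simp: ell_def intro!: summable_add)
  show ?thesis
  proof (rule summable_comparison_test'[OF s, of 0])
    fix n :: nat
    have "0 \<le> (cmod (c n) - cmod (d n))\<^sup>2 + (cmod (c n)) * cmod (d n)" by simp
    then have "cmod (c n) * cmod (d n) \<le> (cmod (c n))\<^sup>2 + (cmod (d n))\<^sup>2"
      by (simp add: power2_eq_square algebra_simps)
    then have "cmod (c n) * cmod (d n) / a n \<le> ((cmod (c n))\<^sup>2 + (cmod (d n))\<^sup>2) / a n"
      by (rule divide_right_mono) simp
    then show "norm (cmod (c n * cnj (d n) / complex_of_real (a n))) \<le> (cmod (c n))\<^sup>2 / a n + (cmod (d n))\<^sup>2 / a n"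
      by (simp add: norm_mult norm_divide add_divide_distrib)
  qed
qed

lemmas inner_summable = summable_norm_cancel[OF inner_abs_summable]

lemma inner_self:
  assumes "c \<in> ell"
  shows "inner c c = complex_of_real (nsq c)"
proof -
  have "inner c c = (\<Sum>n. complex_of_real ((cmod (c n))\<^sup>2 / a n))"
    unfolding inner_def by (simp flip: complex_norm_square)
  also have "\<dots> = complex_of_real (nsq c)"
    using assms unfolding ell_def nsq_def mem_Collect_eq by (rule suminf_of_real[symmetric])
  finally show ?thesis .
qed

lemma ip_norm_disc_fun: "c \<in> ell \<Longrightarrow> ip_norm ip (disc_fun c) = sqrt (nsq c)"
  by (simp add: ip_norm_def ip_def inner_self)

lemma nsq_eq_0:
  assumes "c \<in> ell" "nsq c = 0"
  shows "c = (\<lambda>n. 0)"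
proof
  fix n
  have "(cmod (c n))\<^sup>2 / a n \<le> 0" using term_le_nsq[OF assms(1), of n] assms(2) by simp
  then show "c n = 0" using a_pos[of n] by (simp add: divide_le_0_iff)
qed

lemma disc_fun_zero: "disc_fun (\<lambda>n. 0) = (\<lambda>z. 0)"
  by (auto simp: disc_fun_def)

text \<open>
  The usual argument for sequence spaces: a Cauchy sequence converges in each coefficient, and the
  norm estimates pass to the limit one truncation at a time.
\<close>

lemma ell_complete:
  assumes u: "\<And>m. u m \<in> ell"
    and cauchy: "\<And>e. e > 0 \<Longrightarrow> \<exists>N. \<forall>m\<ge>N. \<forall>n\<ge>N. sqrt (nsq (\<lambda>i. u m i - u n i)) < e"
  shows "\<exists>c\<in>ell. (\<lambda>m. sqrt (nsq (\<lambda>i. u m i - c i))) \<longlonglongrightarrow> 0"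
proof -
  have "Cauchy (\<lambda>m. u m i)" for i
  proof (rule metric_CauchyI)
    fix e :: real assume e: "e > 0"
    then have "e / sqrt (a i) > 0" using a_pos by simp
    from cauchy[OF this] obtain N where
      N: "\<forall>m\<ge>N. \<forall>n\<ge>N. sqrt (nsq (\<lambda>i. u m i - u n i)) < e / sqrt (a i)" by blast
    have "dist (u m i) (u n i) < e" if "m \<ge> N" "n \<ge> N" for m n
    proof -
      have "sqrt ((cmod (u m i - u n i))\<^sup>2 / a i) \<le> sqrt (nsq (\<lambda>i. u m i - u n i))"
        using term_le_nsq[OF ell_diff[OF u u]] by simp
      also have "\<dots> < e / sqrt (a i)" using N that by blast
      finally have "cmod (u m i - u n i) / sqrt (a i) < e / sqrt (a i)"
        by (simp add: real_sqrt_divide)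
      then show ?thesis using a_pos[of i] by (simp add: dist_norm divide_less_cancel)
    qed
    then show "\<exists>M. \<forall>m\<ge>M. \<forall>n\<ge>M. dist (u m i) (u n i) < e" by blast
  qed
  then have "\<exists>l. (\<lambda>m. u m i) \<longlonglongrightarrow> l" for i
    using Cauchy_convergent convergent_def by blast
  then obtain c where c: "\<And>i. (\<lambda>m. u m i) \<longlonglongrightarrow> c i" by metis
  have main: "(\<lambda>i. u m i - c i) \<in> ell \<and> nsq (\<lambda>i. u m i - c i) \<le> e\<^sup>2"
    if N: "\<forall>m\<ge>N. \<forall>n\<ge>N. sqrt (nsq (\<lambda>i. u m i - u n i)) < e" and m: "m \<ge> N" and e: "e > 0" for m N e
  proof -
    have "Q K (\<lambda>i. u m i - c i) \<le> e\<^sup>2" for K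
    proof (rule tendsto_upperbound)
      show "(\<lambda>n. Q K (\<lambda>i. u m i - u n i)) \<longlonglongrightarrow> Q K (\<lambda>i. u m i - c i)"
        unfolding Q_def by (intro tendsto_intros c) simp
      show "\<forall>\<^sub>F n in sequentially. Q K (\<lambda>i. u m i - u n i) \<le> e\<^sup>2"
        unfolding eventually_sequentially
      proof (intro exI[of _ N] allI impI)
        fix n assume "n \<ge> N"
        then have "sqrt (nsq (\<lambda>i. u m i - u n i)) \<le> e" using N m by force
        then have "nsq (\<lambda>i. u m i - u n i) \<le> e\<^sup>2"
          by (rule sqrt_le_D)
        then show "Q K (\<lambda>i. u m i - u n i) \<le> e\<^sup>2"
          using Q_le_nsq[OF ell_diff[OF u u], of K m n] by linarith
      qed
    qed simp
    then show ?thesis using ellI_bounded by blast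
  qed
  obtain N1 where N1: "\<forall>m\<ge>N1. \<forall>n\<ge>N1. sqrt (nsq (\<lambda>i. u m i - u n i)) < 1" using cauchy[of 1] by auto
  have d: "(\<lambda>i. u m i - c i) \<in> ell" if "m \<ge> N1" for m using main[OF N1 that] by simp
  have cell: "c \<in> ell"
    using ell_diff[OF u[of N1] d[of N1]] by simp
  moreover have "(\<lambda>m. sqrt (nsq (\<lambda>i. u m i - c i))) \<longlonglongrightarrow> 0"
  proof (rule LIMSEQ_I)
    fix r :: real assume r: "r > 0"
    obtain N where N: "\<forall>m\<ge>N. \<forall>n\<ge>N. sqrt (nsq (\<lambda>i. u m i - u n i)) < r / 2" using cauchy[of "r/2"] r by auto
    have "norm (sqrt (nsq (\<lambda>i. u m i - c i)) - 0) < r" if "m \<ge> N" for m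
    proof -
      have "nsq (\<lambda>i. u m i - c i) \<le> (r/2)\<^sup>2" using main[OF N that] r by simp
      then have "sqrt (nsq (\<lambda>i. u m i - c i)) \<le> r / 2" using r by (intro real_le_lsqrt) auto
      then show ?thesis using r nsq_nonneg[OF ell_diff[OF u cell]] by simp
    qed
    then show "\<exists>N. \<forall>m\<ge>N. norm (sqrt (nsq (\<lambda>i. u m i - c i)) - 0) < r" by blast
  qed
  ultimately show ?thesis by blast
qed

lemma kernel_coef_ell:
  assumes "w \<in> cball 0 1"
  shows "(\<lambda>n. complex_of_real (a n) * cnj w ^ n) \<in> ell"
proof -
  have "summable (\<lambda>n. a n)" by (rule a_summable)
  then have "summable (\<lambda>n. (cmod (complex_of_real (a n) * cnj w ^ n))\<^sup>2 / a n)"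
  proof (rule summable_comparison_test'[of _ 0])
    fix n :: nat
    have "cmod w ^ n \<le> 1" using assms by (simp add: power_le_one)
    then have "(cmod w ^ n)\<^sup>2 \<le> 1" by (simp add: power_le_one)
    moreover have "(cmod (complex_of_real (a n) * cnj w ^ n))\<^sup>2 / a n = a n * (cmod w ^ n)\<^sup>2"
      by (simp add: norm_mult norm_power power2_eq_square)
    ultimately show "norm ((cmod (complex_of_real (a n) * cnj w ^ n))\<^sup>2 / a n) \<le> a n"
      using a_pos[of n] by (simp add: mult_left_le)
  qed
  then show ?thesis by (simp add: ell_def)
qed

lemma ker_eq_disc_fun:
  assumes "w \<in> cball 0 1"
  shows "(\<lambda>z. ker z w) = disc_fun (\<lambda>n. complex_of_real (a n) * cnj w ^ n)"
  using assms by (auto simp: ker_def disc_fun_def power_mult_distrib mult_ac)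

lemma ker_sums:
  assumes "z \<in> cball 0 1" "w \<in> cball 0 1"
  shows "(\<lambda>n. complex_of_real (a n) * (z * cnj w) ^ n) sums ker z w"
proof -
  have "summable (\<lambda>n. complex_of_real (a n) * cnj w ^ n * z ^ n)"
    by (rule disc_summable[OF ell_abs_summable[OF kernel_coef_ell[OF assms(2)]] assms(1)])
  then show ?thesis
    using assms by (simp add: ker_def power_mult_distrib mult_ac summable_sums)
qed

lemma space_zero: "(\<lambda>z. 0) \<in> space"
  using disc_fun_in_space[OF zero_ell] by (simp add: disc_fun_zero)

lemma space_add_coef:
  assumes "f \<in> space" "g \<in> space"
  shows "(\<lambda>z. f z + g z) = disc_fun (\<lambda>n. coef f n + coef g n)"
  using disc_fun_add[OF ell_abs_summable[OF coef_ell[OF assms(1)]] ell_abs_summable[OF coef_ell[OF assms(2)]]] assms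
  by simp

lemma space_diff_coef:
  assumes "f \<in> space" "g \<in> space"
  shows "(\<lambda>z. f z - g z) = disc_fun (\<lambda>n. coef f n - coef g n)"
  using disc_fun_diff[OF ell_abs_summable[OF coef_ell[OF assms(1)]] ell_abs_summable[OF coef_ell[OF assms(2)]]] assms
  by simp

lemma space_scale_coef:
  assumes "f \<in> space"
  shows "(\<lambda>z. x * f z) = disc_fun (\<lambda>n. x * coef f n)"
  using disc_fun_scale[OF ell_abs_summable[OF coef_ell[OF assms(1)]]] assms by simp

lemma rkhs_space: "rkhs (cball 0 1) space ip ker"
proof
  show "space \<subseteq> functions_on (cball 0 1)"
    by (auto simp: space_def disc_fun_in_functions_on)
  show "(\<lambda>x. 0) \<in> space" by (rule space_zero)
  fix f g h :: "complex \<Rightarrow> complex" and c w z :: complex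
  show "(\<lambda>x. f x + g x) \<in> space" if "f \<in> space" "g \<in> space"
    unfolding space_add_coef[OF that] by (intro disc_fun_in_space ell_add coef_ell that)
  show "(\<lambda>x. c * f x) \<in> space" if "f \<in> space"
    unfolding space_scale_coef[OF that] by (intro disc_fun_in_space ell_scale coef_ell that)
  show "ip (\<lambda>x. f x + g x) h = ip f h + ip g h" if "f \<in> space" "g \<in> space" "h \<in> space"
    unfolding space_add_coef[OF that(1,2)] ip_def
    using suminf_add[OF inner_summable[OF coef_ell[OF that(1)] coef_ell[OF that(3)]]
        inner_summable[OF coef_ell[OF that(2)] coef_ell[OF that(3)]]]
    by (simp add: ell_add coef_ell that inner_def ring_distribs add_divide_distrib)
  show "ip (\<lambda>x. c * f x) h = c * ip f h" if "f \<in> space" "h \<in> space"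
    unfolding space_scale_coef[OF that(1)] ip_def
    using suminf_mult[OF inner_summable[OF coef_ell[OF that(1)] coef_ell[OF that(2)]], of c]
    by (simp add: ell_scale coef_ell that inner_def mult.assoc)
  show "ip g f = cnj (ip f g)" if "f \<in> space" "g \<in> space"
  proof -
    have "(\<lambda>n. cnj (coef f n * cnj (coef g n) / complex_of_real (a n))) sums cnj (inner (coef f) (coef g))"
      unfolding inner_def sums_cnj
      by (intro summable_sums inner_summable coef_ell that)
    then show ?thesis
      unfolding ip_def inner_def[of "coef g"] by (simp add: sums_iff mult.commute)
  qed
  show "0 \<le> Re (ip f f)" if "f \<in> space"
    by (simp add: ip_def inner_self coef_ell that nsq_nonneg)
  show "f = (\<lambda>x. 0)" if "f \<in> space" "ip f f = 0"
  proof -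
    have "nsq (coef f) = 0" using that by (simp add: ip_def inner_self coef_ell)
    then have "coef f = (\<lambda>n. 0)" by (rule nsq_eq_0[OF coef_ell[OF that(1)]])
    then have "disc_fun (coef f) = disc_fun (\<lambda>n. 0)" by simp
    then show ?thesis using that(1) by (simp add: disc_fun_zero)
  qed
  show "(\<lambda>z. ker z w) \<in> space" if "w \<in> cball 0 1"
    unfolding ker_eq_disc_fun[OF that] by (intro disc_fun_in_space kernel_coef_ell that)
  show "ip f (\<lambda>z. ker z w) = f w" if "f \<in> space" "w \<in> cball 0 1"
  proof -
    have "ip f (\<lambda>z. ker z w) = (\<Sum>n. coef f n * w ^ n)"
      unfolding ip_def ker_eq_disc_fun[OF that(2)]
      by (simp add: coef_disc_fun[OF kernel_coef_ell[OF that(2)]] inner_def)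
    also have "\<dots> = disc_fun (coef f) w" using that(2) by (simp only: disc_fun_def if_True)
    finally show ?thesis using that(1) by simp
  qed
  show "ker z z \<noteq> 0" if "z \<in> cball 0 1"
  proof -
    have "(\<lambda>n. Re (complex_of_real (a n) * (z * cnj z) ^ n)) sums Re (ker z z)"
      by (rule sums_Re[OF ker_sums[OF that that]])
    moreover have "(\<lambda>n. Re (complex_of_real (a n) * (z * cnj z) ^ n)) = (\<lambda>n. a n * ((cmod z)\<^sup>2) ^ n)"
      by (auto simp: complex_norm_square[symmetric] fun_eq_iff simp flip: of_real_power)
    ultimately have s: "(\<lambda>n. a n * ((cmod z)\<^sup>2) ^ n) sums Re (ker z z)" by simp
    have "sum (\<lambda>n. a n * ((cmod z)\<^sup>2) ^ n) {0} \<le> (\<Sum>n. a n * ((cmod z)\<^sup>2) ^ n)"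
      by (rule sum_le_suminf) (use s in \<open>auto simp: sums_iff\<close>)
    then have "Re (ker z z) > 0" using s a_pos[of 0] by (auto simp: sums_iff)
    then show ?thesis by auto
  qed
next
  fix u :: "nat \<Rightarrow> complex \<Rightarrow> complex"
  assume u: "\<And>n. u n \<in> space"
    and cauchy: "\<And>e. e > 0 \<Longrightarrow> \<exists>N. \<forall>m\<ge>N. \<forall>n\<ge>N. ip_norm ip (\<lambda>x. u m x - u n x) < e"
  have "\<exists>c\<in>ell. (\<lambda>m. sqrt (nsq (\<lambda>i. coef (u m) i - c i))) \<longlonglongrightarrow> 0"
  proof (rule ell_complete)
    show "coef (u m) \<in> ell" for m by (rule coef_ell[OF u])
    show "\<exists>N. \<forall>m\<ge>N. \<forall>n\<ge>N. sqrt (nsq (\<lambda>i. coef (u m) i - coef (u n) i)) < e" if "e > 0" for e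
      using cauchy[OF that] by (simp add: space_diff_coef u ip_norm_disc_fun ell_diff coef_ell)
  qed
  then obtain c where c: "c \<in> ell" "(\<lambda>m. sqrt (nsq (\<lambda>i. coef (u m) i - c i))) \<longlonglongrightarrow> 0" by blast
  then show "\<exists>f\<in>space. (\<lambda>n. ip_norm ip (\<lambda>x. u n x - f x)) \<longlonglongrightarrow> 0"
    by (intro bexI[of _ "disc_fun c"])
      (auto simp: space_diff_coef u ip_norm_disc_fun ell_diff coef_ell disc_fun_in_space)
qed

section \<open>Multipliers of weighted spaces\<close>

lemma Q_tendsto: "c \<in> ell \<Longrightarrow> (\<lambda>N. Q N c) \<longlonglongrightarrow> nsq c"
  unfolding Q_def nsq_def ell_def by (auto intro: summable_LIMSEQ')

lemma ip_norm_square: "f \<in> space \<Longrightarrow> (ip_norm ip f)\<^sup>2 = nsq (coef f)"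
  using ip_norm_disc_fun[of "coef f"] by (simp add: coef_ell nsq_nonneg)

lemma disc_fun_multiplier:
  assumes "summable (\<lambda>n. cmod (c n))" "\<And>f. f \<in> ell \<Longrightarrow> conv c f \<in> ell"
  shows "disc_fun c \<in> Mult (cball 0 1) space"
proof -
  have "(\<lambda>x. disc_fun c x * f x) \<in> space" if "f \<in> space" for f
  proof -
    have "(\<lambda>x. disc_fun c x * disc_fun (coef f) x) = disc_fun (conv c (coef f))"
      by (rule disc_fun_conv[symmetric]) (intro assms ell_abs_summable coef_ell that)+
    then show ?thesis using disc_fun_in_space[OF assms(2)[OF coef_ell[OF that]]] that by simp
  qed
  then show ?thesis by (simp add: Mult_def disc_fun_in_functions_on)
qed

lemma sqrt_Q_L2: "sqrt (Q N c) = L2_set (\<lambda>n. cmod (c n) / sqrt (a n)) {..N}"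
  by (simp add: Q_def L2_set_def power_divide)

lemma Q_triangle: "sqrt (Q N (\<lambda>n. c n + d n)) \<le> sqrt (Q N c) + sqrt (Q N d)"
proof -
  have "sqrt (Q N (\<lambda>n. c n + d n)) \<le> L2_set (\<lambda>n. cmod (c n) / sqrt (a n) + cmod (d n) / sqrt (a n)) {..N}"
    unfolding sqrt_Q_L2
    by (rule L2_set_mono) (auto simp: add_divide_distrib[symmetric] norm_triangle_ineq intro!: divide_right_mono)
  also have "\<dots> \<le> sqrt (Q N c) + sqrt (Q N d)"
    unfolding sqrt_Q_L2 by (rule L2_set_triangle_ineq)
  finally show ?thesis .
qed

lemma Q_zero: "Q N (\<lambda>n. 0) = 0"
  by (simp add: Q_def)

lemma Q_triangle_sum: "finite J \<Longrightarrow> sqrt (Q N (\<lambda>n. \<Sum>j\<in>J. c j n)) \<le> (\<Sum>j\<in>J. sqrt (Q N (c j)))"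
proof (induction J rule: finite_induct)
  case (insert j J)
  then show ?case using Q_triangle[of N "c j" "\<lambda>n. \<Sum>j\<in>J. c j n"] by simp
qed (simp add: Q_zero)

lemma sqrt_Q_scale: "sqrt (Q N (\<lambda>n. x * c n)) = cmod x * sqrt (Q N c)"
  by (simp add: Q_scale real_sqrt_mult)

lemma coeff_le_Q: "n \<le> N \<Longrightarrow> (cmod (c n))\<^sup>2 / a n \<le> Q N c"
  unfolding Q_def by (intro member_le_sum) auto

lemma coeff_le_sqrt_Q:
  assumes "n \<le> N"
  shows "cmod (c n) \<le> sqrt (a n) * sqrt (Q N c)"
proof -
  have "(cmod (c n))\<^sup>2 \<le> a n * Q N c"
    using coeff_le_Q[OF assms, of c] a_pos[of n] by (simp add: divide_le_eq mult.commute)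
  then have "cmod (c n) \<le> sqrt (a n * Q N c)" by (rule real_le_rsqrt)
  then show ?thesis by (simp add: real_sqrt_mult)
qed

text \<open>
  On finitely many coordinates an everywhere defined lower triangular operator is bounded. Unboundedness is therefore
  a property of the tails, which allows humps to be placed arbitrarily far out.
\<close>

lemma low_part_bound:
  assumes mult: "\<And>f. f \<in> ell \<Longrightarrow> conv \<psi> f \<in> ell"
  shows "\<exists>D\<ge>0. \<forall>N f. sqrt (Q N (conv \<psi> (\<lambda>n. if n < k \<and> n \<le> N then f n else 0))) \<le> D * sqrt (Q N f)"
proof (intro exI conjI allI)
  let ?D = "\<Sum>i<k. sqrt (a i) * sqrt (nsq (conv \<psi> (delta i)))"
  show "0 \<le> ?D" by (intro sum_nonneg mult_nonneg_nonneg) (auto simp: nsq_nonneg mult delta_ell)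
  fix N :: nat and f :: "nat \<Rightarrow> complex"
  let ?c = "\<lambda>i. if i \<le> N then f i else 0"
  have "(\<lambda>n. if n < k \<and> n \<le> N then f n else 0) = (\<lambda>n. \<Sum>i<k. ?c i * delta i n)"
  proof
    fix n
    have "(\<Sum>i<k. ?c i * delta i n) = (\<Sum>i<k. if i = n then ?c n else 0)"
      by (rule sum.cong) (auto simp: delta_def)
    then show "(if n < k \<and> n \<le> N then f n else 0) = (\<Sum>i<k. ?c i * delta i n)" by auto
  qed
  then have "conv \<psi> (\<lambda>n. if n < k \<and> n \<le> N then f n else 0) = (\<lambda>n. \<Sum>i<k. ?c i * conv \<psi> (delta i) n)"
    by (simp only: conv_sum_right[abs_def])
  then have "sqrt (Q N (conv \<psi> (\<lambda>n. if n < k \<and> n \<le> N then f n else 0))) \<le> (\<Sum>i<k. sqrt (Q N (\<lambda>n. ?c i * conv \<psi> (delta i) n)))"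
    by (simp only: Q_triangle_sum finite_lessThan)
  also have "\<dots> \<le> (\<Sum>i<k. sqrt (a i) * sqrt (nsq (conv \<psi> (delta i))) * sqrt (Q N f))"
  proof (rule sum_mono)
    fix i
    have "cmod (?c i) \<le> sqrt (a i) * sqrt (Q N f)"
      using coeff_le_sqrt_Q[of i N f] by (simp add: Q_nonneg)
    then have "cmod (?c i) * sqrt (Q N (conv \<psi> (delta i))) \<le> (sqrt (a i) * sqrt (Q N f)) * sqrt (nsq (conv \<psi> (delta i)))"
      by (rule mult_mono) (auto simp: Q_nonneg Q_le_nsq mult delta_ell)
    then show "sqrt (Q N (\<lambda>n. ?c i * conv \<psi> (delta i) n)) \<le> sqrt (a i) * sqrt (nsq (conv \<psi> (delta i))) * sqrt (Q N f)"
      unfolding sqrt_Q_scale by (simp only: mult_ac)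
  qed
  also have "\<dots> = ?D * sqrt (Q N f)" by (simp add: sum_distrib_right)
  finally show "sqrt (Q N (conv \<psi> (\<lambda>n. if n < k \<and> n \<le> N then f n else 0))) \<le> ?D * sqrt (Q N f)" .
qed

lemma hump_exists:
  assumes mult: "\<And>f. f \<in> ell \<Longrightarrow> conv \<psi> f \<in> ell"
    and unbounded: "\<And>C. 0 \<le> C \<Longrightarrow> \<exists>f N. Q N (conv \<psi> f) > C\<^sup>2 * Q N f"
    and B: "0 \<le> B"
  shows "\<exists>g N. (\<forall>n. n < k \<or> N < n \<longrightarrow> g n = 0) \<and> Q N g \<le> 1 \<and> B \<le> sqrt (Q N (conv \<psi> g))"
proof -
  obtain D where D: "D \<ge> 0"
    "\<And>N f. sqrt (Q N (conv \<psi> (\<lambda>n. if n < k \<and> n \<le> N then f n else 0))) \<le> D * sqrt (Q N f)"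
    using low_part_bound[OF mult, of k] by blast
  obtain f N where fN: "Q N (conv \<psi> f) > (B + D)\<^sup>2 * Q N f"
    using unbounded[of "B + D"] B D by auto
  define s where "s = sqrt (Q N f)"
  have s0: "0 \<le> s" "s\<^sup>2 = Q N f" by (simp_all add: s_def Q_nonneg)
  have big: "sqrt (Q N (conv \<psi> f)) > (B + D) * s"
    using fN s0 B D by (intro real_less_rsqrt) (simp add: power_mult_distrib)
  have "s \<noteq> 0"
  proof
    assume "s = 0"
    then have "f n = 0" if "n \<le> N" for n
      using coeff_le_sqrt_Q[OF that, of f] by (simp add: s_def)
    then have "Q N (conv \<psi> f) = Q N (\<lambda>n. 0)"
      by (intro Q_cong) (auto simp: conv_def intro!: sum.neutral)
    then show False using big \<open>s = 0\<close> by (simp add: Q_zero)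
  qed
  then have s: "s > 0" using s0 by simp
  let ?low = "\<lambda>n. if n < k \<and> n \<le> N then f n else 0"
  let ?h = "\<lambda>n. if k \<le> n \<and> n \<le> N then f n else 0"
  have "Q N (conv \<psi> f) = Q N (\<lambda>n. conv \<psi> ?h n + conv \<psi> ?low n)"
  proof (rule Q_cong)
    fix n assume n: "n \<le> N"
    have "conv \<psi> f n = conv \<psi> (\<lambda>n. ?h n + ?low n) n"
      by (rule conv_cong) (use n in auto)
    then show "conv \<psi> f n = conv \<psi> ?h n + conv \<psi> ?low n" by (simp only: conv_add_right)
  qed
  then have "sqrt (Q N (conv \<psi> f)) \<le> sqrt (Q N (conv \<psi> ?h)) + sqrt (Q N (conv \<psi> ?low))"
    using Q_triangle by simp
  then have h: "B * s \<le> sqrt (Q N (conv \<psi> ?h))"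
    using D(2)[of N f] big unfolding s_def[symmetric] by (simp add: ring_distribs)
  let ?g = "\<lambda>n. complex_of_real (1 / s) * ?h n"
  have "Q N ?h \<le> Q N f" unfolding Q_def by (intro sum_mono) auto
  moreover have "cmod (complex_of_real (1 / s)) = 1 / s" using s by (simp only: norm_of_real) simp
  ultimately have "Q N ?g \<le> 1" unfolding Q_scale using s s0(2)[symmetric] by (simp add: power_divide)
  moreover have "B \<le> sqrt (Q N (conv \<psi> ?g))"
  proof -
    have "conv \<psi> ?g = (\<lambda>n. complex_of_real (1 / s) * conv \<psi> ?h n)" by (rule ext) (rule conv_scale_right)
    then have "sqrt (Q N (conv \<psi> ?g)) = cmod (complex_of_real (1 / s)) * sqrt (Q N (conv \<psi> ?h))" by (simp only: sqrt_Q_scale)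
    also have "\<dots> = sqrt (Q N (conv \<psi> ?h)) / s" using s by (simp add: norm_divide)
    finally have "sqrt (Q N (conv \<psi> ?g)) = sqrt (Q N (conv \<psi> ?h)) / s" .
    then show ?thesis using h s by (simp add: le_divide_eq)
  qed
  ultimately show ?thesis by (intro exI[of _ ?g] exI[of _ N]) auto
qed

text \<open>
  A gliding hump in place of the closed graph theorem. If multiplication were unbounded, vectors
  with supports further and further out could be added up so that the image is large on windows
  that the later summands do not touch, because multiplication never lowers the degree. The sum would lie in the
  space and its image would not.
\<close>

lemma multiplication_bounded:
  assumes mult: "\<And>f. f \<in> ell \<Longrightarrow> conv \<psi> f \<in> ell"
  shows "\<exists>C\<ge>0. \<forall>f N. Q N (conv \<psi> f) \<le> C\<^sup>2 * Q N f"
proof (rule ccontr)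
  assume "\<not> ?thesis"
  then have unbounded: "\<And>C. 0 \<le> C \<Longrightarrow> \<exists>f N. Q N (conv \<psi> f) > C\<^sup>2 * Q N f"
    by (meson not_le)
  \<comment> \<open>A state consists of the partial sum of the humps and a bound for its support. Beyond this bound
    the partial sum may still be changed; below it everything is settled.\<close>
  define P where "P j x \<longleftrightarrow> (\<forall>n\<ge>snd x. fst x n = 0) \<and> j \<le> snd x \<and>
     (\<forall>N. sqrt (Q N (fst x)) \<le> (\<Sum>i<j. (1 / 2) ^ i))" for j and x :: "(nat \<Rightarrow> complex) \<times> nat"
  define R where "R j x y \<longleftrightarrow> snd x \<le> snd y \<and> (\<forall>n<snd x. fst y n = fst x n) \<and>
     (\<exists>N<snd y. real j \<le> sqrt (Q N (conv \<psi> (fst y))))" for j and x y :: "(nat \<Rightarrow> complex) \<times> nat"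
  have "\<exists>s. \<forall>j. P j (s j) \<and> R j (s j) (s (Suc j))"
  proof (rule dependent_nat_choice)
    show "\<exists>x. P 0 x" by (rule exI[of _ "(\<lambda>n. 0, 0)"]) (simp add: P_def Q_zero)
    fix x j assume x: "P j x"
    obtain F k where Fk: "x = (F, k)" by force
    have F: "\<And>n. n \<ge> k \<Longrightarrow> F n = 0" "j \<le> k" "\<And>N. sqrt (Q N F) \<le> (\<Sum>i<j. (1 / 2) ^ i)"
      using x by (auto simp: P_def Fk)
    have Fell: "F \<in> ell" by (rule ell_finite_support[of k]) (use F in auto)
    \<comment> \<open>The hump is scaled by \<open>2^-j\<close> to make the norms summable; it must still outweigh \<open>j\<close> and the image of
      the earlier humps.\<close>
    let ?B = "2 ^ j * (real j + sqrt (nsq (conv \<psi> F)))"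
    have "0 \<le> ?B" by (simp add: nsq_nonneg mult Fell)
    from hump_exists[OF mult unbounded this, of k] obtain g N where
      g: "\<And>n. n < k \<or> N < n \<Longrightarrow> g n = 0" "Q N g \<le> 1" "?B \<le> sqrt (Q N (conv \<psi> g))" by blast
    let ?w = "complex_of_real ((1 / 2) ^ j)"
    have w: "cmod ?w = (1 / 2) ^ j" by (simp add: norm_power norm_divide)
    define F' where "F' n = F n + ?w * g n" for n
    define k' where "k' = Suc (max k N)"
    have g1: "sqrt (Q M g) \<le> 1" for M
    proof -
      have "Q M g \<le> Q (max M N) g" by (rule Q_mono) simp
      also have "\<dots> = Q N g"
        unfolding Q_def by (rule sum.mono_neutral_right) (auto simp: g(1))
      finally show ?thesis using g(2) by (simp add: Q_nonneg)
    qed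
    have "sqrt (Q M F') \<le> (\<Sum>i<Suc j. (1 / 2) ^ i)" for M
    proof -
      have "sqrt (Q M F') \<le> sqrt (Q M F) + sqrt (Q M (\<lambda>n. ?w * g n))" unfolding F'_def[abs_def] by (rule Q_triangle)
      also have "\<dots> \<le> (\<Sum>i<j. (1 / 2) ^ i) + (1 / 2) ^ j * 1"
        unfolding sqrt_Q_scale w by (intro add_mono F mult_left_mono g1) auto
      finally show ?thesis by simp
    qed
    moreover have "F' n = 0" if "k' \<le> n" for n
    proof -
      have "k \<le> n" "N < n" using that by (simp_all add: k'_def)
      then show ?thesis using F(1)[of n] g(1)[of n] by (simp add: F'_def)
    qed
    ultimately have P': "P (Suc j) (F', k')"
      using F(2) by (simp add: P_def k'_def)
    have "real j \<le> sqrt (Q N (conv \<psi> F'))"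
    proof -
      have "(\<lambda>n. ?w * conv \<psi> g n) = (\<lambda>n. conv \<psi> F' n + (-1) * conv \<psi> F n)"
        unfolding F'_def[abs_def] conv_add_right conv_scale_right by auto
      then have "sqrt (Q N (\<lambda>n. ?w * conv \<psi> g n)) \<le> sqrt (Q N (conv \<psi> F')) + sqrt (Q N (\<lambda>n. (-1) * conv \<psi> F n))"
        by (simp only: Q_triangle)
      then have "(1 / 2) ^ j * sqrt (Q N (conv \<psi> g)) \<le> sqrt (Q N (conv \<psi> F')) + sqrt (Q N (conv \<psi> F))"
        unfolding sqrt_Q_scale w by simp
      moreover have "(1 / 2) ^ j * ?B \<le> (1 / 2) ^ j * sqrt (Q N (conv \<psi> g))" by (rule mult_left_mono[OF g(3)]) simp
      moreover have "(1 / 2) ^ j * ?B = real j + sqrt (nsq (conv \<psi> F))"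
        by (simp add: power_divide)
      moreover have "sqrt (Q N (conv \<psi> F)) \<le> sqrt (nsq (conv \<psi> F))" by (simp add: Q_le_nsq mult Fell)
      ultimately show ?thesis by linarith
    qed
    then have "R j x (F', k')"
      using g(1) by (auto simp: R_def Fk F'_def k'_def intro!: exI[of _ N])
    with P' show "\<exists>y. P (Suc j) y \<and> R j x y" by blast
  qed
  then obtain s where sP: "\<And>j. P j (s j)" and sR: "\<And>j. R j (s j) (s (Suc j))" by blast
  define F where "F j = fst (s j)" for j
  define k where "k j = snd (s j)" for j
  have k_mono: "mono k" using sR by (intro incseq_SucI) (simp add: R_def k_def)
  have kj: "j \<le> k j" for j using sP[of j] by (simp add: P_def k_def)
  have stable: "F i n = F j n" if "j \<le> i" "n < k j" for i j n
    using that(1)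
  proof (induction i rule: dec_induct)
    case (step i)
    have "n < k i" using that(2) monoD[OF k_mono step(1)] by simp
    then show ?case using sR[of i] step by (simp add: R_def F_def k_def)
  qed simp
  define G where "G n = F (Suc n) n" for n
  have G: "G n = F j n" if "n < k j" for n j
  proof -
    have "n < k (Suc n)" using kj[of "Suc n"] by simp
    then show ?thesis
      using stable[of j "max j (Suc n)" n] stable[of "Suc n" "max j (Suc n)" n] that by (simp add: G_def)
  qed
  have "Q N G \<le> 2\<^sup>2" for N
  proof -
    have "Q N G = Q N (F (Suc N))"
      by (rule Q_cong) (use G kj[of "Suc N"] in auto)
    moreover have "sqrt (Q N (F (Suc N))) \<le> (\<Sum>i<Suc N. (1 / 2) ^ i)"
      using sP[of "Suc N"] by (simp add: P_def F_def del: sum.lessThan_Suc)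
    moreover have "(\<Sum>i<Suc N. (1 / 2::real) ^ i) \<le> 2"
      by (simp add: sum_gp_strict del: sum.lessThan_Suc)
    ultimately have "sqrt (Q N G) \<le> 2" by simp
    then show ?thesis by (rule sqrt_le_D)
  qed
  then have "G \<in> ell" by (rule ellI_bounded)
  then have GG: "conv \<psi> G \<in> ell" by (rule mult)
  obtain j :: nat where j: "real j > sqrt (nsq (conv \<psi> G))" using reals_Archimedean2 by blast
  obtain N where N: "N < k (Suc j)" "real j \<le> sqrt (Q N (conv \<psi> (F (Suc j))))"
    using sR[of j] by (auto simp: R_def F_def k_def)
  have "Q N (conv \<psi> (F (Suc j))) = Q N (conv \<psi> G)"
    by (intro Q_cong conv_cong) (use G[of _ "Suc j"] N(1) in auto)
  also have "\<dots> \<le> nsq (conv \<psi> G)" by (rule Q_le_nsq[OF GG])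
  finally have "sqrt (Q N (conv \<psi> (F (Suc j)))) \<le> sqrt (nsq (conv \<psi> G))" by simp
  then show False using N(2) j by linarith
qed

lemma space_times:
  assumes "f \<in> space" "g \<in> space"
  shows "(\<lambda>x. f x * g x) = disc_fun (conv (coef f) (coef g))"
  using disc_fun_conv[OF ell_abs_summable[OF coef_ell[OF assms(1)]] ell_abs_summable[OF coef_ell[OF assms(2)]]] assms
  by simp

lemma Mult_in_space:
  assumes "\<phi> \<in> Mult (cball 0 1) space"
  shows "\<phi> \<in> space"
proof -
  have "(\<lambda>x. \<phi> x * disc_fun (delta 0) x) \<in> space"
    using assms disc_fun_in_space[OF delta_ell[of 0]] by (auto simp: Mult_def)
  moreover have "(\<lambda>x. \<phi> x * disc_fun (delta 0) x) = \<phi>"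
    using assms by (auto simp: Mult_def functions_on_def disc_fun_delta fun_eq_iff)
  ultimately show ?thesis by simp
qed

lemma Mult_conv_ell:
  assumes "\<phi> \<in> Mult (cball 0 1) space" "f \<in> ell"
  shows "conv (coef \<phi>) f \<in> ell"
proof -
  have "(\<lambda>x. \<phi> x * disc_fun f x) \<in> space"
    using assms by (auto simp: Mult_def disc_fun_in_space)
  moreover have "(\<lambda>x. \<phi> x * disc_fun f x) = disc_fun (conv (coef \<phi>) f)"
    using space_times[OF Mult_in_space[OF assms(1)] disc_fun_in_space[OF assms(2)]] assms(2) by simp
  moreover have "summable (\<lambda>n. cmod (conv (coef \<phi>) f n))"
    by (intro conv_abs_summable ell_abs_summable coef_ell Mult_in_space assms)
  ultimately show ?thesis by (simp add: disc_fun_in_space_iff)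
qed

lemma Mult_bounded:
  assumes "\<phi> \<in> Mult (cball 0 1) space"
  shows "\<exists>C\<ge>0. \<forall>f N. Q N (conv (coef \<phi>) f) \<le> C\<^sup>2 * Q N f"
  by (rule multiplication_bounded) (rule Mult_conv_ell[OF assms])

lemma Mult_add:
  assumes "\<phi> \<in> Mult (cball 0 1) space" "\<psi> \<in> Mult (cball 0 1) space"
  shows "(\<lambda>x. \<phi> x + \<psi> x) \<in> Mult (cball 0 1) space"
proof -
  interpret rkhs "cball 0 1" space ip ker by (rule rkhs_space)
  show ?thesis using assms
    by (auto simp: Mult_def functions_on_def ring_distribs intro!: add_in)
qed

lemma Mult_scale:
  assumes "\<phi> \<in> Mult (cball 0 1) space"
  shows "(\<lambda>x. c * \<phi> x) \<in> Mult (cball 0 1) space"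
proof -
  interpret rkhs "cball 0 1" space ip ker by (rule rkhs_space)
  show ?thesis using assms
    by (auto simp: Mult_def functions_on_def mult.assoc intro!: scale_in)
qed

lemma Mult_times:
  assumes "\<phi> \<in> Mult (cball 0 1) space" "\<psi> \<in> Mult (cball 0 1) space"
  shows "(\<lambda>x. \<phi> x * \<psi> x) \<in> Mult (cball 0 1) space"
  using assms by (auto simp: Mult_def functions_on_def mult.assoc)

lemma Mult_one: "disc_fun (delta 0) \<in> Mult (cball 0 1) space"
proof -
  have "(\<lambda>x. disc_fun (delta 0) x * f x) = f" if "f \<in> space" for f
    using that by (auto simp: space_def disc_fun_delta disc_fun_def fun_eq_iff)
  then show ?thesis by (auto simp: Mult_def disc_fun_in_functions_on)
qed

lemma point_evaluation_character:
  assumes x: "x \<in> cball 0 1"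
  shows "point_evaluation (cball 0 1) space x \<in> characters (cball 0 1) space"
proof -
  have "disc_fun (delta 0) x = 1" using x by (simp add: disc_fun_delta)
  then show ?thesis
    unfolding characters_def point_evaluation_def
    by (auto simp: Mult_add Mult_scale Mult_times intro!: bexI[OF _ Mult_one])
qed

lemma compact_point_evaluations:
  "compactin (maximal_ideal_space (cball 0 1) space) (point_evaluation (cball 0 1) space ` cball 0 1)"
proof (rule image_compactin)
  let ?X = "top_of_set (cball (0::complex) 1)"
  show "compactin ?X (cball 0 1)"
    by (simp add: compactin_subtopology)
  have cont: "continuous_map ?X euclidean \<phi>" if "\<phi> \<in> Mult (cball 0 1) space" for \<phi>
    using continuous_on_disc_fun[OF ell_abs_summable[OF coef_ell[OF Mult_in_space[OF that]]]]
      Mult_in_space[OF that] by simp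
  show "continuous_map ?X (maximal_ideal_space (cball 0 1) space) (point_evaluation (cball 0 1) space)"
    unfolding maximal_ideal_space_def
  proof (rule continuous_map_into_subtopology)
    show "continuous_map ?X (product_topology (\<lambda>\<phi>. euclidean) (Mult (cball 0 1) space)) (point_evaluation (cball 0 1) space)"
      unfolding continuous_map_componentwise
    proof (intro conjI ballI)
      show "point_evaluation (cball 0 1) space ` topspace ?X \<subseteq> extensional (Mult (cball 0 1) space)"
        by (auto simp: point_evaluation_def)
      fix \<phi> assume \<phi>: "\<phi> \<in> Mult (cball 0 1) space"
      then show "continuous_map ?X euclidean (\<lambda>x. point_evaluation (cball 0 1) space x \<phi>)"
        using cont[OF \<phi>] by (simp add: point_evaluation_def)
    qed
    show "point_evaluation (cball 0 1) space \<in> topspace ?X \<rightarrow> characters (cball 0 1) space"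
      using point_evaluation_character by auto
  qed
qed

lemma nsq_tail:
  assumes "c \<in> ell"
  shows "(\<lambda>n. if n \<le> N then 0 else c n) \<in> ell" "nsq (\<lambda>n. if n \<le> N then 0 else c n) = nsq c - Q N c"
proof -
  let ?t = "\<lambda>n. if n \<le> N then 0 else c n" and ?h = "\<lambda>n. if n \<le> N then c n else 0"
  have h: "?h \<in> ell" by (rule ell_finite_support[of N]) auto
  show t: "?t \<in> ell" using ell_diff[OF assms h] by (rule back_subst[of "\<lambda>c. c \<in> ell"]) auto
  have "nsq c = (\<Sum>n. (cmod (?h n))\<^sup>2 / a n + (cmod (?t n))\<^sup>2 / a n)"
    unfolding nsq_def by (rule suminf_cong) auto
  also have "\<dots> = nsq ?h + nsq ?t"
    unfolding nsq_def by (rule suminf_add[symmetric]) (use h t in \<open>auto simp: ell_def\<close>)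
  also have "nsq ?h = Q N ?h" by (rule nsq_finite_support) auto
  also have "Q N ?h = Q N c" by (rule Q_cong) auto
  finally show "nsq ?t = nsq c - Q N c" by simp
qed

lemma nsq_delta: "nsq (delta k) = 1 / a k"
proof -
  have "nsq (delta k) = (\<Sum>n\<in>{k}. (cmod (delta k n))\<^sup>2 / a n)"
    unfolding nsq_def by (rule suminf_finite) (auto simp: delta_def)
  then show ?thesis by (simp add: delta_def)
qed

text \<open>
  A partially multiplicative functional is determined by its value at the coordinate function, since polynomials are
  dense, and boundedness on the monomials forces this value into the disc of convergence of
  \<open>\<Sum> a n |t|^(2 n)\<close>.
\<close>

lemma maximal_domain_disc:
  assumes radius: "\<And>x B. 1 < x \<Longrightarrow> \<exists>n. B < a n * x ^ n"
  shows "maximal_domain (cball 0 1) space ip"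
  unfolding maximal_domain_def
proof (intro allI impI)
  interpret rkhs "cball 0 1" space ip ker by (rule rkhs_space)
  fix \<rho> assume \<rho>: "partially_multiplicative space ip \<rho>"
  then have add: "\<And>f g. f \<in> space \<Longrightarrow> g \<in> space \<Longrightarrow> \<rho> (\<lambda>x. f x + g x) = \<rho> f + \<rho> g"
    and scale: "\<And>c f. f \<in> space \<Longrightarrow> \<rho> (\<lambda>x. c * f x) = c * \<rho> f"
    and times: "\<And>f g. f \<in> space \<Longrightarrow> g \<in> space \<Longrightarrow> (\<lambda>x. f x * g x) \<in> space \<Longrightarrow> \<rho> (\<lambda>x. f x * g x) = \<rho> f * \<rho> g"
    unfolding partially_multiplicative_def by blast+
  obtain C where C: "\<And>f. f \<in> space \<Longrightarrow> cmod (\<rho> f) \<le> C * ip_norm ip f"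
    using \<rho> unfolding partially_multiplicative_def by blast
  obtain f0 where f0: "f0 \<in> space" "\<rho> f0 \<noteq> 0"
    using \<rho> unfolding partially_multiplicative_def by blast
  define e where "e n = disc_fun (delta n)" for n
  have e: "e n \<in> space" for n by (simp add: e_def disc_fun_in_space delta_ell)
  have e0: "(\<lambda>x. f x * e 0 x) = f" if "f \<in> space" for f
    using that by (auto simp: e_def space_def disc_fun_delta disc_fun_def fun_eq_iff)
  have "\<rho> f0 = \<rho> f0 * \<rho> (e 0)"
    using times[OF f0(1) e[of 0]] f0(1) by (simp add: e0)
  then have \<rho>0: "\<rho> (e 0) = 1" using f0(2) by simp
  have e_Suc: "(\<lambda>x. e n x * e 1 x) = e (Suc n)" for n
    by (auto simp: e_def disc_fun_delta fun_eq_iff)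
  define w where "w = \<rho> (e 1)"
  have pow: "\<rho> (e n) = w ^ n" for n
  proof (induction n)
    case (Suc n)
    have "\<rho> (e (Suc n)) = \<rho> (e n) * \<rho> (e 1)"
      using times[OF e[of n] e[of 1]] e[of "Suc n"] by (simp only: e_Suc)
    then show ?case using Suc by (simp add: w_def)
  qed (simp add: \<rho>0)
  have bound: "a n * ((cmod w)\<^sup>2) ^ n \<le> C\<^sup>2" for n
  proof -
    have "cmod w ^ n \<le> C * sqrt (1 / a n)"
      using C[OF e[of n]] unfolding pow by (simp add: norm_power e_def ip_norm_disc_fun delta_ell nsq_delta)
    then have "(cmod w ^ n)\<^sup>2 \<le> (C * sqrt (1 / a n))\<^sup>2" by (rule power_mono) simp
    also have "\<dots> = C\<^sup>2 / a n" by (simp add: power_mult_distrib)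
    finally have "(cmod w ^ n)\<^sup>2 * a n \<le> C\<^sup>2" using a_pos[of n] by (simp add: le_divide_eq)
    then show ?thesis by (simp add: power_mult[symmetric] mult.commute)
  qed
  have w: "w \<in> cball 0 1"
  proof (rule ccontr)
    assume "w \<notin> cball 0 1"
    then have "1 < (cmod w)\<^sup>2" by (simp add: one_less_power)
    then show False using radius[of "(cmod w)\<^sup>2" "C\<^sup>2"] bound by (meson not_le)
  qed
  have "\<rho> f = f w" if f: "f \<in> space" for f
  proof -
    define c where "c = coef f"
    have c: "c \<in> ell" "f = disc_fun c" using f by (simp_all add: c_def coef_ell)
    have partial: "\<rho> (disc_fun (\<lambda>n. if n < N then c n else 0)) = (\<Sum>n<N. c n * w ^ n)" for N
    proof (induction N)
      case 0
      have "\<rho> (\<lambda>x. 0 * e 0 x) = 0" by (subst scale[OF e]) simp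
      then show ?case by (simp add: disc_fun_zero)
    next
      case (Suc N)
      have t: "(\<lambda>n. if n < N then c n else 0) \<in> ell" by (rule ell_finite_support[of N]) auto
      have "(\<lambda>n. if n < Suc N then c n else 0) = (\<lambda>n. (if n < N then c n else 0) + c N * delta N n)"
        by (auto simp: delta_def less_Suc_eq)
      then have "disc_fun (\<lambda>n. if n < Suc N then c n else 0) = (\<lambda>x. disc_fun (\<lambda>n. if n < N then c n else 0) x + c N * e N x)"
        using disc_fun_add[OF ell_abs_summable[OF t] abs_summable_scale[OF delta_abs_summable[of N], of "c N"]]
          disc_fun_scale[OF delta_abs_summable[of N], of "c N"]
        by (simp add: e_def)
      then have "\<rho> (disc_fun (\<lambda>n. if n < Suc N then c n else 0)) = \<rho> (disc_fun (\<lambda>n. if n < N then c n else 0)) + \<rho> (\<lambda>x. c N * e N x)"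
        using add[OF disc_fun_in_space[OF t] scale_in[OF e[of N], of "c N"]] by simp
      also have "\<dots> = (\<Sum>n<Suc N. c n * w ^ n)"
        using Suc by (simp add: scale[OF e] pow)
      finally show ?case .
    qed
    have split: "\<rho> f - (\<Sum>n<Suc N. c n * w ^ n) = \<rho> (disc_fun (\<lambda>n. if n \<le> N then 0 else c n))" for N
    proof -
      let ?h = "\<lambda>n. if n < Suc N then c n else 0" and ?t = "\<lambda>n. if n \<le> N then 0 else c n"
      have h: "?h \<in> ell" by (rule ell_finite_support[of N]) auto
      have t: "?t \<in> ell" by (rule nsq_tail[OF c(1)])
      have "c = (\<lambda>n. ?h n + ?t n)" by auto
      then have "f = (\<lambda>x. disc_fun ?h x + disc_fun ?t x)"
        using disc_fun_add[OF ell_abs_summable[OF h] ell_abs_summable[OF t]] c(2) by simp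
      then have "\<rho> f = \<rho> (disc_fun ?h) + \<rho> (disc_fun ?t)"
        using add[OF disc_fun_in_space[OF h] disc_fun_in_space[OF t]] by simp
      then show ?thesis unfolding partial by simp
    qed
    have "(\<lambda>N. C * sqrt (nsq c - Q N c)) \<longlonglongrightarrow> C * sqrt (nsq c - nsq c)"
      using c(1) unfolding Q_def nsq_def ell_def
      by (intro tendsto_intros summable_LIMSEQ') auto
    then have lim0: "(\<lambda>N. C * sqrt (nsq c - Q N c)) \<longlonglongrightarrow> 0" by simp
    have "(\<lambda>N. \<rho> f - (\<Sum>n<Suc N. c n * w ^ n)) \<longlonglongrightarrow> 0"
    proof (rule Lim_null_comparison[OF always_eventually lim0], rule allI)
      fix N
      show "cmod (\<rho> f - (\<Sum>n<Suc N. c n * w ^ n)) \<le> C * sqrt (nsq c - Q N c)"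
        unfolding split using C[OF disc_fun_in_space[OF nsq_tail(1)[OF c(1)]], of N]
        by (simp add: ip_norm_disc_fun nsq_tail[OF c(1)])
    qed
    then have "(\<lambda>N. \<rho> f - (\<rho> f - (\<Sum>n<Suc N. c n * w ^ n))) \<longlonglongrightarrow> \<rho> f - 0"
      by (intro tendsto_intros)
    then have "(\<lambda>N. \<Sum>n<Suc N. c n * w ^ n) \<longlonglongrightarrow> \<rho> f" by simp
    moreover have "(\<lambda>N. \<Sum>n<Suc N. c n * w ^ n) \<longlonglongrightarrow> f w"
    proof -
      have "(\<lambda>n. c n * w ^ n) sums f w"
        using disc_summable[OF ell_abs_summable[OF c(1)] w] w unfolding c(2) by (simp add: disc_fun_def summable_sums)
      then show ?thesis unfolding sums_def by (rule LIMSEQ_Suc)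
    qed
    ultimately show ?thesis by (rule LIMSEQ_unique)
  qed
  then show "\<exists>x\<in>cball 0 1. \<forall>f\<in>space. \<rho> f = f x" using w by blast
qed

text \<open>
  This is the operator norm bound \<open>C\<close> for multiplication by \<open>c\<close>, in truncated form.
\<close>

definition bounded_by :: "(nat \<Rightarrow> complex) \<Rightarrow> real \<Rightarrow> bool" where
  "bounded_by c C \<longleftrightarrow> 0 \<le> C \<and> (\<forall>f N. Q N (conv c f) \<le> C\<^sup>2 * Q N f)"

lemma coef_Mult_times:
  assumes "\<phi> \<in> Mult (cball 0 1) space" "\<psi> \<in> Mult (cball 0 1) space"
  shows "coef (\<lambda>x. \<phi> x * \<psi> x) = conv (coef \<phi>) (coef \<psi>)"
  unfolding space_times[OF assms[THEN Mult_in_space]]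
  by (intro coef_disc_fun Mult_conv_ell coef_ell Mult_in_space assms)

lemma coef_add:
  assumes "f \<in> space" "g \<in> space"
  shows "coef (\<lambda>x. f x + g x) = (\<lambda>n. coef f n + coef g n)"
  unfolding space_add_coef[OF assms] by (intro coef_disc_fun ell_add coef_ell assms)

lemma coef_scale:
  assumes "f \<in> space"
  shows "coef (\<lambda>x. c * f x) = (\<lambda>n. c * coef f n)"
  unfolding space_scale_coef[OF assms] by (intro coef_disc_fun ell_scale coef_ell assms)

end

section \<open>Kernels of the form 1 / (1 - B)\<close>

lemma sum_shift:
  fixes f :: "nat \<Rightarrow> 'a::comm_monoid_add"
  shows "(\<Sum>n\<le>N. if k \<le> n then f (n - k) else 0) = (if k \<le> N then \<Sum>m\<le>N - k. f m else 0)"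
proof -
  have "(\<Sum>n\<le>N. if k \<le> n then f (n - k) else 0) = (\<Sum>n\<in>{n\<in>{..N}. k \<le> n}. f (n - k))"
    by (rule sum.inter_filter[symmetric]) simp
  also have "\<dots> = (if k \<le> N then \<Sum>m\<le>N - k. f m else 0)"
    by (auto intro!: sum.reindex_bij_witness[where i="\<lambda>m. m + k" and j="\<lambda>n. n - k"] sum.neutral)
  finally show ?thesis .
qed

lemma sum_triangle:
  fixes f :: "nat \<Rightarrow> nat \<Rightarrow> 'a::comm_monoid_add"
  shows "(\<Sum>n\<le>N. \<Sum>l=1..n. f l (n - l)) = (\<Sum>l=1..N. \<Sum>m\<le>N - l. f l m)"
proof -
  have "(\<Sum>n\<le>N. \<Sum>l=1..n. f l (n - l)) = (\<Sum>n\<le>N. \<Sum>l=1..N. if l \<le> n then f l (n - l) else 0)"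
  proof (rule sum.cong)
    fix n assume "n \<in> {..N}"
    then show "(\<Sum>l=1..n. f l (n - l)) = (\<Sum>l=1..N. if l \<le> n then f l (n - l) else 0)"
      by (intro sum.mono_neutral_cong_left) auto
  qed simp
  also have "\<dots> = (\<Sum>l=1..N. \<Sum>n\<le>N. if l \<le> n then f l (n - l) else 0)"
    by (rule sum.swap)
  also have "\<dots> = (\<Sum>l=1..N. \<Sum>m\<le>N - l. f l m)"
    by (rule sum.cong) (auto simp: sum_shift)
  finally show ?thesis .
qed

text \<open>
  The coefficients of \<open>1 / (1 - B)\<close>: \<open>a n\<close> is the sum over all compositions of \<open>n\<close> of the product of the
  weights \<open>b\<close> of the parts.
\<close>

fun renewal_seq :: "(nat \<Rightarrow> real) \<Rightarrow> nat \<Rightarrow> real" where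
  "renewal_seq b n = (if n = 0 then 1 else \<Sum>l=1..n. b l * renewal_seq b (n - l))"

declare renewal_seq.simps [simp del]

text \<open>
  The bound \<open>1/2\<close> keeps \<open>1 - B\<close> away from \<open>0\<close> on the closed disc, and \<open>b 1 > 0\<close> makes all \<open>a n\<close> positive, so
  that the space contains the polynomials.
\<close>

locale renewal =
  fixes b :: "nat \<Rightarrow> real"
  assumes b_0: "b 0 = 0" and b_nonneg: "0 \<le> b n" and b_1: "0 < b 1"
    and b_summable: "summable b" and b_le: "suminf b \<le> 1 / 2"
begin

abbreviation a :: "nat \<Rightarrow> real" where "a \<equiv> renewal_seq b"

lemma a_0 [simp]: "a 0 = 1"
  by (simp add: renewal_seq.simps)

lemma a_rec: "0 < n \<Longrightarrow> a n = (\<Sum>l=1..n. b l * a (n - l))"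
  by (simp add: renewal_seq.simps[of b n])

lemma renewal_nonneg: "0 \<le> a n"
proof (induction n rule: less_induct)
  case (less n)
  show ?case
  proof (cases "n = 0")
    case False
    then show ?thesis using less by (auto simp: a_rec b_nonneg intro!: sum_nonneg mult_nonneg_nonneg)
  qed simp
qed

lemma a_ge_mult:
  assumes "0 < k"
  shows "b k * a n \<le> a (n + k)"
proof -
  have "sum (\<lambda>l. b l * a (n + k - l)) {k} \<le> (\<Sum>l=1..n+k. b l * a (n + k - l))"
    by (rule sum_mono2) (use assms in \<open>auto simp: b_nonneg renewal_nonneg\<close>)
  then show ?thesis using assms by (simp add: a_rec)
qed

lemma a_ge_b: "0 < n \<Longrightarrow> b n \<le> a n"
  using a_ge_mult[of n 0] by simp

lemma renewal_pos: "0 < a n"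
proof (induction n)
  case (Suc n)
  have "0 < b 1 * a n" using Suc b_1 by simp
  also have "\<dots> \<le> a (Suc n)" using a_ge_mult[of 1 n] by simp
  finally show ?case .
qed simp

lemma sum_b_le: "finite I \<Longrightarrow> sum b I \<le> 1 / 2"
  using sum_le_suminf[OF b_summable, of I] b_nonneg b_le by force

lemma sum_a_le: "(\<Sum>n\<le>N. a n) \<le> 2"
proof -
  have "(\<Sum>n\<le>N. a n) \<le> (\<Sum>n\<le>N. (if n = 0 then 1 else 0) + (\<Sum>l=1..n. b l * a (n - l)))"
    by (rule sum_mono) (simp add: a_rec)
  also have "\<dots> = 1 + (\<Sum>n\<le>N. \<Sum>l=1..n. b l * a (n - l))"
    by (simp add: sum.distrib)
  also have "(\<Sum>n\<le>N. \<Sum>l=1..n. b l * a (n - l)) = (\<Sum>l=1..N. \<Sum>m\<le>N - l. b l * a m)"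
    by (rule sum_triangle)
  also have "\<dots> \<le> (\<Sum>l=1..N. \<Sum>m\<le>N. b l * a m)"
    by (intro sum_mono sum_mono2) (auto simp: b_nonneg renewal_nonneg)
  also have "\<dots> = (\<Sum>l=1..N. b l) * (\<Sum>m\<le>N. a m)"
    by (simp add: sum_product)
  also have "\<dots> \<le> 1 / 2 * (\<Sum>m\<le>N. a m)"
    by (intro mult_right_mono sum_b_le sum_nonneg renewal_nonneg) auto
  finally show ?thesis by simp
qed

sublocale weight a
proof
  show "0 < a n" for n by (rule renewal_pos)
  show "summable a"
  proof (rule summableI_nonneg_bounded)
    show "0 \<le> a n" for n by (rule renewal_nonneg)
    show "(\<Sum>n<N. a n) \<le> 2" for N
      using sum_a_le[of N] sum_mono2[of "{..N}" "{..<N}" a] renewal_nonneg by force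
  qed
qed

text \<open>
  Multiplication by \<open>u l = sqrt (b l) z^l\<close>. If one thinks of \<open>b\<close> as the weights of letters \<open>l\<close>, this is
  appending the letter \<open>l\<close>.
\<close>

definition up :: "nat \<Rightarrow> (nat \<Rightarrow> complex) \<Rightarrow> nat \<Rightarrow> complex" where
  "up l c n = (if l \<le> n then complex_of_real (sqrt (b l)) * c (n - l) else 0)"

text \<open>
  The part of the squared norm of \<open>c\<close> that is still visible in degree \<open>N\<close> after a shift by \<open>k\<close>. The value \<open>Q N c\<close>
  also counts higher degrees, which would spoil the decomposition of the norm below.
\<close>

definition Qs :: "nat \<Rightarrow> nat \<Rightarrow> (nat \<Rightarrow> complex) \<Rightarrow> real" where
  "Qs N k c = (if k \<le> N then Q (N - k) c else 0)"

lemma Qs_le: "Qs N k c \<le> Q N c"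
  by (simp add: Qs_def Q_mono Q_nonneg)

lemma Qs_nonneg: "0 \<le> Qs N k c"
  by (simp add: Qs_def Q_nonneg)

lemma Qs_scale: "Qs N k (\<lambda>n. x * c n) = (cmod x)\<^sup>2 * Qs N k c"
  by (simp add: Qs_def Q_scale)

lemma row_pointwise:
  assumes J: "finite J" "inj_on \<nu> J" "\<And>j. j \<in> J \<Longrightarrow> 1 \<le> \<nu> j"
  shows "(cmod (\<Sum>j\<in>J. up (\<nu> j) (Z j) n))\<^sup>2 / a n
    \<le> (\<Sum>j\<in>J. if \<nu> j \<le> n then (cmod (Z j (n - \<nu> j)))\<^sup>2 / a (n - \<nu> j) else 0)"
proof -
  define J' where "J' = {j\<in>J. \<nu> j \<le> n}"
  have fin: "finite J'" using J by (simp add: J'_def)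
  let ?x = "\<lambda>j. sqrt (b (\<nu> j)) * sqrt (a (n - \<nu> j))"
  let ?y = "\<lambda>j. cmod (Z j (n - \<nu> j)) / sqrt (a (n - \<nu> j))"
  have "(\<Sum>j\<in>J. up (\<nu> j) (Z j) n) = (\<Sum>j\<in>J'. complex_of_real (sqrt (b (\<nu> j))) * Z j (n - \<nu> j))"
    unfolding J'_def sum.inter_filter[OF J(1)] up_def by simp
  then have "cmod (\<Sum>j\<in>J. up (\<nu> j) (Z j) n) \<le> (\<Sum>j\<in>J'. cmod (complex_of_real (sqrt (b (\<nu> j))) * Z j (n - \<nu> j)))"
    by (simp only: norm_sum)
  also have "\<dots> = (\<Sum>j\<in>J'. ?x j * ?y j)"
    by (rule sum.cong) (auto simp: norm_mult b_nonneg)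
  finally have "(cmod (\<Sum>j\<in>J. up (\<nu> j) (Z j) n))\<^sup>2 \<le> (\<Sum>j\<in>J'. ?x j * ?y j)\<^sup>2"
    by (rule power_mono) simp
  also have "\<dots> \<le> (\<Sum>j\<in>J'. (?x j)\<^sup>2) * (\<Sum>j\<in>J'. (?y j)\<^sup>2)"
    by (rule Cauchy_Schwarz_ineq_sum)
  also have "\<dots> \<le> a n * (\<Sum>j\<in>J'. (?y j)\<^sup>2)"
  proof (rule mult_right_mono)
    have "(\<Sum>j\<in>J'. (?x j)\<^sup>2) = (\<Sum>j\<in>J'. b (\<nu> j) * a (n - \<nu> j))"
      by (rule sum.cong) (auto simp: power_mult_distrib b_nonneg)
    also have "\<dots> = (\<Sum>l\<in>\<nu> ` J'. b l * a (n - l))"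
      by (rule sum.reindex_cong[symmetric, of \<nu>]) (use J in \<open>auto simp: J'_def inj_on_def\<close>)
    also have "\<dots> \<le> (\<Sum>l=1..n. b l * a (n - l))"
      by (rule sum_mono2) (use J in \<open>auto simp: J'_def b_nonneg\<close>)
    also have "\<dots> \<le> a n"
      by (cases "n = 0") (auto simp: a_rec)
    finally show "(\<Sum>j\<in>J'. (?x j)\<^sup>2) \<le> a n" .
  qed (auto intro!: sum_nonneg)
  finally have "(cmod (\<Sum>j\<in>J. up (\<nu> j) (Z j) n))\<^sup>2 / a n \<le> (\<Sum>j\<in>J'. (?y j)\<^sup>2)"
    using a_pos[of n] by (simp add: divide_le_eq mult.commute)
  also have "(\<Sum>j\<in>J'. (?y j)\<^sup>2) = (\<Sum>j\<in>J. if \<nu> j \<le> n then (cmod (Z j (n - \<nu> j)))\<^sup>2 / a (n - \<nu> j) else 0)"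
    unfolding J'_def sum.inter_filter[OF J(1)] by (rule sum.cong) (auto simp: power_divide)
  finally show ?thesis .
qed

text \<open>
  Cauchy-Schwarz in each degree \<open>n\<close>: the factor produced by the weights is \<open>\<Sum> b (\<nu> j) a (n - \<nu> j)\<close>, which is at
  most \<open>a n\<close> by the renewal recursion. Injectivity of \<open>\<nu>\<close> makes the terms distinct summands of
  that recursion.
\<close>

lemma row_contraction:
  assumes J: "finite J" "inj_on \<nu> J" "\<And>j. j \<in> J \<Longrightarrow> 1 \<le> \<nu> j"
  shows "Q N (\<lambda>n. (if n = 0 then x else 0) + (\<Sum>j\<in>J. up (\<nu> j) (Z j) n))
    \<le> (cmod x)\<^sup>2 + (\<Sum>j\<in>J. Qs N (\<nu> j) (Z j))"
proof -
  let ?T = "\<lambda>n. \<Sum>j\<in>J. if \<nu> j \<le> n then (cmod (Z j (n - \<nu> j)))\<^sup>2 / a (n - \<nu> j) else 0"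
  have z: "(\<Sum>j\<in>J. up (\<nu> j) (Z j) 0) = 0"
    using J(3) by (force simp: up_def intro!: sum.neutral)
  have T: "0 \<le> ?T n" for n by (auto intro!: sum_nonneg)
  have "Q N (\<lambda>n. (if n = 0 then x else 0) + (\<Sum>j\<in>J. up (\<nu> j) (Z j) n))
     \<le> (\<Sum>n\<le>N. (if n = 0 then (cmod x)\<^sup>2 else 0) + ?T n)"
    unfolding Q_def
  proof (rule sum_mono)
    fix n
    show "(cmod ((if n = 0 then x else 0) + (\<Sum>j\<in>J. up (\<nu> j) (Z j) n)))\<^sup>2 / a n
        \<le> (if n = 0 then (cmod x)\<^sup>2 else 0) + ?T n"
      using row_pointwise[OF J, of Z n] z T[of 0] by (cases "n = 0") auto
  qed
  also have "\<dots> = (cmod x)\<^sup>2 + (\<Sum>n\<le>N. ?T n)"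
    by (simp add: sum.distrib)
  also have "(\<Sum>n\<le>N. ?T n) = (\<Sum>j\<in>J. \<Sum>n\<le>N. if \<nu> j \<le> n then (cmod (Z j (n - \<nu> j)))\<^sup>2 / a (n - \<nu> j) else 0)"
    by (rule sum.swap)
  also have "\<dots> = (\<Sum>j\<in>J. Qs N (\<nu> j) (Z j))"
  proof (rule sum.cong)
    fix j
    show "(\<Sum>n\<le>N. if \<nu> j \<le> n then (cmod (Z j (n - \<nu> j)))\<^sup>2 / a (n - \<nu> j) else 0) = Qs N (\<nu> j) (Z j)"
      unfolding sum_shift[of "\<nu> j" "\<lambda>m. (cmod (Z j m))\<^sup>2 / a m" N] Qs_def Q_def ..
  qed simp
  finally show ?thesis .
qed

text \<open>
  The component \<open>g l\<close> in the minimal decomposition \<open>f = f(0) + \<Sum> u l g l\<close>. It is the adjoint of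
  multiplication by \<open>u l\<close>, and with this choice the row contraction is attained with equality.
\<close>

definition part :: "(nat \<Rightarrow> complex) \<Rightarrow> nat \<Rightarrow> nat \<Rightarrow> complex" where
  "part f l m = complex_of_real (sqrt (b l) * a m / a (m + l)) * f (m + l)"

lemma up_part: "up l (part f l) n = (if l \<le> n then complex_of_real (b l * a (n - l) / a n) * f n else 0)"
proof -
  have "sqrt (b l) * (sqrt (b l) * a (n - l) / a n) = b l * a (n - l) / a n"
    using real_sqrt_mult_self[of "b l"] b_nonneg[of l] by simp
  then have "complex_of_real (sqrt (b l)) * complex_of_real (sqrt (b l) * a (n - l) / a n)
      = complex_of_real (b l * a (n - l) / a n)"
    by (metis of_real_mult)
  then show ?thesis by (simp add: up_def part_def mult.assoc[symmetric] del: of_real_mult of_real_divide)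
qed

lemma part_decomp:
  assumes J: "{1..n} \<subseteq> J" "finite J" "0 \<notin> J"
  shows "f n = (if n = 0 then f 0 else 0) + (\<Sum>l\<in>J. up l (part f l) n)"
proof -
  have "(\<Sum>l\<in>J. up l (part f l) n) = (\<Sum>l=1..n. complex_of_real (b l * a (n - l) / a n) * f n)"
    by (rule sum.mono_neutral_cong_right) (use J in \<open>auto simp: up_part Suc_le_eq intro: gr0I\<close>)
  also have "\<dots> = complex_of_real (\<Sum>l=1..n. b l * a (n - l) / a n) * f n"
    by (simp add: sum_distrib_right)
  also have "(\<Sum>l=1..n. b l * a (n - l) / a n) = (if n = 0 then 0 else 1)"
  proof (cases "n = 0")
    case False
    then show ?thesis
      using a_rec[of n] a_pos[of n] by (simp add: sum_divide_distrib[symmetric])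
  qed simp
  finally show ?thesis by auto
qed

lemma part_norm:
  assumes J: "finite J" "0 \<notin> J"
  shows "(cmod (f 0))\<^sup>2 + (\<Sum>l\<in>J. Qs N l (part f l)) \<le> Q N f"
proof -
  have q: "(cmod (part f l m))\<^sup>2 / a m = b l * a m * ((cmod (f (m + l)))\<^sup>2 / (a (m + l))\<^sup>2)" for l m
    by (simp add: part_def norm_mult norm_divide b_nonneg power_mult_distrib power_divide power2_eq_square)
  have "(\<Sum>l\<in>J. Qs N l (part f l)) = (\<Sum>l\<in>J \<inter> {1..N}. Qs N l (part f l))"
    by (rule sum.mono_neutral_right) (use J in \<open>auto simp: Qs_def Suc_le_eq intro: gr0I\<close>)
  also have "\<dots> \<le> (\<Sum>l=1..N. Qs N l (part f l))"
    by (rule sum_mono2) (auto simp: Qs_nonneg)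
  also have "\<dots> = (\<Sum>l=1..N. \<Sum>m\<le>N - l. b l * a m * ((cmod (f (m + l)))\<^sup>2 / (a (m + l))\<^sup>2))"
    by (rule sum.cong) (auto simp: Qs_def Q_def q)
  also have "\<dots> = (\<Sum>n\<le>N. \<Sum>l=1..n. b l * a (n - l) * ((cmod (f (n - l + l)))\<^sup>2 / (a (n - l + l))\<^sup>2))"
    by (rule sum_triangle[symmetric])
  also have "\<dots> = (\<Sum>n\<le>N. if n = 0 then 0 else (cmod (f n))\<^sup>2 / a n)"
  proof (rule sum.cong)
    fix n
    have "(\<Sum>l=1..n. b l * a (n - l) * ((cmod (f (n - l + l)))\<^sup>2 / (a (n - l + l))\<^sup>2))
       = (\<Sum>l=1..n. b l * a (n - l)) * ((cmod (f n))\<^sup>2 / (a n)\<^sup>2)"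
      by (simp add: sum_distrib_right sum_divide_distrib)
    also have "\<dots> = (if n = 0 then 0 else (cmod (f n))\<^sup>2 / a n)"
      using a_rec[of n] a_pos[of n] by (simp add: power2_eq_square)
    finally show "(\<Sum>l=1..n. b l * a (n - l) * ((cmod (f (n - l + l)))\<^sup>2 / (a (n - l + l))\<^sup>2))
       = (if n = 0 then 0 else (cmod (f n))\<^sup>2 / a n)" .
  qed simp
  finally have "(\<Sum>l\<in>J. Qs N l (part f l)) \<le> (\<Sum>n\<le>N. if n = 0 then 0 else (cmod (f n))\<^sup>2 / a n)" .
  moreover have "Q N f = (\<Sum>n\<le>N. (if n = 0 then (cmod (f 0))\<^sup>2 else 0) + (if n = 0 then 0 else (cmod (f n))\<^sup>2 / a n))"
    unfolding Q_def by (rule sum.cong) auto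
  ultimately show ?thesis by (simp add: sum.distrib)
qed

lemma up_pow: "(up l ^^ i) c n = (if i * l \<le> n then complex_of_real (sqrt (b l)) ^ i * c (n - i * l) else 0)"
proof (induction i arbitrary: n)
  case (Suc i)
  have "(up l ^^ Suc i) c n = up l ((up l ^^ i) c) n" by simp
  also have "\<dots> = (if l \<le> n then complex_of_real (sqrt (b l)) * (up l ^^ i) c (n - l) else 0)"
    by (simp only: up_def)
  also have "\<dots> = (if Suc i * l \<le> n then complex_of_real (sqrt (b l)) ^ Suc i * c (n - Suc i * l) else 0)"
    unfolding Suc.IH by (auto simp: le_diff_conv2 add.commute)
  finally show ?case .
qed simp

lemma Q_up: "1 \<le> l \<Longrightarrow> Q N (up l c) \<le> Q N c"
  using row_contraction[of "{l}" id N 0 "\<lambda>_. c"] Qs_le[of N l c] by simp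

lemma up_sum: "up l (\<lambda>n. \<Sum>i\<in>I. c i n) n = (\<Sum>i\<in>I. up l (c i) n)"
  by (simp add: up_def sum_distrib_left)

lemma up_scale: "up l (\<lambda>n. x * c n) n = x * up l c n"
  by (simp add: up_def)

text \<open>
  With \<open>h = f - u l g l\<close>, the vectors \<open>h, u l h, (u l)^2 h, \<dots>\<close> behave as if they were orthogonal: \<open>h\<close> involves no word
  that starts with the letter \<open>l\<close>, so the words occurring in \<open>(u l)^i h\<close> for different \<open>i\<close> form a prefix code.
  Induction on \<open>M\<close> peels off one power of \<open>u l\<close> with the row contraction.
\<close>

lemma prefix_bound:
  assumes l: "1 \<le> l"
  shows "Q N (\<lambda>n. \<Sum>i\<le>M. x i * (up l ^^ i) (\<lambda>n. f n - up l (part f l) n) n)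
    \<le> (\<Sum>i\<le>M. (cmod (x i))\<^sup>2) * Q N f"
proof -
  define J where "J = insert l {1..N} - {l}"
  define h where "h n = f n - up l (part f l) n" for n
  have J: "finite J" "0 \<notin> J" "l \<notin> J" "finite (insert l J)" "0 \<notin> insert l J"
    using l by (auto simp: J_def)
  have h: "h n = (if n = 0 then f 0 else 0) + (\<Sum>j\<in>J. up j (part f j) n)" if "n \<le> N" for n
  proof -
    have "{1..n} \<subseteq> insert l J" using that by (auto simp: J_def)
    from part_decomp[OF this J(4,5), of f] show ?thesis
      using J by (simp add: h_def)
  qed
  have norm_J: "(cmod (f 0))\<^sup>2 + (\<Sum>j\<in>J. Qs N j (part f j)) \<le> Q N f"
    by (rule part_norm) (use J in auto)
  have "Q N (\<lambda>n. \<Sum>i\<le>M. x i * (up l ^^ i) h n) \<le> (\<Sum>i\<le>M. (cmod (x i))\<^sup>2) * Q N f"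
  proof (induction M arbitrary: x)
    case (0 x)
    have "Q N h = Q N (\<lambda>n. (if n = 0 then f 0 else 0) + (\<Sum>j\<in>J. up (id j) (part f j) n))"
      by (rule Q_cong) (simp add: h)
    also have "\<dots> \<le> (cmod (f 0))\<^sup>2 + (\<Sum>j\<in>J. Qs N (id j) (part f j))"
      by (rule row_contraction) (use J in \<open>auto simp: Suc_le_eq intro: gr0I\<close>)
    also have "\<dots> \<le> Q N f" using norm_J by simp
    finally show ?case by (simp add: Q_scale mult_left_mono)
  next
    case (Suc M x)
    let ?S = "\<lambda>n. \<Sum>i\<le>M. x (Suc i) * (up l ^^ i) h n"
    let ?Z = "\<lambda>j. if j = l then ?S else (\<lambda>n. x 0 * part f j n)"
    have eq: "(\<Sum>i\<le>Suc M. x i * (up l ^^ i) h n)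
       = (if n = 0 then x 0 * f 0 else 0) + (\<Sum>j\<in>insert l J. up (id j) (?Z j) n)" if "n \<le> N" for n
    proof -
      have "(\<Sum>i\<le>Suc M. x i * (up l ^^ i) h n) = x 0 * h n + (\<Sum>i\<le>M. x (Suc i) * (up l ^^ (Suc i)) h n)"
        unfolding sum.atMost_Suc_shift by simp
      also have "(\<Sum>i\<le>M. x (Suc i) * (up l ^^ (Suc i)) h n) = up l ?S n"
        by (simp add: up_sum up_scale)
      also have "x 0 * h n = (if n = 0 then x 0 * f 0 else 0) + (\<Sum>j\<in>J. up (id j) (\<lambda>n. x 0 * part f j n) n)"
        unfolding h[OF that] by (simp add: distrib_left sum_distrib_left up_scale)
      also have "(\<Sum>j\<in>J. up (id j) (\<lambda>n. x 0 * part f j n) n) = (\<Sum>j\<in>J. up (id j) (?Z j) n)"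
        by (rule sum.cong) (use J(3) in auto)
      finally show ?thesis using J by (simp add: add_ac)
    qed
    have "Q N (\<lambda>n. \<Sum>i\<le>Suc M. x i * (up l ^^ i) h n)
        = Q N (\<lambda>n. (if n = 0 then x 0 * f 0 else 0) + (\<Sum>j\<in>insert l J. up (id j) (?Z j) n))"
      by (rule Q_cong) (rule eq)
    also have "\<dots> \<le> (cmod (x 0 * f 0))\<^sup>2 + (\<Sum>j\<in>insert l J. Qs N (id j) (?Z j))"
      by (rule row_contraction) (use J l in \<open>auto simp: Suc_le_eq intro: gr0I\<close>)
    also have "(\<Sum>j\<in>insert l J. Qs N (id j) (?Z j)) = Qs N l ?S + (\<Sum>j\<in>J. Qs N j (?Z j))"
      using J by simp
    also have "(\<Sum>j\<in>J. Qs N j (?Z j)) = (\<Sum>j\<in>J. (cmod (x 0))\<^sup>2 * Qs N j (part f j))"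
      by (rule sum.cong) (use J(3) in \<open>auto simp: Qs_scale\<close>)
    also have "(cmod (x 0 * f 0))\<^sup>2 + (Qs N l ?S + (\<Sum>j\<in>J. (cmod (x 0))\<^sup>2 * Qs N j (part f j)))
       = Qs N l ?S + (cmod (x 0))\<^sup>2 * ((cmod (f 0))\<^sup>2 + (\<Sum>j\<in>J. Qs N j (part f j)))"
      by (simp add: norm_mult power_mult_distrib distrib_left sum_distrib_left)
    also have "\<dots> \<le> (\<Sum>i\<le>M. (cmod (x (Suc i)))\<^sup>2) * Q N f + (cmod (x 0))\<^sup>2 * Q N f"
      using norm_J Suc.IH[of "\<lambda>i. x (Suc i)"] Qs_le[of N l ?S]
      by (intro add_mono mult_left_mono) auto
    also have "\<dots> = (\<Sum>i\<le>Suc M. (cmod (x i))\<^sup>2) * Q N f"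
      unfolding sum.atMost_Suc_shift distrib_right by simp
    finally show ?case .
  qed
  then show ?thesis by (simp add: h_def[abs_def])
qed

lemma Mult_separates_points: "separates_points (Mult (cball 0 1) space) (cball 0 1)"
proof -
  have "conv (delta 1) f \<in> ell" if f: "f \<in> ell" for f
  proof (rule ellI_bounded)
    fix N
    have "up 1 f = (\<lambda>n. complex_of_real (sqrt (b 1)) * conv (delta 1) f n)"
      by (rule ext) (subst conv_commute, simp add: up_def conv_delta)
    then have "b 1 * Q N (conv (delta 1) f) = Q N (up 1 f)"
      using b_1 by (simp add: Q_scale)
    also have "\<dots> \<le> Q N f" by (rule Q_up) simp
    also have "\<dots> \<le> nsq f" by (rule Q_le_nsq[OF f])
    finally show "Q N (conv (delta 1) f) \<le> nsq f / b 1"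
      using b_1 by (simp add: le_divide_eq mult.commute)
  qed
  then have "disc_fun (delta 1) \<in> Mult (cball 0 1) space"
    by (intro disc_fun_multiplier delta_abs_summable)
  moreover have "disc_fun (delta 1) x \<noteq> disc_fun (delta 1) y" if "x \<in> cball 0 1" "y \<in> cball 0 1" "x \<noteq> y" for x y
    using that by (simp add: disc_fun_delta)
  ultimately show ?thesis unfolding separates_points_def by blast
qed

end

text \<open>
  The form may be degenerate. Coefficient vectors with respect to a linearly dependent
  family carry such a form, and working with coefficients avoids choosing a basis.
\<close>

section \<open>Gram-Schmidt and the lurking isometry\<close>

locale semi_ip =
  fixes B :: "(nat \<Rightarrow> complex) \<Rightarrow> (nat \<Rightarrow> complex) \<Rightarrow> complex"
  assumes add: "B (\<lambda>i. x i + y i) z = B x z + B y z"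
    and scale: "B (\<lambda>i. c * x i) z = c * B x z"
    and herm: "B y x = cnj (B x y)"
    and nonneg: "0 \<le> Re (B x x)"
begin

definition orthonormal :: "nat \<Rightarrow> (nat \<Rightarrow> nat \<Rightarrow> complex) \<Rightarrow> bool" where
  "orthonormal R g \<longleftrightarrow> (\<forall>k<R. \<forall>l<R. B (g k) (g l) = (if k = l then 1 else 0))"

definition residual :: "nat \<Rightarrow> (nat \<Rightarrow> nat \<Rightarrow> complex) \<Rightarrow> (nat \<Rightarrow> complex) \<Rightarrow> nat \<Rightarrow> complex" where
  "residual R g x i = x i - (\<Sum>k<R. B x (g k) * g k i)"

lemma zero: "B (\<lambda>i. 0) z = 0"
  using scale[of 0 "\<lambda>i. 0" z] by simp

lemma sum: "finite S \<Longrightarrow> B (\<lambda>i. \<Sum>k\<in>S. c k * x k i) z = (\<Sum>k\<in>S. c k * B (x k) z)"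
  by (induction S rule: finite_induct) (simp_all add: zero add scale)

lemma add_right: "B z (\<lambda>i. x i + y i) = B z x + B z y"
  using add[of x y z] herm by (metis complex_cnj_add)

lemma scale_right: "B z (\<lambda>i. c * x i) = cnj c * B z x"
  using scale[of c x z] herm by (metis complex_cnj_mult)

lemma sum_right: "finite S \<Longrightarrow> B z (\<lambda>i. \<Sum>k\<in>S. c k * x k i) = (\<Sum>k\<in>S. cnj (c k) * B z (x k))"
  by (subst herm, subst sum) (simp_all add: herm[of "x _" z] cong: sum.cong)

lemma diff: "B (\<lambda>i. x i - y i) z = B x z - B y z"
  using add[of x "\<lambda>i. -1 * y i" z] scale[of "-1" y z] by simp

lemma diff_right: "B z (\<lambda>i. x i - y i) = B z x - B z y"
  using diff[of x y z] herm by (metis complex_cnj_diff)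

lemma self_real: "B x x = complex_of_real (Re (B x x))"
  using herm[of x x] by (metis Reals_cnj_iff of_real_Re)

text \<open>
  Along \<open>t x + y\<close> the quadratic term of the form vanishes. If \<open>B x y\<close> were nonzero, the linear term would
  make the form negative for a suitable \<open>t\<close>.
\<close>

lemma null_orthogonal:
  assumes "B x x = 0"
  shows "B x y = 0"
proof (rule ccontr)
  assume nz: "B x y \<noteq> 0"
  let ?c = "(cmod (B x y))\<^sup>2"
  have c: "?c > 0" using nz by simp
  define t where "t = - (Re (B y y) + 1) / ?c"
  let ?w = "complex_of_real t * cnj (B x y)"
  have "B (\<lambda>i. ?w * x i + y i) (\<lambda>i. ?w * x i + y i) = ?w * B x y + cnj ?w * B y x + B y y"
    unfolding add add_right scale scale_right using assms by (simp add: algebra_simps)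
  also have "\<dots> = complex_of_real (2 * t * ?c) + B y y"
    unfolding herm[of y x] by (simp add: complex_norm_square mult_ac del: of_real_power)
  finally have "Re (B (\<lambda>i. ?w * x i + y i) (\<lambda>i. ?w * x i + y i)) = 2 * t * ?c + Re (B y y)"
    by simp
  with nonneg[of "\<lambda>i. ?w * x i + y i"] have "0 \<le> 2 * t * ?c + Re (B y y)" by simp
  also have "t * ?c = - (Re (B y y) + 1)" using c by (simp add: t_def)
  then have "2 * t * ?c + Re (B y y) = - Re (B y y) - 2" by simp
  also have "\<dots> < 0" using nonneg[of y] by simp
  finally show False by simp
qed

lemma orthonormal_comb:
  assumes "orthonormal R g" "k < R"
  shows "B (\<lambda>i. \<Sum>l<R. c l * g l i) (g k) = c k"
proof -
  have "B (\<lambda>i. \<Sum>l<R. c l * g l i) (g k) = (\<Sum>l<R. c l * B (g l) (g k))"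
    by (rule sum) simp
  also have "\<dots> = (\<Sum>l<R. if l = k then c l else 0)"
    by (rule sum.cong) (use assms in \<open>auto simp: orthonormal_def\<close>)
  finally show ?thesis using assms(2) by simp
qed

lemma orthonormal_comb_norm:
  assumes "orthonormal R g"
  shows "B (\<lambda>i. \<Sum>l<R. c l * g l i) (\<lambda>i. \<Sum>l<R. c l * g l i) = complex_of_real (\<Sum>l<R. (cmod (c l))\<^sup>2)"
  by (subst sum_right) (simp_all add: orthonormal_comb[OF assms] complex_norm_square mult.commute del: of_real_power)

lemma residual_orthogonal:
  assumes "orthonormal R g" "k < R"
  shows "B (residual R g x) (g k) = 0"
  unfolding residual_def diff using orthonormal_comb[OF assms] by simp

lemma bessel:
  assumes "orthonormal R g"
  shows "(\<Sum>k<R. (cmod (B x (g k)))\<^sup>2) \<le> Re (B x x)"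
proof -
  let ?p = "\<lambda>i. \<Sum>k<R. B x (g k) * g k i"
  have xp: "B x ?p = complex_of_real (\<Sum>k<R. (cmod (B x (g k)))\<^sup>2)"
    by (subst sum_right) (simp_all add: complex_norm_square mult.commute del: of_real_power)
  have px: "B ?p x = complex_of_real (\<Sum>k<R. (cmod (B x (g k)))\<^sup>2)"
    by (subst herm, subst xp) simp
  have "B (\<lambda>i. x i - ?p i) (\<lambda>i. x i - ?p i) = B x x - complex_of_real (\<Sum>k<R. (cmod (B x (g k)))\<^sup>2)"
    unfolding diff diff_right xp px orthonormal_comb_norm[OF assms] by simp
  then show ?thesis using nonneg[of "\<lambda>i. x i - ?p i"] by simp
qed

lemma gram_schmidt:
  fixes M :: nat and v :: "nat \<Rightarrow> nat \<Rightarrow> complex"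
  shows "\<exists>R g. orthonormal R g \<and> (\<forall>j<M. B (residual R g (v j)) (residual R g (v j)) = 0)"
proof (induction M)
  case 0
  show ?case by (rule exI[of _ 0]) (auto simp: orthonormal_def)
next
  case (Suc M)
  then obtain R g where o: "orthonormal R g"
    and null: "\<And>j. j < M \<Longrightarrow> B (residual R g (v j)) (residual R g (v j)) = 0" by blast
  let ?x = "residual R g (v M)"
  show ?case
  proof (cases "B ?x ?x = 0")
    case True
    then show ?thesis using o null less_Suc_eq by auto
  next
    case False
    define s where "s = sqrt (Re (B ?x ?x))"
    have "Re (B ?x ?x) \<noteq> 0"
    proof
      assume 0: "Re (B ?x ?x) = 0"
      have "B ?x ?x = complex_of_real (Re (B ?x ?x))" by (rule self_real)
      also have "\<dots> = 0" by (simp only: 0 of_real_0)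
      finally show False using False by simp
    qed
    then have pos: "Re (B ?x ?x) > 0" using nonneg[of ?x] by linarith
    have s: "s > 0" "s * s = Re (B ?x ?x)" using pos by (simp_all add: s_def)
    have Bx: "B ?x ?x = complex_of_real (s * s)" unfolding s(2) by (rule self_real)
    define g' where "g' = g(R := (\<lambda>i. complex_of_real (1 / s) * ?x i))"
    have g'_lt: "g' k = g k" if "k < R" for k using that by (simp add: g'_def)
    have g'_R: "g' R = (\<lambda>i. complex_of_real (1 / s) * ?x i)" by (simp add: g'_def)
    have oR: "B (g' R) (g k) = 0" if "k < R" for k
      unfolding g'_R scale residual_orthogonal[OF o that] by simp
    have oR': "B (g k) (g' R) = 0" if "k < R" for k
      by (subst herm) (simp add: oR that)
    have RR: "B (g' R) (g' R) = 1"
      unfolding g'_R scale scale_right Bx using s(1) by simp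
    have o': "orthonormal (Suc R) g'"
      unfolding orthonormal_def using o oR oR' RR by (auto simp: less_Suc_eq g'_lt orthonormal_def)
    have res: "residual (Suc R) g' x i = residual R g x i - B x (g' R) * g' R i" for x i
      by (simp add: residual_def g'_lt)
    have "B (residual (Suc R) g' (v j)) (residual (Suc R) g' (v j)) = 0" if "j < Suc M" for j
    proof (cases "j = M")
      case True
      have "v M = (\<lambda>i. ?x i + (\<Sum>k<R. B (v M) (g k) * g k i))" by (simp add: residual_def)
      then have "B (v M) (g' R) = B ?x (g' R) + B (\<lambda>i. \<Sum>k<R. B (v M) (g k) * g k i) (g' R)"
        using add[of ?x "\<lambda>i. \<Sum>k<R. B (v M) (g k) * g k i" "g' R"] by simp
      also have "B (\<lambda>i. \<Sum>k<R. B (v M) (g k) * g k i) (g' R) = 0"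
        by (subst sum) (auto simp: oR')
      also have "B ?x (g' R) = complex_of_real s"
        unfolding g'_R scale_right Bx using s(1) by simp
      finally have "residual (Suc R) g' (v M) = (\<lambda>i. 0)"
        using s by (auto simp: res g'_R)
      then show ?thesis using True by (simp add: zero)
    next
      case False
      then have j: "j < M" using that by simp
      have "B (residual R g (v j)) (g' R) = 0" by (rule null_orthogonal[OF null[OF j]])
      moreover have "v j = (\<lambda>i. residual R g (v j) i + (\<Sum>k<R. B (v j) (g k) * g k i))" by (simp add: residual_def)
      then have "B (v j) (g' R) = B (residual R g (v j)) (g' R) + B (\<lambda>i. \<Sum>k<R. B (v j) (g k) * g k i) (g' R)"
        using add[of "residual R g (v j)" "\<lambda>i. \<Sum>k<R. B (v j) (g k) * g k i" "g' R"] by simp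
      moreover have "B (\<lambda>i. \<Sum>k<R. B (v j) (g k) * g k i) (g' R) = 0"
        by (subst sum) (auto simp: oR')
      ultimately have "residual (Suc R) g' (v j) = residual R g (v j)" by (auto simp: res)
      then show ?thesis using null[OF j] by simp
    qed
    with o' show ?thesis by blast
  qed
qed

lemma expand:
  assumes "B (residual R g x) (residual R g x) = 0"
  shows "B x y = (\<Sum>k<R. B x (g k) * B (g k) y)"
proof -
  have "B (residual R g x) y = 0" by (rule null_orthogonal[OF assms])
  then have "B x y - B (\<lambda>i. \<Sum>k<R. B x (g k) * g k i) y = 0"
    unfolding residual_def diff .
  then show ?thesis by (subst (asm) sum) auto
qed

end

definition coord :: "nat \<Rightarrow> nat \<Rightarrow> complex" where
  "coord j i = (if i = j then 1 else 0)"

lemma gram_form: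
  "semi_ip (\<lambda>x x'. \<Sum>y<K. (\<Sum>i<N. x i * \<rho> i y) * cnj (\<Sum>i<N. x' i * \<rho> i y))"
proof
  fix x y z :: "nat \<Rightarrow> complex" and c :: complex
  show "0 \<le> Re (\<Sum>y<K. (\<Sum>i<N. x i * \<rho> i y) * cnj (\<Sum>i<N. x i * \<rho> i y))"
    by (auto simp: complex_norm_square[symmetric] simp del: cnj_sum intro!: sum_nonneg simp flip: of_real_power)
  show "(\<Sum>j<K. (\<Sum>i<N. y i * \<rho> i j) * cnj (\<Sum>i<N. x i * \<rho> i j))
      = cnj (\<Sum>j<K. (\<Sum>i<N. x i * \<rho> i j) * cnj (\<Sum>i<N. y i * \<rho> i j))"
    by (subst cnj_sum, rule sum.cong, simp, simp only: complex_cnj_mult complex_cnj_cnj mult.commute)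
qed (simp_all add: sum_distrib_left sum_distrib_right sum.distrib ring_distribs mult_ac)

text \<open>
  Expanding the coordinate vectors in an orthonormal family for the form \<open>x P x^*\<close> gives \<open>P = \<Gamma> \<Gamma>^*\<close>.
\<close>

lemma psd_factorization:
  fixes P :: "nat \<Rightarrow> nat \<Rightarrow> complex"
  assumes herm: "\<And>i j. i < N \<Longrightarrow> j < N \<Longrightarrow> P j i = cnj (P i j)"
    and psd: "\<And>x. 0 \<le> Re (\<Sum>i<N. \<Sum>j<N. x i * P i j * cnj (x j))"
  shows "\<exists>m \<Gamma>. \<forall>i<N. \<forall>j<N. P i j = (\<Sum>k<(m::nat). \<Gamma> i k * cnj (\<Gamma> j k))"
proof -
  let ?B = "\<lambda>(x :: nat \<Rightarrow> complex) y. \<Sum>i<N. \<Sum>j<N. x i * P i j * cnj (y j)"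
  interpret semi_ip ?B
  proof
    fix x y :: "nat \<Rightarrow> complex"
    have "?B y x = (\<Sum>j<N. \<Sum>i<N. y i * P i j * cnj (x j))" by (rule sum.swap)
    also have "\<dots> = cnj (?B x y)"
      unfolding cnj_sum
    proof (intro sum.cong refl)
      fix i j assume "j \<in> {..<N}" "i \<in> {..<N}"
      then show "y i * P i j * cnj (x j) = cnj (x j * P j i * cnj (y i))"
        using herm[of j i] by (simp add: mult_ac)
    qed
    finally show "?B y x = cnj (?B x y)" .
    show "0 \<le> Re (?B x x)" by (rule psd)
  qed (simp_all add: sum_distrib_left sum.distrib ring_distribs mult_ac)
  obtain R g where g: "orthonormal R g" "\<And>j. j < N \<Longrightarrow> ?B (residual R g (coord j)) (residual R g (coord j)) = 0"
    using gram_schmidt[of N coord] by blast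
  have "P i j = (\<Sum>k<R. ?B (coord i) (g k) * cnj (?B (coord j) (g k)))" if "i < N" "j < N" for i j
  proof -
    have "P i j = ?B (coord i) (coord j)"
    proof -
      have "?B (coord i) (coord j) = (\<Sum>i'<N. \<Sum>j'<N. if i' = i then (if j' = j then P i j else 0) else 0)"
        by (intro sum.cong) (auto simp: coord_def)
      also have "\<dots> = (\<Sum>i'<N. if i' = i then P i j else 0)"
        using that by (intro sum.cong) auto
      also have "\<dots> = P i j" using that by simp
      finally show ?thesis by simp
    qed
    also have "\<dots> = (\<Sum>k<R. ?B (coord i) (g k) * ?B (g k) (coord j))" by (rule expand[OF g(2)[OF that(1)]])
    also have "\<dots> = (\<Sum>k<R. ?B (coord i) (g k) * cnj (?B (coord j) (g k)))"
      by (intro sum.cong refl arg_cong2[where f="(*)"] herm)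
    finally show ?thesis .
  qed
  note P_eq = this
  define \<Gamma> where "\<Gamma> i k = ?B (coord i) (g k)" for i k
  have "\<forall>i<N. \<forall>j<N. P i j = (\<Sum>k<R. \<Gamma> i k * cnj (\<Gamma> j k))"
    unfolding \<Gamma>_def by (intro allI impI P_eq)
  then show ?thesis by (intro exI)
qed

text \<open>
  If two families \<open>d i\<close> and \<open>\<rho> i\<close> have the same Gram matrix, then the same linear combinations
  orthonormalize both of them. With the resulting orthonormal families \<open>e\<close> and \<open>f\<close>, the matrix \<open>V\<close> with entries
  \<open>\<Sum> cnj (e \<kappa>) f \<kappa>\<close> is a partial isometry and carries each row \<open>d i\<close> to \<open>\<rho> i\<close>. The vectors \<open>d i\<close> are
  infinite, indexed by \<open>(l, k)\<close>, and the last clause keeps the decay of \<open>V\<close> in \<open>l\<close> under control.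
\<close>

lemma lurking_isometry:
  fixes d :: "nat \<Rightarrow> nat \<Rightarrow> nat \<Rightarrow> complex" and \<rho> :: "nat \<Rightarrow> nat \<Rightarrow> complex"
  assumes gram: "\<And>i j. i < N \<Longrightarrow> j < N \<Longrightarrow>
      (\<lambda>l. \<Sum>k<K. d i l k * cnj (d j l k)) sums (\<Sum>y<K. \<rho> i y * cnj (\<rho> j y))"
  shows "\<exists>V :: nat \<Rightarrow> nat \<Rightarrow> nat \<Rightarrow> complex.
     (\<forall>L v. (\<Sum>l<L. \<Sum>k<K. (cmod (\<Sum>y<K. V l k y * v y))\<^sup>2) \<le> (\<Sum>y<K. (cmod (v y))\<^sup>2)) \<and>
     (\<forall>i<N. \<forall>y<K. (\<lambda>l. \<Sum>k<K. d i l k * V l k y) sums \<rho> i y) \<and>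
     (\<exists>C\<ge>0. \<forall>l. \<forall>k<K. \<forall>y<K. cmod (V l k y) \<le> C * (\<Sum>i<N. cmod (d i l k)))"
proof -
  let ?B = "\<lambda>x x'. \<Sum>y<K. (\<Sum>i<N. x i * \<rho> i y) * cnj (\<Sum>i<N. x' i * \<rho> i y)"
  interpret B: semi_ip ?B by (rule gram_form)
  obtain R g where g: "B.orthonormal R g"
    and null: "\<And>j. j < N \<Longrightarrow> ?B (B.residual R g (coord j)) (B.residual R g (coord j)) = 0"
    using B.gram_schmidt[of N coord] by blast
  define f where "f k y = (\<Sum>i<N. g k i * \<rho> i y)" for k y
  define e where "e \<kappa> l k = (\<Sum>i<N. g \<kappa> i * d i l k)" for \<kappa> l k
  \<comment> \<open>The operator mapping each \<open>e \<kappa>\<close> to \<open>f \<kappa>\<close> and vanishing on the orthogonal complement.\<close>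
  define V where "V l k y = (\<Sum>\<kappa><R. cnj (e \<kappa> l k) * f \<kappa> y)" for l k y
  have coord_sum: "(\<Sum>i<N. coord j i * x i) = x j" if "j < N" for j and x :: "nat \<Rightarrow> complex"
  proof -
    have "(\<Sum>i<N. coord j i * x i) = (\<Sum>i<N. if i = j then x j else 0)"
      by (rule sum.cong) (auto simp: coord_def)
    then show ?thesis using that by simp
  qed
  have Bf: "?B x (g \<kappa>) = (\<Sum>y<K. (\<Sum>i<N. x i * \<rho> i y) * cnj (f \<kappa> y))" for x \<kappa>
    by (simp add: f_def)
  have gram_B: "(\<lambda>l. \<Sum>k<K. (\<Sum>i<N. x i * d i l k) * cnj (\<Sum>i<N. x' i * d i l k)) sums ?B x x'" for x x'
  proof -
    have "(\<lambda>l. \<Sum>i<N. \<Sum>j<N. x i * cnj (x' j) * (\<Sum>k<K. d i l k * cnj (d j l k))) sums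
          (\<Sum>i<N. \<Sum>j<N. x i * cnj (x' j) * (\<Sum>y<K. \<rho> i y * cnj (\<rho> j y)))"
      by (intro sums_sum sums_mult gram) auto
    moreover have "(\<Sum>i<N. \<Sum>j<N. x i * cnj (x' j) * (\<Sum>k<K. p i k * cnj (p j k)))
       = (\<Sum>k<K. (\<Sum>i<N. x i * p i k) * cnj (\<Sum>i<N. x' i * p i k))" for p :: "nat \<Rightarrow> nat \<Rightarrow> complex"
    proof -
      have "(\<Sum>k<K. (\<Sum>i<N. x i * p i k) * cnj (\<Sum>i<N. x' i * p i k))
         = (\<Sum>k<K. \<Sum>i<N. \<Sum>j<N. x i * p i k * (cnj (x' j) * cnj (p j k)))"
        by (simp add: sum_product)
      also have "\<dots> = (\<Sum>i<N. \<Sum>k<K. \<Sum>j<N. x i * p i k * (cnj (x' j) * cnj (p j k)))"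
        by (rule sum.swap)
      also have "\<dots> = (\<Sum>i<N. \<Sum>j<N. \<Sum>k<K. x i * p i k * (cnj (x' j) * cnj (p j k)))"
        by (intro sum.cong refl sum.swap)
      finally show ?thesis by (simp add: sum_distrib_left mult_ac)
    qed
    ultimately show ?thesis by simp
  qed
  have contractive: "(\<Sum>l<L. \<Sum>k<K. (cmod (\<Sum>y<K. V l k y * v y))\<^sup>2) \<le> (\<Sum>y<K. (cmod (v y))\<^sup>2)" for L v
  proof -
    define t where "t \<kappa> = (\<Sum>y<K. f \<kappa> y * v y)" for \<kappa>
    define c where "c i = (\<Sum>\<kappa><R. cnj (t \<kappa>) * g \<kappa> i)" for i
    have Vv: "(\<Sum>y<K. V l k y * v y) = cnj (\<Sum>i<N. c i * d i l k)" for l k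
    proof -
      have "(\<Sum>y<K. V l k y * v y) = (\<Sum>y<K. \<Sum>\<kappa><R. cnj (e \<kappa> l k) * (f \<kappa> y * v y))"
        by (simp add: V_def sum_distrib_right mult.assoc)
      also have "\<dots> = (\<Sum>\<kappa><R. cnj (e \<kappa> l k) * t \<kappa>)"
        by (subst sum.swap) (simp add: t_def sum_distrib_left)
      also have "\<dots> = (\<Sum>\<kappa><R. \<Sum>i<N. cnj (cnj (t \<kappa>) * g \<kappa> i * d i l k))"
        by (simp add: e_def sum_distrib_right sum_distrib_left mult_ac)
      also have "\<dots> = cnj (\<Sum>i<N. c i * d i l k)"
        by (subst sum.swap) (simp add: c_def sum_distrib_right)
      finally show ?thesis .
    qed
    have sm: "(\<lambda>l. \<Sum>k<K. (cmod (\<Sum>i<N. c i * d i l k))\<^sup>2) sums Re (?B c c)"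
      using sums_Re[OF gram_B[of c c]] by (simp add: complex_norm_square[symmetric] del: cnj_sum flip: of_real_power of_real_sum)
    have "(\<Sum>l<L. \<Sum>k<K. (cmod (\<Sum>i<N. c i * d i l k))\<^sup>2) \<le> (\<Sum>l. \<Sum>k<K. (cmod (\<Sum>i<N. c i * d i l k))\<^sup>2)"
      by (rule sum_le_suminf[OF sums_summable[OF sm]]) (auto intro!: sum_nonneg)
    also have "\<dots> = Re (?B c c)" by (rule sums_unique[OF sm, symmetric])
    also have "?B c c = complex_of_real (\<Sum>\<kappa><R. (cmod (cnj (t \<kappa>)))\<^sup>2)"
      using B.orthonormal_comb_norm[OF g, of "\<lambda>\<kappa>. cnj (t \<kappa>)"] by (simp add: c_def)
    finally have 1: "(\<Sum>l<L. \<Sum>k<K. (cmod (\<Sum>y<K. V l k y * v y))\<^sup>2) \<le> (\<Sum>\<kappa><R. (cmod (t \<kappa>))\<^sup>2)"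
      by (simp add: Vv del: cnj_sum)
    interpret S: semi_ip "\<lambda>x x'. \<Sum>y<K. (\<Sum>i<K. x i * coord y i) * cnj (\<Sum>i<K. x' i * coord y i)"
      by (rule gram_form[where N=K and K=K and \<rho>="\<lambda>i y. coord y i"])
    have S: "(\<Sum>y<K. (\<Sum>i<K. x i * coord y i) * cnj (\<Sum>i<K. x' i * coord y i)) = (\<Sum>y<K. x y * cnj (x' y))" for x x'
    proof (rule sum.cong)
      fix y assume "y \<in> {..<K}"
      then have "(\<Sum>i<K. z i * coord y i) = z y" for z :: "nat \<Rightarrow> complex"
        by (subst sum.cong[OF refl, of _ _ "\<lambda>i. if i = y then z y else 0"]) (auto simp: coord_def)
      then show "(\<Sum>i<K. x i * coord y i) * cnj (\<Sum>i<K. x' i * coord y i) = x y * cnj (x' y)" by simp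
    qed simp
    have "S.orthonormal R f"
      unfolding S.orthonormal_def unfolding S
      using g unfolding B.orthonormal_def f_def .
    from S.bessel[OF this, of "\<lambda>y. cnj (v y)"]
    have "(\<Sum>\<kappa><R. (cmod (\<Sum>y<K. cnj (v y) * cnj (f \<kappa> y)))\<^sup>2) \<le> Re (\<Sum>y<K. cnj (v y) * v y)"
      unfolding S by simp
    moreover have "(\<Sum>y<K. cnj (v y) * cnj (f \<kappa> y)) = cnj (t \<kappa>)" for \<kappa>
      by (simp add: t_def mult.commute)
    moreover have "Re (\<Sum>y<K. cnj (v y) * v y) = (\<Sum>y<K. (cmod (v y))\<^sup>2)"
      unfolding Re_sum by (intro sum.cong refl) (simp add: cmod_power2 power2_eq_square[of "Re _"] power2_eq_square[of "Im _"])
    ultimately have "(\<Sum>\<kappa><R. (cmod (t \<kappa>))\<^sup>2) \<le> (\<Sum>y<K. (cmod (v y))\<^sup>2)" by simp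
    with 1 show ?thesis by linarith
  qed
  moreover have "(\<lambda>l. \<Sum>k<K. d i l k * V l k y) sums \<rho> i y" if i: "i < N" and y: "y < K" for i y
  proof -
    have "(\<lambda>l. \<Sum>k<K. (\<Sum>j<N. coord i j * d j l k) * cnj (\<Sum>j<N. g \<kappa> j * d j l k)) sums ?B (coord i) (g \<kappa>)" for \<kappa>
      by (rule gram_B)
    then have ex: "(\<lambda>l. \<Sum>k<K. d i l k * cnj (e \<kappa> l k)) sums ?B (coord i) (g \<kappa>)" for \<kappa>
      unfolding coord_sum[OF i] e_def .
    have "(\<lambda>l. \<Sum>\<kappa><R. (\<Sum>k<K. d i l k * cnj (e \<kappa> l k)) * f \<kappa> y) sums (\<Sum>\<kappa><R. ?B (coord i) (g \<kappa>) * f \<kappa> y)"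
      by (rule sums_sum, rule sums_mult2, rule ex)
    moreover have "(\<Sum>\<kappa><R. (\<Sum>k<K. d i l k * cnj (e \<kappa> l k)) * f \<kappa> y) = (\<Sum>k<K. d i l k * V l k y)" for l
      unfolding V_def sum_distrib_left sum_distrib_right
      by (subst sum.swap) (simp add: mult.assoc)
    moreover have "(\<Sum>\<kappa><R. ?B (coord i) (g \<kappa>) * f \<kappa> y) = \<rho> i y"
    proof -
      let ?x = "B.residual R g (coord i)"
      have "(\<Sum>y<K. (cmod (\<Sum>j<N. ?x j * \<rho> j y))\<^sup>2) = 0"
      proof -
        have "complex_of_real (\<Sum>y<K. (cmod (\<Sum>j<N. ?x j * \<rho> j y))\<^sup>2) = ?B ?x ?x"
          by (simp add: complex_norm_square del: cnj_sum of_real_power)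
        also have "\<dots> = 0" by (rule null[OF i])
        finally show ?thesis by (simp only: of_real_eq_0_iff)
      qed
      then have "(\<Sum>j<N. ?x j * \<rho> j y) = 0"
        using y by (subst (asm) sum_nonneg_eq_0_iff) auto
      moreover have "(\<Sum>j<N. ?x j * \<rho> j y) = (\<Sum>j<N. coord i j * \<rho> j y) - (\<Sum>j<N. \<Sum>\<kappa><R. ?B (coord i) (g \<kappa>) * g \<kappa> j * \<rho> j y)"
        unfolding B.residual_def by (simp add: left_diff_distrib sum_subtractf sum_distrib_right)
      moreover have "(\<Sum>j<N. \<Sum>\<kappa><R. ?B (coord i) (g \<kappa>) * g \<kappa> j * \<rho> j y) = (\<Sum>\<kappa><R. ?B (coord i) (g \<kappa>) * f \<kappa> y)"
        by (subst sum.swap) (simp only: f_def sum_distrib_left mult.assoc)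
      ultimately show ?thesis by (simp add: coord_sum[OF i])
    qed
    ultimately show ?thesis by simp
  qed
  moreover have "\<exists>C\<ge>0. \<forall>l. \<forall>k<K. \<forall>y<K. cmod (V l k y) \<le> C * (\<Sum>i<N. cmod (d i l k))"
  proof (intro exI conjI allI impI)
    let ?G = "\<lambda>\<kappa>. \<Sum>i<N. cmod (g \<kappa> i)" and ?F = "\<lambda>\<kappa>. \<Sum>y<K. cmod (f \<kappa> y)"
    show "0 \<le> (\<Sum>\<kappa><R. ?G \<kappa> * ?F \<kappa>)" by (intro sum_nonneg mult_nonneg_nonneg) auto
    fix l k y assume y: "y < K"
    let ?D = "\<Sum>i<N. cmod (d i l k)"
    have e: "cmod (e \<kappa> l k) \<le> ?G \<kappa> * ?D" for \<kappa>
    proof -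
      have "cmod (e \<kappa> l k) \<le> (\<Sum>i<N. cmod (g \<kappa> i * d i l k))" unfolding e_def by (rule norm_sum)
      also have "\<dots> \<le> (\<Sum>i<N. cmod (g \<kappa> i) * ?D)"
        unfolding norm_mult by (intro sum_mono mult_left_mono member_le_sum) auto
      finally show ?thesis by (simp add: sum_distrib_right)
    qed
    have "cmod (V l k y) \<le> (\<Sum>\<kappa><R. cmod (cnj (e \<kappa> l k) * f \<kappa> y))" unfolding V_def by (rule norm_sum)
    also have "\<dots> \<le> (\<Sum>\<kappa><R. ?G \<kappa> * ?D * ?F \<kappa>)"
      unfolding norm_mult complex_mod_cnj
      by (intro sum_mono mult_mono e member_le_sum) (use y in \<open>auto intro!: mult_nonneg_nonneg sum_nonneg\<close>)
    also have "\<dots> = (\<Sum>\<kappa><R. ?G \<kappa> * ?F \<kappa>) * ?D"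
      unfolding sum_distrib_right[of "\<lambda>\<kappa>. ?G \<kappa> * ?F \<kappa>"] by (intro sum.cong refl) (simp only: mult_ac)
    finally show "cmod (V l k y) \<le> (\<Sum>\<kappa><R. ?G \<kappa> * ?F \<kappa>) * ?D" .
  qed
  ultimately show ?thesis by blast
qed

section \<open>Transfer functions and the complete Pick property\<close>

lemma sum_lessThan_split:
  fixes g :: "nat \<Rightarrow> 'a::comm_monoid_add"
  shows "(\<Sum>y<r + m. g y) = (\<Sum>y<r. g y) + (\<Sum>k<m. g (r + k))"
  by (induction m) (simp_all add: add.assoc)

context renewal
begin

lemma conv_up: "conv c (up l d) n = up l (conv c d) n"
proof (cases "l \<le> n")
  case True
  have "conv c (up l d) n = (\<Sum>i\<le>n - l. complex_of_real (sqrt (b l)) * (c i * d (n - l - i)))"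
    unfolding conv_def
  proof (rule sum.mono_neutral_cong_right)
    show "\<forall>i\<in>{..n} - {..n - l}. c i * up l d (n - i) = 0" using True by (auto simp: up_def)
    show "c i * up l d (n - i) = complex_of_real (sqrt (b l)) * (c i * d (n - l - i))" if "i \<in> {..n - l}" for i
    proof -
      have "n - i - l = n - l - i" "l \<le> n - i" using that True by auto
      then show ?thesis by (simp add: up_def)
    qed
  qed auto
  then show ?thesis using True by (simp add: up_def conv_def sum_distrib_left)
next
  case False
  then show ?thesis by (auto simp: conv_def up_def intro!: sum.neutral)
qed

end

text \<open>
  A linear system with \<open>r\<close> inputs, \<open>r\<close> outputs and \<open>m\<close> states. Column \<open>y\<close> of \<open>V\<close> is an input for \<open>y < r\<close> and the
  state coordinate \<open>y - r\<close> otherwise. Block row \<open>0\<close> produces the output and block row \<open>l \<ge> 1\<close> produces the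
  contribution to the next state that is delayed by the letter \<open>l\<close>.
\<close>

locale realization = renewal b for b +
  fixes r m :: nat and V :: "nat \<Rightarrow> nat \<Rightarrow> nat \<Rightarrow> complex"
  assumes contractive: "(\<Sum>l<L. \<Sum>k<r + m. (cmod (\<Sum>y<r + m. V l k y * v y))\<^sup>2) \<le> (\<Sum>y<r + m. (cmod (v y))\<^sup>2)"
begin

lemma contractive_split:
  "(\<Sum>p<r. (cmod (\<Sum>y<r + m. V 0 p y * v y))\<^sup>2) + (\<Sum>l=1..N. \<Sum>k<m. (cmod (\<Sum>y<r + m. V l k y * v y))\<^sup>2)
    \<le> (\<Sum>y<r + m. (cmod (v y))\<^sup>2)"
proof -
  let ?f = "\<lambda>l k. (cmod (\<Sum>y<r + m. V l k y * v y))\<^sup>2"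
  have set: "{..<Suc N} = insert 0 {1..N}" by auto
  have "(\<Sum>p<r. ?f 0 p) + (\<Sum>l=1..N. \<Sum>k<m. ?f l k) \<le> (\<Sum>k<r + m. ?f 0 k) + (\<Sum>l=1..N. \<Sum>k<r + m. ?f l k)"
    by (intro add_mono sum_mono sum_mono2) auto
  also have "\<dots> = (\<Sum>l<Suc N. \<Sum>k<r + m. ?f l k)"
    unfolding set by (subst sum.insert) auto
  also have "\<dots> \<le> (\<Sum>y<r + m. (cmod (v y))\<^sup>2)" by (rule contractive)
  finally show ?thesis .
qed

text \<open>
  Applying the contraction \<open>V\<close> in each degree bounds output plus feedback by input plus state. By the row contraction the
  state is no larger than the feedback it comes from, and these two terms cancel.
\<close>

lemma energy:
  assumes T: "\<And>k n. k < m \<Longrightarrow> T n (r + k) = (\<Sum>l=1..n. up l (\<lambda>n. \<Sum>y<r + m. V l k y * T n y) n)"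
  shows "(\<Sum>p<r. Q N (\<lambda>n. \<Sum>y<r + m. V 0 p y * T n y)) \<le> (\<Sum>q<r. Q N (\<lambda>n. T n q))"
proof -
  define Z where "Z l k n = (\<Sum>y<r + m. V l k y * T n y)" for l k n
  have pt: "(\<Sum>p<r. (cmod (Z 0 p n))\<^sup>2 / a n) + (\<Sum>l=1..N. \<Sum>k<m. (cmod (Z l k n))\<^sup>2 / a n)
      \<le> (\<Sum>y<r + m. (cmod (T n y))\<^sup>2 / a n)" for n
  proof -
    have "(\<Sum>p<r. (cmod (Z 0 p n))\<^sup>2 / a n) + (\<Sum>l=1..N. \<Sum>k<m. (cmod (Z l k n))\<^sup>2 / a n)
      = ((\<Sum>p<r. (cmod (Z 0 p n))\<^sup>2) + (\<Sum>l=1..N. \<Sum>k<m. (cmod (Z l k n))\<^sup>2)) / a n"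
      by (simp add: sum_divide_distrib add_divide_distrib)
    also have "\<dots> \<le> (\<Sum>y<r + m. (cmod (T n y))\<^sup>2) / a n"
      unfolding Z_def by (intro divide_right_mono contractive_split) simp
    finally show ?thesis by (simp add: sum_divide_distrib)
  qed
  have "(\<Sum>n\<le>N. (\<Sum>p<r. (cmod (Z 0 p n))\<^sup>2 / a n) + (\<Sum>l=1..N. \<Sum>k<m. (cmod (Z l k n))\<^sup>2 / a n))
      \<le> (\<Sum>n\<le>N. \<Sum>y<r + m. (cmod (T n y))\<^sup>2 / a n)"
    by (intro sum_mono pt)
  moreover have "(\<Sum>n\<le>N. \<Sum>p<r. (cmod (Z 0 p n))\<^sup>2 / a n) = (\<Sum>p<r. Q N (Z 0 p))"
    unfolding Q_def by (rule sum.swap)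
  moreover have "(\<Sum>n\<le>N. \<Sum>l=1..N. \<Sum>k<m. (cmod (Z l k n))\<^sup>2 / a n) = (\<Sum>k<m. \<Sum>l=1..N. Q N (Z l k))"
  proof -
    have "(\<Sum>n\<le>N. \<Sum>l=1..N. \<Sum>k<m. (cmod (Z l k n))\<^sup>2 / a n) = (\<Sum>l=1..N. \<Sum>n\<le>N. \<Sum>k<m. (cmod (Z l k n))\<^sup>2 / a n)"
      by (rule sum.swap)
    also have "\<dots> = (\<Sum>l=1..N. \<Sum>k<m. Q N (Z l k))"
      unfolding Q_def by (intro sum.cong refl sum.swap)
    also have "\<dots> = (\<Sum>k<m. \<Sum>l=1..N. Q N (Z l k))" by (rule sum.swap)
    finally show ?thesis .
  qed
  moreover have "(\<Sum>n\<le>N. \<Sum>y<r + m. (cmod (T n y))\<^sup>2 / a n)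
      = (\<Sum>q<r. Q N (\<lambda>n. T n q)) + (\<Sum>k<m. Q N (\<lambda>n. T n (r + k)))"
  proof -
    have "(\<Sum>n\<le>N. \<Sum>y<r + m. (cmod (T n y))\<^sup>2 / a n) = (\<Sum>y<r + m. Q N (\<lambda>n. T n y))"
      unfolding Q_def by (rule sum.swap)
    then show ?thesis by (simp only: sum_lessThan_split)
  qed
  moreover have "(\<Sum>k<m. Q N (\<lambda>n. T n (r + k))) \<le> (\<Sum>k<m. \<Sum>l=1..N. Q N (Z l k))"
  proof (rule sum_mono)
    fix k assume "k \<in> {..<m}"
    then have k: "k < m" by simp
    have "Q N (\<lambda>n. T n (r + k)) = Q N (\<lambda>n. (if n = 0 then 0 else 0) + (\<Sum>l\<in>{1..N}. up (id l) (Z l k) n))"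
    proof (rule Q_cong)
      fix n assume "n \<le> N"
      then have "(\<Sum>l=1..n. up l (Z l k) n) = (\<Sum>l\<in>{1..N}. up l (Z l k) n)"
        by (intro sum.mono_neutral_left) (auto simp: up_def)
      then show "T n (r + k) = (if n = 0 then 0 else 0) + (\<Sum>l\<in>{1..N}. up (id l) (Z l k) n)"
        using T[OF k, of n] by (simp add: Z_def[abs_def])
    qed
    also have "\<dots> \<le> (cmod 0)\<^sup>2 + (\<Sum>l\<in>{1..N}. Qs N (id l) (Z l k))"
      by (rule row_contraction) auto
    also have "\<dots> \<le> (\<Sum>l=1..N. Q N (Z l k))"
      by (simp add: sum_mono Qs_le)
    finally show "Q N (\<lambda>n. T n (r + k)) \<le> (\<Sum>l=1..N. Q N (Z l k))" .
  qed
  ultimately have "(\<Sum>p<r. Q N (Z 0 p)) \<le> (\<Sum>q<r. Q N (\<lambda>n. T n q))"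
    by (simp add: sum.distrib)
  then show ?thesis by (simp add: Z_def[abs_def])
qed

text \<open>
  The combined input and state sequence when the input is the constant \<open>1\<close> in channel \<open>q\<close>; entry \<open>y\<close> is an
  input for \<open>y < r\<close> and a state otherwise.
\<close>

fun state :: "nat \<Rightarrow> nat \<Rightarrow> nat \<Rightarrow> complex" where
  "state q n y = (if y < r then (if n = 0 \<and> y = q then 1 else 0)
     else \<Sum>l=1..n. complex_of_real (sqrt (b l)) * (\<Sum>y'<r + m. V l (y - r) y' * state q (n - l) y'))"

declare state.simps [simp del]

definition transfer :: "nat \<Rightarrow> nat \<Rightarrow> nat \<Rightarrow> complex" where
  "transfer p q n = (\<Sum>y<r + m. V 0 p y * state q n y)"

lemma state_input: "y < r \<Longrightarrow> state q n y = (if y = q then delta 0 n else 0)"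
  by (simp add: state.simps[of q n y] delta_def)

lemma state_rec: "state q n (r + k) = (\<Sum>l=1..n. up l (\<lambda>n. \<Sum>y<r + m. V l k y * state q n y) n)"
  by (subst state.simps) (auto simp: up_def intro!: sum.cong)

text \<open>
  The system is linear and commutes with shifts, so the state for the input \<open>F\<close> is obtained by convolution from the
  states for the constant inputs, and the energy inequality applies to it.
\<close>

lemma response:
  "(\<Sum>p<r. Q N (\<lambda>n. \<Sum>q<r. conv (F q) (transfer p q) n)) \<le> (\<Sum>q<r. Q N (F q))"
proof -
  define T where "T n y = (\<Sum>q<r. conv (F q) (\<lambda>n. state q n y) n)" for n y
  have ZT: "(\<Sum>y<r + m. V l k y * T n y) = (\<Sum>q<r. conv (F q) (\<lambda>n. \<Sum>y<r + m. V l k y * state q n y) n)" for l k n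
    unfolding conv_sum_right T_def sum_distrib_left by (rule sum.swap)
  have "T n (r + k) = (\<Sum>l=1..n. up l (\<lambda>n. \<Sum>y<r + m. V l k y * T n y) n)" for k n
  proof -
    have "T n (r + k) = (\<Sum>q<r. \<Sum>l=1..n. up l (conv (F q) (\<lambda>n. \<Sum>y<r + m. V l k y * state q n y)) n)"
      unfolding T_def
    proof (rule sum.cong)
      fix q
      let ?c = "\<lambda>l n. \<Sum>y<r + m. V l k y * state q n y"
      have "conv (F q) (\<lambda>n. state q n (r + k)) n = conv (F q) (\<lambda>i. \<Sum>l\<in>{1..n}. 1 * up l (?c l) i) n"
      proof (rule conv_cong)
        fix i assume "i \<le> n"
        then have "(\<Sum>l=1..i. up l (?c l) i) = (\<Sum>l=1..n. up l (?c l) i)"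
          by (intro sum.mono_neutral_left) (auto simp: up_def)
        then show "state q i (r + k) = (\<Sum>l=1..n. 1 * up l (?c l) i)" by (simp add: state_rec)
      qed
      also have "\<dots> = (\<Sum>l=1..n. 1 * conv (F q) (up l (?c l)) n)" by (rule conv_sum_right)
      also have "\<dots> = (\<Sum>l=1..n. up l (conv (F q) (?c l)) n)" by (simp add: conv_up)
      finally show "conv (F q) (\<lambda>n. state q n (r + k)) n = (\<Sum>l=1..n. up l (conv (F q) (?c l)) n)" .
    qed simp
    also have "\<dots> = (\<Sum>l=1..n. \<Sum>q<r. up l (conv (F q) (\<lambda>n. \<Sum>y<r + m. V l k y * state q n y)) n)"
      by (rule sum.swap)
    also have "\<dots> = (\<Sum>l=1..n. up l (\<lambda>n. \<Sum>y<r + m. V l k y * T n y) n)"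
      unfolding ZT up_sum ..
    finally show ?thesis .
  qed
  then have "(\<Sum>p<r. Q N (\<lambda>n. \<Sum>y<r + m. V 0 p y * T n y)) \<le> (\<Sum>q<r. Q N (\<lambda>n. T n q))"
    by (rule energy)
  also have "(\<Sum>q<r. Q N (\<lambda>n. T n q)) = (\<Sum>q<r. Q N (F q))"
  proof (rule sum.cong)
    fix y assume "y \<in> {..<r}"
    then have y: "y < r" by simp
    have "T n y = F y n" for n
    proof -
      have "T n y = (\<Sum>q<r. if q = y then F y n else 0)"
        unfolding T_def
      proof (rule sum.cong)
        fix q
        have "conv (F q) (\<lambda>n. state q n y) n = (if q = y then conv (F q) (delta 0) n else 0)"
          using y by (simp add: state_input conv_def)
        then show "conv (F q) (\<lambda>n. state q n y) n = (if q = y then F y n else 0)"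
          by (simp add: conv_delta)
      qed simp
      then show ?thesis using y by simp
    qed
    then show "Q N (\<lambda>n. T n y) = Q N (F y)" by simp
  qed simp
  finally show ?thesis by (simp only: ZT transfer_def[abs_def])
qed

lemma response_single:
  assumes "p < r" "q < r"
  shows "Q N (conv f (transfer p q)) \<le> Q N f"
proof -
  let ?F = "\<lambda>j. if j = q then f else (\<lambda>n. 0)"
  have z: "Q N (\<lambda>n. 0) = 0" by (simp add: Q_def)
  have eq: "(\<Sum>j<r. conv (?F j) (transfer p' j) n) = conv f (transfer p' q) n" for p' n
  proof -
    have "(\<Sum>j<r. conv (?F j) (transfer p' j) n) = (\<Sum>j<r. if j = q then conv f (transfer p' q) n else 0)"
      by (rule sum.cong) (auto simp: conv_def)
    then show ?thesis using assms(2) by simp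
  qed
  have "(\<Sum>p'<r. Q N (conv f (transfer p' q))) \<le> (\<Sum>j<r. Q N (?F j))"
    using response[of N ?F] by (simp only: eq)
  also have "\<dots> = (\<Sum>j<r. if j = q then Q N f else 0)"
    by (rule sum.cong) (auto simp: z)
  also have "\<dots> = Q N f" using assms(2) by simp
  finally have "(\<Sum>p'<r. Q N (conv f (transfer p' q))) \<le> Q N f" .
  moreover have "Q N (conv f (transfer p q)) \<le> (\<Sum>p'<r. Q N (conv f (transfer p' q)))"
    using assms(1) by (intro member_le_sum) (auto simp: Q_nonneg)
  ultimately show ?thesis by linarith
qed

lemma conv_transfer_ell:
  assumes "p < r" "q < r" "f \<in> ell"
  shows "conv (transfer p q) f \<in> ell"
  unfolding conv_commute[of "transfer p q"]
proof (rule ellI_bounded)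
  fix N show "Q N (conv f (transfer p q)) \<le> nsq f"
    using response_single[OF assms(1,2), of N f] Q_le_nsq[OF assms(3), of N] by linarith
qed

lemma transfer_ell: "p < r \<Longrightarrow> q < r \<Longrightarrow> transfer p q \<in> ell"
proof -
  assume "p < r" "q < r"
  from conv_transfer_ell[OF this delta_ell[of 0]] show ?thesis
    by (simp add: conv_delta[abs_def] cong: if_cong)
qed

lemma state_input_norm:
  assumes "q < r"
  shows "(\<Sum>y<r. (cmod (state q n y))\<^sup>2) = (if n = 0 then 1 else 0)"
proof -
  have "(\<Sum>y<r. (cmod (state q n y))\<^sup>2) = (\<Sum>y<r. if y = q then (if n = 0 then 1 else 0) else 0)"
    by (rule sum.cong) (auto simp: state_input delta_def)
  then show ?thesis using assms by simp
qed

text \<open>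
  The row \<open>(u 1, u 2, \<dots>)\<close> has norm at most \<open>sqrt (1/2)\<close> with respect to the unweighted norm. Feeding the state back
  through it loses half of the energy, so that the total energy \<open>S\<close> of the state satisfies \<open>S \<le> (1 + S) / 2\<close>.
\<close>

lemma state_energy:
  assumes q: "q < r"
  shows "(\<Sum>n\<le>N. \<Sum>k<m. (cmod (state q n (r + k)))\<^sup>2) \<le> 1"
proof -
  define Z where "Z l k n = (\<Sum>y<r + m. V l k y * state q n y)" for l k n
  have pt: "(cmod (state q n (r + k)))\<^sup>2 \<le> 1 / 2 * (\<Sum>l=1..n. (cmod (Z l k (n - l)))\<^sup>2)" for n k
  proof -
    have "cmod (state q n (r + k)) \<le> (\<Sum>l=1..n. cmod (up l (Z l k) n))"
      unfolding state_rec Z_def[abs_def] by (rule norm_sum)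
    also have "\<dots> = (\<Sum>l=1..n. sqrt (b l) * cmod (Z l k (n - l)))"
      by (rule sum.cong) (auto simp: up_def norm_mult b_nonneg)
    finally have "(cmod (state q n (r + k)))\<^sup>2 \<le> (\<Sum>l=1..n. sqrt (b l) * cmod (Z l k (n - l)))\<^sup>2"
      by (rule power_mono) simp
    also have "\<dots> \<le> (\<Sum>l=1..n. (sqrt (b l))\<^sup>2) * (\<Sum>l=1..n. (cmod (Z l k (n - l)))\<^sup>2)"
      by (rule Cauchy_Schwarz_ineq_sum)
    also have "(\<Sum>l=1..n. (sqrt (b l))\<^sup>2) = (\<Sum>l=1..n. b l)" by (simp add: b_nonneg)
    also have "(\<Sum>l=1..n. b l) * (\<Sum>l=1..n. (cmod (Z l k (n - l)))\<^sup>2) \<le> 1 / 2 * (\<Sum>l=1..n. (cmod (Z l k (n - l)))\<^sup>2)"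
      by (intro mult_right_mono sum_b_le sum_nonneg) auto
    finally show ?thesis .
  qed
  define S where "S = (\<Sum>n\<le>N. \<Sum>k<m. (cmod (state q n (r + k)))\<^sup>2)"
  have "S \<le> (\<Sum>n\<le>N. \<Sum>k<m. 1 / 2 * (\<Sum>l=1..n. (cmod (Z l k (n - l)))\<^sup>2))"
    unfolding S_def by (intro sum_mono pt)
  also have "\<dots> = 1 / 2 * (\<Sum>n\<le>N. \<Sum>l=1..n. \<Sum>k<m. (cmod (Z l k (n - l)))\<^sup>2)"
    unfolding sum_distrib_left[symmetric] by (intro arg_cong2[where f="(*)"] refl sum.cong sum.swap)
  also have "(\<Sum>n\<le>N. \<Sum>l=1..n. \<Sum>k<m. (cmod (Z l k (n - l)))\<^sup>2) = (\<Sum>l=1..N. \<Sum>i\<le>N - l. \<Sum>k<m. (cmod (Z l k i))\<^sup>2)"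
    by (rule sum_triangle)
  also have "\<dots> \<le> (\<Sum>l=1..N. \<Sum>i\<le>N. \<Sum>k<m. (cmod (Z l k i))\<^sup>2)"
    by (intro sum_mono sum_mono2 sum_nonneg) auto
  also have "\<dots> = (\<Sum>i\<le>N. \<Sum>l=1..N. \<Sum>k<m. (cmod (Z l k i))\<^sup>2)" by (rule sum.swap)
  also have "\<dots> \<le> (\<Sum>i\<le>N. \<Sum>y<r + m. (cmod (state q i y))\<^sup>2)"
  proof (rule sum_mono)
    fix i
    show "(\<Sum>l=1..N. \<Sum>k<m. (cmod (Z l k i))\<^sup>2) \<le> (\<Sum>y<r + m. (cmod (state q i y))\<^sup>2)"
      using contractive_split[of "\<lambda>y. state q i y" N] sum_nonneg[of "{..<r}" "\<lambda>p. (cmod (\<Sum>y<r + m. V 0 p y * state q i y))\<^sup>2"]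
      unfolding Z_def by (smt (verit) zero_le_power2)
  qed
  also have "\<dots> = 1 + S"
    unfolding S_def sum_lessThan_split sum.distrib state_input_norm[OF q] by simp
  finally show ?thesis unfolding S_def by simp
qed

lemma state_bound:
  assumes "q < r" "y < r + m"
  shows "cmod (state q n y) \<le> 1"
proof (cases "y < r")
  case True
  then show ?thesis by (simp add: state_input delta_def)
next
  case False
  then obtain k where k: "y = r + k" "k < m" using assms(2) by (metis add_less_cancel_left le_add_diff_inverse not_less)
  have "(cmod (state q n y))\<^sup>2 \<le> (\<Sum>k<m. (cmod (state q n (r + k)))\<^sup>2)"
    using k by (auto intro!: member_le_sum)
  also have "\<dots> \<le> (\<Sum>n\<le>n. \<Sum>k<m. (cmod (state q n (r + k)))\<^sup>2)"
    by (rule member_le_sum[where f="\<lambda>n. \<Sum>k<m. (cmod (state q n (r + k)))\<^sup>2"]) (auto intro!: sum_nonneg)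
  also have "\<dots> \<le> 1" by (rule state_energy[OF assms(1)])
  finally show ?thesis by (simp add: abs_square_le_1)
qed

definition state_coeff :: "nat \<Rightarrow> nat \<Rightarrow> nat \<Rightarrow> complex" where
  "state_coeff k y l = complex_of_real (sqrt (b l)) * V l k y"

lemma state_conv: "state q n (r + k) = (\<Sum>y<r + m. conv (state_coeff k y) (\<lambda>n. state q n y) n)"
proof -
  have "(\<Sum>y<r + m. conv (state_coeff k y) (\<lambda>n. state q n y) n)
      = (\<Sum>l\<le>n. \<Sum>y<r + m. complex_of_real (sqrt (b l)) * (V l k y * state q (n - l) y))"
    unfolding conv_def state_coeff_def by (subst sum.swap) (simp add: mult.assoc)
  also have "\<dots> = (\<Sum>l=1..n. \<Sum>y<r + m. complex_of_real (sqrt (b l)) * (V l k y * state q (n - l) y))"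
  proof (rule sum.mono_neutral_right)
    show "\<forall>l\<in>{..n} - {1..n}. (\<Sum>y<r + m. complex_of_real (sqrt (b l)) * (V l k y * state q (n - l) y)) = 0"
    proof
      fix l assume "l \<in> {..n} - {1..n}"
      then have "l = 0" by auto
      then show "(\<Sum>y<r + m. complex_of_real (sqrt (b l)) * (V l k y * state q (n - l) y)) = 0" by (simp add: b_0)
    qed
  qed auto
  also have "\<dots> = state q n (r + k)"
    unfolding state_rec by (rule sum.cong) (auto simp: up_def sum_distrib_left)
  finally show ?thesis by simp
qed

context
  fixes C :: real
  assumes growth: "\<And>l k y. 1 \<le> l \<Longrightarrow> k < m \<Longrightarrow> y < r + m \<Longrightarrow> cmod (V l k y) \<le> C * sqrt (b l)"
begin

lemma state_coeff_abs_summable: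
  assumes "k < m" "y < r + m"
  shows "summable (\<lambda>l. cmod (state_coeff k y l))"
proof -
  have "summable (\<lambda>l. C * b l)" by (intro summable_mult b_summable)
  then show ?thesis
  proof (rule summable_comparison_test'[of _ 1])
    fix l :: nat assume l: "1 \<le> l"
    have "cmod (state_coeff k y l) \<le> sqrt (b l) * (C * sqrt (b l))"
      unfolding state_coeff_def norm_mult using growth[OF l assms] b_nonneg[of l] by (auto intro!: mult_left_mono)
    also have "\<dots> = C * b l" using b_nonneg[of l] by simp
    finally show "norm (cmod (state_coeff k y l)) \<le> C * b l" by simp
  qed
qed

definition state_at :: "nat \<Rightarrow> real \<Rightarrow> complex \<Rightarrow> nat \<Rightarrow> complex" where
  "state_at q t z y = disc_fun (dilate t (\<lambda>n. state q n y)) z"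

lemma state_dilate_summable:
  "q < r \<Longrightarrow> y < r + m \<Longrightarrow> 0 \<le> t \<Longrightarrow> t < 1 \<Longrightarrow> summable (\<lambda>n. cmod (dilate t (\<lambda>n. state q n y) n))"
  by (rule dilate_abs_summable_bounded[of _ 1]) (auto simp: state_bound)

lemma state_at_input:
  assumes "y < r" "z \<in> cball 0 1"
  shows "state_at q t z y = (if y = q then 1 else 0)"
proof -
  have "dilate t (\<lambda>n. state q n y) = (\<lambda>n. if y = q then delta 0 n else 0)"
    using assms(1) by (auto simp: dilate_def state_input delta_def)
  then show ?thesis
    using assms(2) by (cases "y = q") (simp_all add: state_at_def disc_fun_delta disc_fun_def)
qed

lemma state_at_rec:
  assumes q: "q < r" and k: "k < m" and t: "0 \<le> t" "t < 1" and z: "z \<in> cball 0 1"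
  shows "state_at q t z (r + k) = (\<Sum>y<r + m. disc_fun (state_coeff k y) (complex_of_real t * z) * state_at q t z y)"
proof -
  have D: "summable (\<lambda>l. cmod (dilate t (state_coeff k y) l))" if "y < r + m" for y
    using state_coeff_abs_summable[OF k that] t by (intro dilate_abs_summable) auto
  have "dilate t (\<lambda>n. state q n (r + k)) = (\<lambda>n. \<Sum>y<r + m. conv (dilate t (state_coeff k y)) (dilate t (\<lambda>n. state q n y)) n)"
  proof
    fix n
    have "dilate t (\<lambda>n. state q n (r + k)) n = (\<Sum>y<r + m. dilate t (conv (state_coeff k y) (\<lambda>n. state q n y)) n)"
      by (simp add: dilate_def state_conv[of q n k] sum_distrib_right)
    then show "dilate t (\<lambda>n. state q n (r + k)) n = (\<Sum>y<r + m. conv (dilate t (state_coeff k y)) (dilate t (\<lambda>n. state q n y)) n)"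
      by (simp add: dilate_conv)
  qed
  then have "state_at q t z (r + k) = disc_fun (\<lambda>n. \<Sum>y<r + m. conv (dilate t (state_coeff k y)) (dilate t (\<lambda>n. state q n y)) n) z"
    by (simp add: state_at_def)
  also have "\<dots> = (\<Sum>y<r + m. disc_fun (conv (dilate t (state_coeff k y)) (dilate t (\<lambda>n. state q n y))) z)"
    by (subst disc_fun_sum) (auto intro!: conv_abs_summable D state_dilate_summable q t)
  also have "\<dots> = (\<Sum>y<r + m. disc_fun (dilate t (state_coeff k y)) z * state_at q t z y)"
  proof (rule sum.cong)
    fix y assume "y \<in> {..<r + m}"
    then have y: "y < r + m" by simp
    show "disc_fun (conv (dilate t (state_coeff k y)) (dilate t (\<lambda>n. state q n y))) z
        = disc_fun (dilate t (state_coeff k y)) z * state_at q t z y"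
      unfolding state_at_def disc_fun_conv[OF D[OF y] state_dilate_summable[OF q y t]] ..
  qed simp
  finally show ?thesis using t z by (simp add: disc_fun_dilate)
qed

text \<open>
  The same argument as for the coefficients, now pointwise: at a point of the disc the row has norm at most
  \<open>sqrt (1/2)\<close>. The bound does not depend on \<open>t < 1\<close>, which is what the passage to the boundary requires.
\<close>

lemma state_at_energy:
  assumes q: "q < r" and t: "0 \<le> t" "t < 1" and z: "z \<in> cball 0 1"
  shows "(\<Sum>k<m. (cmod (state_at q t z (r + k)))\<^sup>2) \<le> 1"
proof -
  let ?w = "complex_of_real t * z" and ?\<tau> = "state_at q t z"
  have w: "?w \<in> cball 0 1" using t z by (simp add: norm_mult mult_le_one)
  define \<zeta> where "\<zeta> l k = (\<Sum>y<r + m. V l k y * ?\<tau> y)" for l k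
  define X where "X = (\<Sum>k<m. (cmod (?\<tau> (r + k)))\<^sup>2)"
  have total: "(\<Sum>y<r + m. (cmod (?\<tau> y))\<^sup>2) = 1 + X"
  proof -
    have "(\<Sum>y<r. (cmod (?\<tau> y))\<^sup>2) = (\<Sum>y<r. if y = q then 1 else 0)"
      by (rule sum.cong) (auto simp: state_at_input[OF _ z])
    then show ?thesis using q by (simp add: sum_lessThan_split X_def)
  qed
  have conv: "(\<lambda>l. complex_of_real (sqrt (b l)) * ?w ^ l * \<zeta> l k) sums ?\<tau> (r + k)" if k: "k < m" for k
  proof -
    have "(\<lambda>l. \<Sum>y<r + m. (state_coeff k y l * ?w ^ l) * ?\<tau> y) sums (\<Sum>y<r + m. disc_fun (state_coeff k y) ?w * ?\<tau> y)"
    proof (rule sums_sum, rule sums_mult2)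
      fix y assume "y \<in> {..<r + m}"
      then show "(\<lambda>l. state_coeff k y l * ?w ^ l) sums disc_fun (state_coeff k y) ?w"
        using disc_summable[OF state_coeff_abs_summable[OF k, of y] w] w by (simp add: disc_fun_def summable_sums)
    qed
    moreover have "(\<Sum>y<r + m. (state_coeff k y l * ?w ^ l) * ?\<tau> y) = complex_of_real (sqrt (b l)) * ?w ^ l * \<zeta> l k" for l
      by (simp add: \<zeta>_def state_coeff_def sum_distrib_left mult_ac)
    ultimately show ?thesis using state_at_rec[OF q k t z] by simp
  qed
  have part: "(\<Sum>k<m. (cmod (\<Sum>l<L. complex_of_real (sqrt (b l)) * ?w ^ l * \<zeta> l k))\<^sup>2) \<le> 1 / 2 * (1 + X)" for L
  proof -
    have "(cmod (\<Sum>l<L. complex_of_real (sqrt (b l)) * ?w ^ l * \<zeta> l k))\<^sup>2 \<le> 1 / 2 * (\<Sum>l<L. (cmod (\<zeta> l k))\<^sup>2)" for k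
    proof -
      have "cmod (\<Sum>l<L. complex_of_real (sqrt (b l)) * ?w ^ l * \<zeta> l k) \<le> (\<Sum>l<L. sqrt (b l) * cmod (\<zeta> l k))"
      proof (rule sum_norm_le)
        fix l
        have "cmod ?w ^ l \<le> 1" using w by (simp add: power_le_one)
        then have "sqrt (b l) * cmod ?w ^ l * cmod (\<zeta> l k) \<le> sqrt (b l) * 1 * cmod (\<zeta> l k)"
          by (intro mult_right_mono mult_left_mono) (auto simp: b_nonneg)
        then show "cmod (complex_of_real (sqrt (b l)) * ?w ^ l * \<zeta> l k) \<le> sqrt (b l) * cmod (\<zeta> l k)"
          by (simp only: norm_mult norm_power norm_of_real) (simp add: b_nonneg)
      qed
      then have "(cmod (\<Sum>l<L. complex_of_real (sqrt (b l)) * ?w ^ l * \<zeta> l k))\<^sup>2 \<le> (\<Sum>l<L. sqrt (b l) * cmod (\<zeta> l k))\<^sup>2"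
        by (rule power_mono) simp
      also have "\<dots> \<le> (\<Sum>l<L. (sqrt (b l))\<^sup>2) * (\<Sum>l<L. (cmod (\<zeta> l k))\<^sup>2)" by (rule Cauchy_Schwarz_ineq_sum)
      also have "(\<Sum>l<L. (sqrt (b l))\<^sup>2) = (\<Sum>l<L. b l)" by (simp add: b_nonneg)
      also have "(\<Sum>l<L. b l) * (\<Sum>l<L. (cmod (\<zeta> l k))\<^sup>2) \<le> 1 / 2 * (\<Sum>l<L. (cmod (\<zeta> l k))\<^sup>2)"
        by (intro mult_right_mono sum_b_le sum_nonneg) auto
      finally show ?thesis .
    qed
    then have "(\<Sum>k<m. (cmod (\<Sum>l<L. complex_of_real (sqrt (b l)) * ?w ^ l * \<zeta> l k))\<^sup>2)
        \<le> (\<Sum>k<m. 1 / 2 * (\<Sum>l<L. (cmod (\<zeta> l k))\<^sup>2))" by (intro sum_mono)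
    also have "\<dots> = 1 / 2 * (\<Sum>l<L. \<Sum>k<m. (cmod (\<zeta> l k))\<^sup>2)"
      unfolding sum_distrib_left[symmetric] by (intro arg_cong2[where f="(*)"] refl sum.swap)
    also have "\<dots> \<le> 1 / 2 * (\<Sum>l<L. \<Sum>k<r + m. (cmod (\<zeta> l k))\<^sup>2)"
      by (intro mult_left_mono sum_mono sum_mono2) auto
    also have "\<dots> \<le> 1 / 2 * (1 + X)"
      unfolding \<zeta>_def total[symmetric] by (intro mult_left_mono contractive) auto
    finally show ?thesis .
  qed
  have "(\<lambda>L. \<Sum>k<m. (cmod (\<Sum>l<L. complex_of_real (sqrt (b l)) * ?w ^ l * \<zeta> l k))\<^sup>2) \<longlonglongrightarrow> X"
    unfolding X_def using conv by (intro tendsto_intros) (auto simp: sums_def)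
  then have "X \<le> 1 / 2 * (1 + X)"
    by (rule LIMSEQ_le_const2) (use part in blast)
  then show ?thesis by (simp add: X_def)
qed

lemma state_at_bound:
  assumes q: "q < r" and t: "0 \<le> t" "t < 1" and z: "z \<in> cball 0 1" and y: "y < r + m"
  shows "cmod (state_at q t z y) \<le> 1"
proof (cases "y < r")
  case True
  then show ?thesis by (simp add: state_at_input[OF _ z])
next
  case False
  then obtain k where k: "y = r + k" "k < m" using y by (metis add_less_cancel_left le_add_diff_inverse not_less)
  have "(cmod (state_at q t z y))\<^sup>2 \<le> (\<Sum>k<m. (cmod (state_at q t z (r + k)))\<^sup>2)"
    using k by (auto intro!: member_le_sum)
  also have "\<dots> \<le> 1" by (rule state_at_energy[OF q t z])
  finally show ?thesis by (simp add: abs_square_le_1)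
qed

text \<open>
  At the node \<open>z\<close> the vector \<open>g\<close> solves the adjoint state equation. Pairing it with the state equation at \<open>t z\<close>
  eliminates the state up to an error controlled by the difference of the state coefficients at \<open>t z\<close> and \<open>z\<close>.
  The detour through \<open>t < 1\<close> serves nodes on the unit circle, where the series for the state need not converge.
\<close>

lemma transfer_interpolates:
  assumes z: "z \<in> cball 0 1" and p: "p < r" and q: "q < r"
    and eq: "\<And>y. y < r + m \<Longrightarrow> V 0 p y + (\<Sum>k<m. g k * disc_fun (state_coeff k y) z) = \<rho> y"
    and \<rho>_state: "\<And>k. k < m \<Longrightarrow> \<rho> (r + k) = g k"
  shows "disc_fun (transfer p q) z = \<rho> q"
proof -
  \<comment> \<open>The error that remains after the state has been eliminated; it vanishes as \<open>t\<close> tends to \<open>1\<close>.\<close>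
  define E where "E t = (\<Sum>k<m. g k * (\<Sum>y<r + m. (disc_fun (state_coeff k y) (complex_of_real t * z) - disc_fun (state_coeff k y) z) * state_at q t z y))" for t
  have val: "disc_fun (transfer p q) (complex_of_real t * z) = \<rho> q + E t" if t: "0 \<le> t" "t < 1" for t
  proof -
    let ?\<tau> = "state_at q t z"
    have "dilate t (transfer p q) = (\<lambda>n. \<Sum>y<r + m. V 0 p y * dilate t (\<lambda>n. state q n y) n)"
      by (auto simp: dilate_def transfer_def sum_distrib_right mult.assoc)
    then have "disc_fun (transfer p q) (complex_of_real t * z) = disc_fun (\<lambda>n. \<Sum>y<r + m. V 0 p y * dilate t (\<lambda>n. state q n y) n) z"
      using disc_fun_dilate[of t z "transfer p q"] t z by simp
    also have "\<dots> = (\<Sum>y<r + m. disc_fun (\<lambda>n. V 0 p y * dilate t (\<lambda>n. state q n y) n) z)"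
      by (subst disc_fun_sum) (auto intro!: abs_summable_scale state_dilate_summable q t)
    also have "\<dots> = (\<Sum>y<r + m. V 0 p y * ?\<tau> y)"
      by (rule sum.cong) (auto simp: disc_fun_scale state_dilate_summable q t state_at_def)
    also have "\<dots> = (\<Sum>y<r + m. \<rho> y * ?\<tau> y - (\<Sum>k<m. g k * disc_fun (state_coeff k y) z) * ?\<tau> y)"
    proof (rule sum.cong)
      fix y assume "y \<in> {..<r + m}"
      then have "V 0 p y = \<rho> y - (\<Sum>k<m. g k * disc_fun (state_coeff k y) z)" using eq[of y] by (simp add: eq_diff_eq)
      then show "V 0 p y * ?\<tau> y = \<rho> y * ?\<tau> y - (\<Sum>k<m. g k * disc_fun (state_coeff k y) z) * ?\<tau> y"
        by (simp only: left_diff_distrib)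
    qed simp
    also have "\<dots> = (\<Sum>y<r + m. \<rho> y * ?\<tau> y) - (\<Sum>k<m. g k * (\<Sum>y<r + m. disc_fun (state_coeff k y) z * ?\<tau> y))"
    proof -
      have "(\<Sum>y<r + m. (\<Sum>k<m. g k * disc_fun (state_coeff k y) z) * ?\<tau> y) = (\<Sum>k<m. g k * (\<Sum>y<r + m. disc_fun (state_coeff k y) z * ?\<tau> y))"
        unfolding sum_distrib_left sum_distrib_right by (subst sum.swap) (simp only: mult.assoc)
      then show ?thesis by (simp only: sum_subtractf)
    qed
    also have "(\<Sum>y<r + m. \<rho> y * ?\<tau> y) = \<rho> q + (\<Sum>k<m. g k * ?\<tau> (r + k))"
    proof -
      have "(\<Sum>y<r. \<rho> y * ?\<tau> y) = (\<Sum>y<r. if y = q then \<rho> q else 0)"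
        by (rule sum.cong) (auto simp: state_at_input[OF _ z])
      then show ?thesis using q by (simp add: sum_lessThan_split \<rho>_state)
    qed
    also have "(\<Sum>k<m. g k * ?\<tau> (r + k)) = (\<Sum>k<m. g k * (\<Sum>y<r + m. disc_fun (state_coeff k y) (complex_of_real t * z) * ?\<tau> y))"
      by (rule sum.cong) (auto simp: state_at_rec[OF q _ t z])
    finally show ?thesis
      unfolding E_def left_diff_distrib sum_subtractf right_diff_distrib by simp
  qed
  define s where "s i = 1 - inverse (real (Suc i))" for i
  have s: "0 \<le> s i" "s i < 1" for i by (simp_all add: s_def inverse_le_1_iff)
  have "s \<longlonglongrightarrow> 1 - 0" unfolding s_def[abs_def] by (intro tendsto_intros LIMSEQ_inverse_real_of_nat)
  then have "(\<lambda>i. complex_of_real (s i) * z) \<longlonglongrightarrow> complex_of_real 1 * z" by (intro tendsto_intros) simp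
  then have sz: "(\<lambda>i. complex_of_real (s i) * z) \<longlonglongrightarrow> z" by simp
  have in_disc: "complex_of_real (s i) * z \<in> cball 0 1" for i
    using s[of i] z by (simp add: norm_mult mult_le_one)
  have cont: "(\<lambda>i. disc_fun c (complex_of_real (s i) * z)) \<longlonglongrightarrow> disc_fun c z" if "summable (\<lambda>n. cmod (c n))" for c
    by (rule continuous_on_tendsto_compose[OF continuous_on_disc_fun[OF that] sz z]) (use in_disc in simp)
  have "(\<lambda>i. E (s i)) \<longlonglongrightarrow> 0"
  proof -
    let ?u = "\<lambda>i. \<Sum>k<m. cmod (g k) * (\<Sum>y<r + m. cmod (disc_fun (state_coeff k y) (complex_of_real (s i) * z) - disc_fun (state_coeff k y) z))"
    have "?u \<longlonglongrightarrow> (\<Sum>k<m. cmod (g k) * (\<Sum>y<r + m. cmod (disc_fun (state_coeff k y) z - disc_fun (state_coeff k y) z)))"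
      by (intro tendsto_intros cont state_coeff_abs_summable) auto
    then have u: "?u \<longlonglongrightarrow> 0" by simp
    show ?thesis
    proof (rule Lim_null_comparison[OF always_eventually u], rule allI)
      fix i
      show "cmod (E (s i)) \<le> ?u i"
        unfolding E_def
      proof (rule sum_norm_le)
        fix k
        have "cmod (\<Sum>y<r + m. (disc_fun (state_coeff k y) (complex_of_real (s i) * z) - disc_fun (state_coeff k y) z) * state_at q (s i) z y)
           \<le> (\<Sum>y<r + m. cmod (disc_fun (state_coeff k y) (complex_of_real (s i) * z) - disc_fun (state_coeff k y) z))"
          by (rule sum_norm_le) (auto simp: norm_mult intro!: mult_left_le state_at_bound q s z)
        then show "cmod (g k * (\<Sum>y<r + m. (disc_fun (state_coeff k y) (complex_of_real (s i) * z) - disc_fun (state_coeff k y) z) * state_at q (s i) z y))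
           \<le> cmod (g k) * (\<Sum>y<r + m. cmod (disc_fun (state_coeff k y) (complex_of_real (s i) * z) - disc_fun (state_coeff k y) z))"
          unfolding norm_mult by (rule mult_left_mono) simp
      qed
    qed
  qed
  then have "(\<lambda>i. \<rho> q + E (s i)) \<longlonglongrightarrow> \<rho> q + 0" by (intro tendsto_intros)
  then have "(\<lambda>i. disc_fun (transfer p q) (complex_of_real (s i) * z)) \<longlonglongrightarrow> \<rho> q"
    using s by (simp add: val)
  moreover have "(\<lambda>i. disc_fun (transfer p q) (complex_of_real (s i) * z)) \<longlonglongrightarrow> disc_fun (transfer p q) z"
    by (rule cont[OF ell_abs_summable[OF transfer_ell[OF p q]]])
  ultimately show ?thesis using LIMSEQ_unique by blast
qed

end

end

lemma index_mult_adjoint: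
  assumes "A \<in> carrier_mat r r" "B \<in> carrier_mat r r" "p < r" "q < r"
  shows "(A * mat_adjoint B) $$ (p, q) = (\<Sum>s<r. A $$ (p, s) * cnj (B $$ (q, s)))"
  using assms by (auto simp: mat_adjoint_def mat_of_rows_def scalar_prod_def atLeast0LessThan intro!: sum.cong)

lemma pick_matrix_index:
  assumes "\<And>i. i < n \<Longrightarrow> W i \<in> carrier_mat r r" "i < n * r" "j < n * r"
  shows "pick_matrix k r n z W $$ (i, j) = k (z (i div r)) (z (j div r)) *
     ((if i mod r = j mod r then 1 else 0)
       - (\<Sum>s<r. W (i div r) $$ (i mod r, s) * cnj (W (j div r) $$ (j mod r, s))))"
proof -
  have r: "0 < r" using assms(2) by (auto intro: gr0I)
  have d: "i div r < n" "j div r < n" using assms(2,3) by (auto simp: less_mult_imp_div_less)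
  have m: "i mod r < r" "j mod r < r" using r by auto
  have c: "W (i div r) \<in> carrier_mat r r" "W (j div r) \<in> carrier_mat r r" using assms(1) d by auto
  have "(1\<^sub>m r - W (i div r) * mat_adjoint (W (j div r))) $$ (i mod r, j mod r)
     = (if i mod r = j mod r then 1 else 0) - (W (i div r) * mat_adjoint (W (j div r))) $$ (i mod r, j mod r)"
    using m c by (auto simp: mat_adjoint_def)
  then show ?thesis using assms(2,3) by (simp add: pick_matrix_def index_mult_adjoint[OF c m])
qed

lemma positive_semidefinite_mat_Re:
  assumes "positive_semidefinite_mat A" "A \<in> carrier_mat N N"
  shows "0 \<le> Re (\<Sum>i<N. \<Sum>j<N. x i * A $$ (i, j) * cnj (x j))"
proof -
  define v where "v = vec N (\<lambda>i. cnj (x i))"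
  have "v \<in> carrier_vec (dim_row A)" using assms(2) by (simp add: v_def)
  then have "0 \<le> (A *\<^sub>v v) \<bullet>c v" using assms(1) by (simp add: positive_semidefinite_mat_def)
  then have "0 \<le> Re ((A *\<^sub>v v) \<bullet>c v)" by (simp add: less_eq_complex_def)
  also have "(A *\<^sub>v v) \<bullet>c v = (\<Sum>i<N. \<Sum>j<N. x i * A $$ (i, j) * cnj (x j))"
    using assms(2)
    by (auto simp: scalar_prod_def v_def atLeast0LessThan sum_distrib_left sum_distrib_right mult_ac intro!: sum.cong)
  finally show ?thesis .
qed

context renewal
begin

lemma ker_herm: "ker w z = cnj (ker z w)"
proof (cases "z \<in> cball 0 1 \<and> w \<in> cball 0 1")
  case True
  then have "(\<lambda>n. cnj (complex_of_real (a n) * (z * cnj w) ^ n)) sums cnj (ker z w)"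
    unfolding sums_cnj by (intro ker_sums) auto
  moreover have "(\<lambda>n. complex_of_real (a n) * (w * cnj z) ^ n) sums ker w z"
    using True by (intro ker_sums) auto
  ultimately show ?thesis by (simp add: mult.commute sums_unique2)
qed (auto simp: ker_def)

lemma b_abs_summable: "summable (\<lambda>n. cmod (complex_of_real (b n)))"
  using b_summable b_nonneg by simp

lemma ker_inverse:
  assumes z: "z \<in> cball 0 1" and w: "w \<in> cball 0 1"
  shows "ker z w * (1 - disc_fun (\<lambda>n. complex_of_real (b n)) (z * cnj w)) = 1"
proof -
  let ?a = "\<lambda>n. complex_of_real (a n)" and ?b = "\<lambda>n. complex_of_real (b n)" and ?x = "z * cnj w"
  have x: "?x \<in> cball 0 1" using z w by (simp add: norm_mult mult_le_one)
  have as: "summable (\<lambda>n. cmod (?a n))" using a_summable by simp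
  have "conv ?b ?a n = (if n = 0 then 0 else ?a n)" for n
  proof -
    have "conv ?b ?a n = (\<Sum>i=1..n. ?b i * ?a (n - i))"
      unfolding conv_def
    proof (rule sum.mono_neutral_right)
      show "\<forall>i\<in>{..n} - {1..n}. ?b i * ?a (n - i) = 0"
      proof
        fix i assume "i \<in> {..n} - {1..n}"
        then have "i = 0" by auto
        then show "?b i * ?a (n - i) = 0" by (simp add: b_0)
      qed
    qed auto
    also have "\<dots> = complex_of_real (\<Sum>i=1..n. b i * a (n - i))" by simp
    finally show ?thesis using a_rec[of n] by (cases "n = 0") auto
  qed
  then have "?a = (\<lambda>n. delta 0 n + conv ?b ?a n)" by (auto simp: delta_def)
  then have "disc_fun ?a ?x = disc_fun (\<lambda>n. delta 0 n + conv ?b ?a n) ?x" by simp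
  also have "\<dots> = disc_fun (delta 0) ?x + disc_fun ?b ?x * disc_fun ?a ?x"
    using disc_fun_add[OF delta_abs_summable conv_abs_summable[OF b_abs_summable as], of 0]
      disc_fun_conv[OF b_abs_summable as] by simp
  also have "disc_fun (delta 0) ?x = 1" using x by (simp add: disc_fun_delta)
  finally have "disc_fun ?a ?x = 1 + disc_fun ?b ?x * disc_fun ?a ?x" .
  moreover have "disc_fun ?a ?x = ker z w" using x z w by (simp only: disc_fun_def ker_def if_True simp_thms)
  ultimately show ?thesis by (simp add: algebra_simps)
qed

end

context realization
begin

lemma transfer_multiplier: "p < r \<Longrightarrow> q < r \<Longrightarrow> disc_fun (transfer p q) \<in> Mult (cball 0 1) space"
  by (intro disc_fun_multiplier conv_transfer_ell ell_abs_summable transfer_ell)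

lemma transfer_contractive: "contractive_multiplier_mat space ip r (mat r r (\<lambda>(p, q). disc_fun (transfer p q)))"
  unfolding contractive_multiplier_mat_def
proof (intro allI impI)
  fix F :: "nat \<Rightarrow> complex \<Rightarrow> complex"
  assume F: "\<forall>q<r. F q \<in> space"
  define f where "f q = coef (F q)" for q
  have f: "f q \<in> ell" "F q = disc_fun (f q)" if "q < r" for q
    using F that by (simp_all add: f_def coef_ell)
  define g where "g p n = (\<Sum>q<r. conv (f q) (transfer p q) n)" for p n
  have out: "(\<lambda>x. \<Sum>q<r. (mat r r (\<lambda>(p, q). disc_fun (transfer p q)) $$ (p, q)) x * F q x) = disc_fun (g p)"
    if p: "p < r" for p
  proof -
    have s: "summable (\<lambda>n. cmod (f q n))" "summable (\<lambda>n. cmod (transfer p q n))" if "q < r" for q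
      using f(1)[OF that] transfer_ell[OF p that] by (auto intro: ell_abs_summable)
    have "disc_fun (g p) = (\<lambda>x. \<Sum>q<r. disc_fun (conv (f q) (transfer p q)) x)"
      unfolding g_def[abs_def] by (rule disc_fun_sum) (auto intro!: conv_abs_summable s)
    also have "\<dots> = (\<lambda>x. \<Sum>q<r. (mat r r (\<lambda>(p, q). disc_fun (transfer p q)) $$ (p, q)) x * F q x)"
      using p by (intro ext sum.cong refl) (auto simp: disc_fun_conv s f(2) mult.commute)
    finally show ?thesis by simp
  qed
  have bound: "(\<Sum>p<r. Q N (g p)) \<le> (\<Sum>q<r. nsq (f q))" for N
  proof -
    have "(\<Sum>p<r. Q N (g p)) \<le> (\<Sum>q<r. Q N (f q))"
      unfolding g_def[abs_def] by (rule response)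
    also have "\<dots> \<le> (\<Sum>q<r. nsq (f q))" by (intro sum_mono Q_le_nsq f) auto
    finally show ?thesis .
  qed
  have g: "g p \<in> ell" if "p < r" for p
  proof (rule ellI_bounded)
    fix N
    have "Q N (g p) \<le> (\<Sum>p<r. Q N (g p))" using that by (intro member_le_sum) (auto simp: Q_nonneg)
    then show "Q N (g p) \<le> (\<Sum>q<r. nsq (f q))" using bound[of N] by linarith
  qed
  have "(\<Sum>p<r. nsq (g p)) \<le> (\<Sum>q<r. nsq (f q))"
  proof (rule LIMSEQ_le_const2)
    show "(\<lambda>N. \<Sum>p<r. Q N (g p)) \<longlonglongrightarrow> (\<Sum>p<r. nsq (g p))"
      by (intro tendsto_sum Q_tendsto g) auto
  qed (use bound in blast)
  moreover have "(\<Sum>p<r. (ip_norm ip (\<lambda>x. \<Sum>q<r. (mat r r (\<lambda>(p, q). disc_fun (transfer p q)) $$ (p, q)) x * F q x))\<^sup>2) = (\<Sum>p<r. nsq (g p))"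
  proof (rule sum.cong)
    fix p assume "p \<in> {..<r}"
    then have p: "p < r" by simp
    show "(ip_norm ip (\<lambda>x. \<Sum>q<r. (mat r r (\<lambda>(p, q). disc_fun (transfer p q)) $$ (p, q)) x * F q x))\<^sup>2 = nsq (g p)"
      unfolding out[OF p] by (simp add: ip_norm_disc_fun g p nsq_nonneg)
  qed simp
  moreover have "(\<Sum>q<r. (ip_norm ip (F q))\<^sup>2) = (\<Sum>q<r. nsq (f q))"
    by (rule sum.cong) (simp_all add: ip_norm_square F f_def)
  ultimately show "sqrt (\<Sum>p<r. (ip_norm ip (\<lambda>x. \<Sum>q<r. (mat r r (\<lambda>(p, q). disc_fun (transfer p q)) $$ (p, q)) x * F q x))\<^sup>2)
      \<le> sqrt (\<Sum>q<r. (ip_norm ip (F q))\<^sup>2)" by simp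
qed

end

context renewal
begin

text \<open>
  Write the Pick matrix as \<open>\<Gamma> \<Gamma>^*\<close>. Since \<open>ker\<close> is inverse to \<open>1 - B\<close>, the equation
  \<open>ker (I - W W^*) = \<Gamma> \<Gamma>^*\<close> is equivalent to \<open>I + B \<Gamma> \<Gamma>^* = W W^* + \<Gamma> \<Gamma>^*\<close>,
  which says that the vectors \<open>(I, u l \<Gamma>)\<close> and \<open>(W, \<Gamma>)\<close> have equal Gram matrices.
\<close>

lemma complete_Pick: "complete_Pick_space (cball 0 1) space ip ker"
  unfolding complete_Pick_space_def
proof (intro conjI rkhs_space allI impI)
  fix r n :: nat and z :: "nat \<Rightarrow> complex" and W :: "nat \<Rightarrow> complex mat"
  assume zW: "\<forall>i<n. z i \<in> cball 0 1 \<and> W i \<in> carrier_mat r r"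
    and psd: "positive_semidefinite_mat (pick_matrix ker r n z W)"
  define N where "N = n * r"
  define P where "P i j = pick_matrix ker r n z W $$ (i, j)" for i j
  define S where "S i j = (\<Sum>s<r. W (i div r) $$ (i mod r, s) * cnj (W (j div r) $$ (j mod r, s)))" for i j
  define x where "x i = z (i div r)" for i
  let ?\<delta> = "\<lambda>i j. if i mod r = j mod r then 1 else (0::complex)"
  have P: "P i j = ker (x i) (x j) * (?\<delta> i j - S i j)" if "i < N" "j < N" for i j
    unfolding P_def S_def x_def by (rule pick_matrix_index) (use that zW in \<open>auto simp: N_def\<close>)
  have xd: "x i \<in> cball 0 1" if "i < N" for i
    using zW that by (auto simp: x_def N_def less_mult_imp_div_less)
  have mr: "i mod r < r" if "i < N" for i
    using that by (auto simp: N_def intro!: mod_less_divisor gr0I)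
  have S_herm: "S j i = cnj (S i j)" for i j
    by (simp add: S_def mult.commute)
  have "\<exists>m \<Gamma>. \<forall>i<N. \<forall>j<N. P i j = (\<Sum>k<(m::nat). \<Gamma> i k * cnj (\<Gamma> j k))"
  proof (rule psd_factorization)
    show "P j i = cnj (P i j)" if "i < N" "j < N" for i j
      using that by (simp add: P ker_herm[of "x j" "x i"] S_herm[of j i])
    show "0 \<le> Re (\<Sum>i<N. \<Sum>j<N. y i * P i j * cnj (y j))" for y
      unfolding P_def by (rule positive_semidefinite_mat_Re[OF psd]) (simp add: pick_matrix_def N_def)
  qed
  then obtain m \<Gamma> where \<Gamma>: "\<And>i j. i < N \<Longrightarrow> j < N \<Longrightarrow> P i j = (\<Sum>k<(m::nat). \<Gamma> i k * cnj (\<Gamma> j k))"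
    by blast
  \<comment> \<open>The index \<open>i\<close> stands for the pair of the node \<open>i div r\<close> and the row \<open>i mod r\<close> of its matrix. Block \<open>0\<close> of \<open>d\<close>
    holds the identity, block \<open>l \<ge> 1\<close> holds \<open>u l \<Gamma>\<close>.\<close>
  define d where "d i l k = (if l = 0 then (if k = i mod r then 1 else 0)
      else if k < m then complex_of_real (sqrt (b l)) * x i ^ l * \<Gamma> i k else 0)" for i l k :: nat
  define \<rho> where "\<rho> i y = (if y < r then W (i div r) $$ (i mod r, y) else \<Gamma> i (y - r))" for i y
  let ?B = "disc_fun (\<lambda>n. complex_of_real (b n))"
  have gram: "(\<lambda>l. \<Sum>k<r + m. d i l k * cnj (d j l k)) sums (\<Sum>y<r + m. \<rho> i y * cnj (\<rho> j y))"
    if i: "i < N" and j: "j < N" for i j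
  proof -
    let ?u = "x i * cnj (x j)"
    have u: "?u \<in> cball 0 1" using xd[OF i] xd[OF j] by (simp add: norm_mult mult_le_one)
    have eq: "(\<Sum>k<r + m. d i l k * cnj (d j l k)) = (if l = 0 then ?\<delta> i j else 0) + complex_of_real (b l) * ?u ^ l * P i j" for l
    proof (cases "l = 0")
      case True
      have "(\<Sum>k<r + m. d i 0 k * cnj (d j 0 k)) = (\<Sum>k<r + m. if k = i mod r then ?\<delta> i j else 0)"
        by (rule sum.cong) (auto simp: d_def)
      also have "\<dots> = ?\<delta> i j" using mr[OF i] by simp
      finally show ?thesis using True by (simp add: b_0)
    next
      case False
      have sq: "complex_of_real (sqrt (b l)) * complex_of_real (sqrt (b l)) = complex_of_real (b l)"
        using b_nonneg[of l] by (simp flip: of_real_mult)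
      have "(\<Sum>k<r + m. d i l k * cnj (d j l k))
          = (\<Sum>k<m. (complex_of_real (sqrt (b l)) * x i ^ l * \<Gamma> i k) * cnj (complex_of_real (sqrt (b l)) * x j ^ l * \<Gamma> j k))"
        using False by (intro sum.mono_neutral_cong_right) (auto simp: d_def)
      also have "\<dots> = (\<Sum>k<m. (complex_of_real (sqrt (b l)) * complex_of_real (sqrt (b l))) * ?u ^ l * (\<Gamma> i k * cnj (\<Gamma> j k)))"
        by (rule sum.cong) (simp_all add: power_mult_distrib mult_ac)
      also have "\<dots> = complex_of_real (b l) * ?u ^ l * P i j"
        unfolding sq \<Gamma>[OF i j] by (simp add: sum_distrib_left)
      finally show ?thesis using False by simp
    qed
    have "(\<lambda>l. complex_of_real (b l) * ?u ^ l) sums ?B ?u"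
      using disc_summable[OF b_abs_summable u] u by (simp add: disc_fun_def summable_sums)
    then have "(\<lambda>l. (if l = 0 then ?\<delta> i j else 0) + complex_of_real (b l) * ?u ^ l * P i j) sums (?\<delta> i j + ?B ?u * P i j)"
      by (intro sums_add sums_mult2 sums_single[of 0 "\<lambda>_. ?\<delta> i j"])
    moreover have "?\<delta> i j + ?B ?u * P i j = (\<Sum>y<r + m. \<rho> i y * cnj (\<rho> j y))"
    proof -
      have "(\<Sum>y<r + m. \<rho> i y * cnj (\<rho> j y)) = S i j + P i j"
        unfolding sum_lessThan_split \<Gamma>[OF i j] S_def by (simp add: \<rho>_def)
      moreover have "(1 - ?B ?u) * P i j = (ker (x i) (x j) * (1 - ?B ?u)) * (?\<delta> i j - S i j)"
        unfolding P[OF i j] by (simp only: mult_ac)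
      then have "(1 - ?B ?u) * P i j = ?\<delta> i j - S i j"
        unfolding ker_inverse[OF xd[OF i] xd[OF j]] by (simp only: mult_1)
      then have "?\<delta> i j + ?B ?u * P i j = S i j + P i j" by (simp only: left_diff_distrib mult_1) (simp add: algebra_simps)
      ultimately show ?thesis by simp
    qed
    ultimately show ?thesis by (simp only: eq)
  qed
  from lurking_isometry[where N=N and K="r + m" and d=d and \<rho>=\<rho>, OF gram] obtain V :: "nat \<Rightarrow> nat \<Rightarrow> nat \<Rightarrow> complex" and C where
    V1: "\<And>L v. (\<Sum>l<L. \<Sum>k<r + m. (cmod (\<Sum>y<r + m. V l k y * v y))\<^sup>2) \<le> (\<Sum>y<r + m. (cmod (v y))\<^sup>2)"
    and V2: "\<And>i y. i < N \<Longrightarrow> y < r + m \<Longrightarrow> (\<lambda>l. \<Sum>k<r + m. d i l k * V l k y) sums \<rho> i y"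
    and C: "0 \<le> C" and V3: "\<And>l k y. k < r + m \<Longrightarrow> y < r + m \<Longrightarrow> cmod (V l k y) \<le> C * (\<Sum>i<N. cmod (d i l k))"
    by blast
  interpret realization b r m V
    by unfold_locales (rule V1)
  let ?C = "C * (\<Sum>i<N. \<Sum>k<m. cmod (\<Gamma> i k))"
  have growth: "cmod (V l k y) \<le> ?C * sqrt (b l)" if "1 \<le> l" "k < m" "y < r + m" for l k y
  proof -
    have "cmod (d i l k) \<le> (\<Sum>k<m. cmod (\<Gamma> i k)) * sqrt (b l)" if i: "i < N" for i
    proof -
      have "cmod (d i l k) = sqrt (b l) * cmod (x i) ^ l * cmod (\<Gamma> i k)"
        using \<open>1 \<le> l\<close> \<open>k < m\<close> by (simp add: d_def norm_mult norm_power b_nonneg)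
      also have "\<dots> \<le> sqrt (b l) * 1 * (\<Sum>k<m. cmod (\<Gamma> i k))"
        using xd[OF i] \<open>k < m\<close> by (intro mult_mono member_le_sum) (auto simp: b_nonneg power_le_one)
      finally show ?thesis by (simp add: mult.commute)
    qed
    then have "(\<Sum>i<N. cmod (d i l k)) \<le> (\<Sum>i<N. (\<Sum>k<m. cmod (\<Gamma> i k)) * sqrt (b l))"
      by (intro sum_mono) auto
    then have "C * (\<Sum>i<N. cmod (d i l k)) \<le> C * (\<Sum>i<N. (\<Sum>k<m. cmod (\<Gamma> i k)) * sqrt (b l))"
      using C by (rule mult_left_mono)
    then show ?thesis using V3[of k y l] that by (simp add: sum_distrib_right mult.assoc)
  qed
  have interp: "disc_fun (transfer p q) (z i) = W i $$ (p, q)" if i: "i < n" and p: "p < r" and q: "q < r" for i p q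
  proof -
    define j where "j = i * r + p"
    have j: "j < N" "j div r = i" "j mod r = p"
    proof -
      have "j < i * r + r" using p by (simp add: j_def)
      also have "\<dots> = Suc i * r" by simp
      also have "\<dots> \<le> n * r" using i by (intro mult_le_mono1) simp
      finally show "j < N" by (simp add: N_def)
    qed (use p in \<open>simp_all add: j_def\<close>)
    have xj: "x j = z i" by (simp add: x_def j)
    have zi: "z i \<in> cball 0 1" using zW i by blast
    have "disc_fun (transfer p q) (z i) = \<rho> j q"
    proof (rule transfer_interpolates[OF growth zi p q])
      show "\<rho> j (r + k) = \<Gamma> j k" if "k < m" for k by (simp add: \<rho>_def)
      fix y assume y: "y < r + m"
      have "(\<Sum>k<r + m. d j l k * V l k y) = (if l = 0 then V 0 p y else 0) + (\<Sum>k<m. \<Gamma> j k * (state_coeff k y l * z i ^ l))" for l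
      proof (cases "l = 0")
        case True
        have "(\<Sum>k<r + m. d j 0 k * V 0 k y) = (\<Sum>k<r + m. if k = p then V 0 p y else 0)"
          by (rule sum.cong) (auto simp: d_def j)
        then show ?thesis using True p by (simp add: state_coeff_def b_0)
      next
        case False
        then show ?thesis
          by (simp, intro sum.mono_neutral_cong_right) (auto simp: d_def state_coeff_def xj)
      qed
      moreover have "(\<lambda>l. (if l = 0 then V 0 p y else 0) + (\<Sum>k<m. \<Gamma> j k * (state_coeff k y l * z i ^ l))) sums
          (V 0 p y + (\<Sum>k<m. \<Gamma> j k * disc_fun (state_coeff k y) (z i)))"
      proof (intro sums_add sums_single[of 0 "\<lambda>_. V 0 p y"], rule sums_sum, rule sums_mult)
        fix k assume "k \<in> {..<m}"
        then have "summable (\<lambda>l. state_coeff k y l * z i ^ l)"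
          using disc_summable[OF state_coeff_abs_summable[OF growth] zi] y by simp
        then show "(\<lambda>l. state_coeff k y l * z i ^ l) sums disc_fun (state_coeff k y) (z i)"
          using zi by (simp add: disc_fun_def summable_sums)
      qed
      ultimately show "V 0 p y + (\<Sum>k<m. \<Gamma> j k * disc_fun (state_coeff k y) (z i)) = \<rho> j y"
        using V2[OF j(1) y] by (simp add: sums_unique2)
    qed
    then show ?thesis using q by (simp add: \<rho>_def j)
  qed
  show "\<exists>\<Phi>\<in>carrier_mat r r. elements_mat \<Phi> \<subseteq> Mult (cball 0 1) space \<and>
          contractive_multiplier_mat space ip r \<Phi> \<and> (\<forall>i<n. map_mat (\<lambda>\<phi>. \<phi> (z i)) \<Phi> = W i)"
  proof (intro bexI[of _ "mat r r (\<lambda>(p, q). disc_fun (transfer p q))"] conjI transfer_contractive allI impI)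
    show "elements_mat (mat r r (\<lambda>(p, q). disc_fun (transfer p q))) \<subseteq> Mult (cball 0 1) space"
      by (auto simp: elements_mat_def intro!: transfer_multiplier)
    show "map_mat (\<lambda>\<phi>. \<phi> (z i)) (mat r r (\<lambda>(p, q). disc_fun (transfer p q))) = W i" if "i < n" for i
    proof -
      have "W i \<in> carrier_mat r r" using zW that by blast
      then show ?thesis using interp[OF that] by (intro eq_matI) auto
    qed
  qed simp
qed

end

section \<open>Lacunary kernels\<close>

lemma geometric_quarter_le: "(\<Sum>j<n. (1 / 4 :: real) ^ Suc j) \<le> 1 / 3"
proof -
  have "(\<Sum>j<n. (1 / 4 :: real) ^ Suc j) = 1 / 3 - (1 / 4) ^ n / 3"
    by (induction n) simp_all
  then show ?thesis by simp
qed

lemma geometric_half_le: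
  fixes y :: real
  assumes "0 \<le> y" "y \<le> 1 / 2"
  shows "(\<Sum>i=1..n. y ^ i) \<le> 1"
proof -
  have "(\<Sum>i=1..n. y ^ i) \<le> (\<Sum>i=1..n. (1 / 2) ^ i)"
    using assms by (intro sum_mono power_mono) auto
  also have "\<dots> = 1 - (1 / 2) ^ n" by (induction n) simp_all
  finally show ?thesis by (rule order_trans) simp
qed

text \<open>
  The letters are \<open>\<nu> 0 = 1, \<nu> 1, \<dots>\<close> and \<open>I j\<close> is the number of powers of the letter \<open>\<nu> j\<close> that must behave
  like powers of an independent variable; it covers the powers that are averaged below, and \<open>I j < T j\<close> puts all of
  them below the next letter. The condition on \<open>I\<close> alone makes the truncation of a geometric series with ratio
  \<open>1 - 1 / (2 * 4^(j+1))\<close> after \<open>I j\<close> terms harmless. The conditions on \<open>T j\<close> say that the next letter is so far away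
  that words made of smaller letters contribute very little to degrees near the multiples of it: they compare the decay
  \<open>2^-(T j)\<close> with the smallest weight \<open>4^-((j+2) I (j+1))\<close> in use and its square root.
\<close>

locale lacunary =
  fixes \<nu> T I :: "nat \<Rightarrow> nat"
  assumes \<nu>_0: "\<nu> 0 = 1" and \<nu>_Suc: "\<nu> (Suc j) = \<nu> j * T j"
    and T_gt: "I j < T j" and I_ge: "4 ^ Suc j \<le> I j"
    and I_tail: "(real (I j) + 1)\<^sup>2 * (1 - 1 / (2 * 4 ^ Suc j)) ^ I j \<le> (1 / 2) ^ j"
    and T_decay: "(1 / 2 :: real) ^ (T j - 1) \<le> (1 / 4) ^ (Suc (Suc j) * I (Suc j))"
    and T_off: "real (\<nu> (Suc j) * I (Suc j) * (I (Suc j) + 1)) * sqrt (1 / 2) ^ (T j - 1)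
        * 2 ^ (Suc (Suc j) * I (Suc j)) \<le> (1 / 2) ^ j"
begin

lemma T_ge: "4 ^ Suc j < T j"
  using T_gt[of j] I_ge[of j] by simp

lemma \<nu>_pos: "0 < \<nu> j"
proof (induction j)
  case (Suc j)
  have "0 < T j" using T_ge[of j] by simp
  then show ?case using Suc by (simp add: \<nu>_Suc)
qed (simp add: \<nu>_0)

lemma \<nu>_step: "4 ^ Suc j * \<nu> j < \<nu> (Suc j)"
  using T_ge[of j] \<nu>_pos[of j] by (simp add: \<nu>_Suc)

lemma \<nu>_mono: "strict_mono \<nu>"
proof (rule strict_monoI_Suc)
  fix j
  have "1 * \<nu> j \<le> 4 ^ Suc j * \<nu> j" by (rule mult_le_mono1) simp
  then show "\<nu> j < \<nu> (Suc j)" using \<nu>_step[of j] by linarith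
qed

lemma \<nu>_inj: "inj \<nu>"
  by (rule strict_mono_imp_inj_on[OF \<nu>_mono])

lemma \<nu>_gt: "j < \<nu> j"
proof (induction j)
  case (Suc j)
  then show ?case using strict_monoD[OF \<nu>_mono, of j "Suc j"] by simp
qed (simp add: \<nu>_0)

lemma \<nu>_ge_power: "4 ^ j \<le> \<nu> j"
proof (induction j)
  case (Suc j)
  have "4 ^ Suc j * 1 \<le> 4 ^ Suc j * \<nu> j" using \<nu>_pos[of j] by (intro mult_le_mono2) simp
  then show ?case using \<nu>_step[of j] by linarith
qed (simp add: \<nu>_0)

definition b :: "nat \<Rightarrow> real" where
  "b l = (if l \<in> range \<nu> then (1 / 4) ^ Suc (inv_into UNIV \<nu> l) else 0)"

lemma b_\<nu>: "b (\<nu> j) = (1 / 4) ^ Suc j"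
  by (simp add: b_def inv_f_f[OF \<nu>_inj])

lemma letter_weight_nonneg: "0 \<le> b l"
  by (simp add: b_def)

lemma sum_letters:
  assumes "finite S" "S \<inter> range \<nu> \<subseteq> \<nu> ` {..<K}"
  shows "(\<Sum>l\<in>S. b l * f l) = (\<Sum>i<K. if \<nu> i \<in> S then (1 / 4) ^ Suc i * f (\<nu> i) else 0)"
proof -
  have "(\<Sum>i<K. if \<nu> i \<in> S then (1 / 4) ^ Suc i * f (\<nu> i) else 0) = (\<Sum>i\<in>{i\<in>{..<K}. \<nu> i \<in> S}. b (\<nu> i) * f (\<nu> i))"
    by (simp only: sum.inter_filter[OF finite_lessThan] b_\<nu>)
  also have "\<dots> = (\<Sum>l\<in>\<nu> ` {i\<in>{..<K}. \<nu> i \<in> S}. b l * f l)"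
    by (rule sum.reindex_cong[symmetric, of \<nu>]) (auto intro: inj_on_subset[OF \<nu>_inj])
  also have "\<dots> = (\<Sum>l\<in>S. b l * f l)"
    by (rule sum.mono_neutral_left) (use assms in \<open>auto simp: b_def\<close>)
  finally show ?thesis by simp
qed

lemma sum_b_bound: "(\<Sum>l<n. b l) \<le> 1 / 3"
proof -
  have "(\<Sum>l<n. b l * 1) = (\<Sum>i<n. if \<nu> i \<in> {..<n} then (1 / 4) ^ Suc i * 1 else 0)"
  proof (rule sum_letters)
    show "{..<n} \<inter> range \<nu> \<subseteq> \<nu> ` {..<n}"
      using \<nu>_gt less_trans by fastforce
  qed simp
  also have "\<dots> \<le> (\<Sum>i<n. (1 / 4) ^ Suc i)" by (intro sum_mono) auto
  also have "\<dots> \<le> 1 / 3" by (rule geometric_quarter_le)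
  finally show ?thesis by simp
qed

sublocale renewal b
proof
  have "0 \<notin> range \<nu>"
  proof
    assume "0 \<in> range \<nu>"
    then obtain j where "\<nu> j = 0" by (metis rangeE)
    then show False using \<nu>_pos[of j] by simp
  qed
  then show "b 0 = 0" by (simp add: b_def)
  show "0 \<le> b n" for n by (rule letter_weight_nonneg)
  show "0 < b 1" using b_\<nu>[of 0] by (simp add: \<nu>_0)
  show s: "summable b"
    by (rule summableI_nonneg_bounded[OF letter_weight_nonneg sum_b_bound])
  show "suminf b \<le> 1 / 2"
    using suminf_le_const[OF s sum_b_bound] by simp
qed

lemma a_letters:
  assumes "0 < n" "n < \<nu> K"
  shows "a n = (\<Sum>i<K. if \<nu> i \<le> n then (1 / 4) ^ Suc i * a (n - \<nu> i) else 0)"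
proof -
  have "a n = (\<Sum>l\<in>{1..n}. b l * a (n - l))" using a_rec[OF assms(1)] by simp
  also have "\<dots> = (\<Sum>i<K. if \<nu> i \<in> {1..n} then (1 / 4) ^ Suc i * a (n - \<nu> i) else 0)"
  proof (rule sum_letters)
    show "{1..n} \<inter> range \<nu> \<subseteq> \<nu> ` {..<K}"
    proof
      fix l assume "l \<in> {1..n} \<inter> range \<nu>"
      then obtain i where i: "l = \<nu> i" "\<nu> i \<le> n" by auto
      then have "\<nu> i < \<nu> K" using assms(2) by simp
      then show "l \<in> \<nu> ` {..<K}" using i strict_mono_less[OF \<nu>_mono] by auto
    qed
  qed simp
  also have "\<dots> = (\<Sum>i<K. if \<nu> i \<le> n then (1 / 4) ^ Suc i * a (n - \<nu> i) else 0)"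
    by (rule sum.cong) (use \<nu>_pos in \<open>auto simp: Suc_le_eq\<close>)
  finally show ?thesis .
qed

text \<open>
  Since \<open>a n \<ge> b n\<close>, it suffices to look at the letters, where \<open>b (\<nu> j) = 4^-(j+1)\<close> decays slower than any geometric
  sequence in \<open>\<nu> j\<close>.
\<close>

lemma unbounded_radius:
  assumes "1 < x"
  shows "\<exists>n. B < a n * x ^ n"
proof -
  define d where "d = x - 1"
  have d: "0 < d" "x = 1 + d" using assms by (simp_all add: d_def)
  obtain j :: nat where j: "4 * \<bar>B\<bar> / d < 4 ^ j"
    using real_arch_pow[of 4 "4 * \<bar>B\<bar> / d"] by auto
  let ?n = "\<nu> (Suc j)"
  have "(4::real) ^ Suc j * 4 ^ j = real (4 ^ Suc j * 4 ^ j)" by simp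
  also have "\<dots> \<le> real (4 ^ Suc j * \<nu> j)"
    unfolding of_nat_le_iff by (intro mult_le_mono2 \<nu>_ge_power)
  also have "\<dots> \<le> real ?n" using \<nu>_step[of j] by linarith
  finally have n: "(4::real) ^ Suc j * 4 ^ j \<le> real ?n" .
  have "1 + real ?n * d \<le> (1 + d) ^ ?n" by (rule Bernoulli_inequality) (use d in simp)
  then have "real ?n * d \<le> x ^ ?n" using d by simp
  moreover have "(4 ^ Suc j * 4 ^ j) * d \<le> real ?n * d" using n d by (intro mult_right_mono) auto
  ultimately have x: "(4 ^ Suc j * 4 ^ j) * d \<le> x ^ ?n" by linarith
  have "\<bar>B\<bar> < 4 ^ j * d / 4" using j d by (simp add: field_simps)
  also have "\<dots> = (1 / 4) ^ Suc (Suc j) * ((4 ^ Suc j * 4 ^ j) * d)"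
    by (simp add: power_divide field_simps)
  also have "\<dots> \<le> a ?n * x ^ ?n"
  proof (rule mult_mono)
    show "(1 / 4) ^ Suc (Suc j) \<le> a ?n" using a_ge_b[OF \<nu>_pos[of "Suc j"]] by (simp only: b_\<nu>)
  qed (use x d in auto)
  finally show ?thesis by (intro exI[of _ ?n]) linarith
qed

text \<open>
  Let \<open>N = \<nu> (j + 1)\<close> and \<open>M = \<nu> j\<close>. A composition of \<open>n\<close> has parts smaller than \<open>N\<close> with sum at least
  \<open>n mod N\<close>, hence at least \<open>(n mod N) div M\<close> of them. Counting each small letter with twice its weight keeps
  the total weight below \<open>1\<close>, so every small letter gains a factor \<open>1/2\<close>.
\<close>

lemma a_decay:
  assumes "n < \<nu> (Suc (Suc j))"
  shows "a n \<le> (1 / 2) ^ ((n mod \<nu> (Suc j)) div \<nu> j)"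
  using assms
proof (induction n rule: less_induct)
  case (less n)
  let ?M = "\<nu> j" and ?N = "\<nu> (Suc j)"
  let ?D = "(1 / 2 :: real) ^ ((n mod ?N) div ?M)"
  show ?case
  proof (cases "n = 0")
    case False
    have small: "a (n - \<nu> i) \<le> 2 * ?D" if i: "i \<le> j" "\<nu> i \<le> n" for i
    proof -
      have le: "\<nu> i \<le> ?M" using i strict_mono_less_eq[OF \<nu>_mono] by simp
      have "n mod ?N = ((n - \<nu> i) mod ?N + \<nu> i) mod ?N"
        using i(2) by (simp add: mod_add_left_eq)
      also have "\<dots> \<le> (n - \<nu> i) mod ?N + \<nu> i" by (rule mod_less_eq_dividend)
      finally have "n mod ?N \<le> (n - \<nu> i) mod ?N + ?M" using le by simp
      then have "(n mod ?N) div ?M \<le> ((n - \<nu> i) mod ?N + ?M) div ?M" by (rule div_le_mono)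
      then have dv: "(n mod ?N) div ?M \<le> Suc (((n - \<nu> i) mod ?N) div ?M)" using \<nu>_pos[of j] by simp
      have "a (n - \<nu> i) \<le> (1 / 2) ^ (((n - \<nu> i) mod ?N) div ?M)"
        using False \<nu>_pos[of i] less.prems by (intro less.IH) auto
      also have "\<dots> = 2 * (1 / 2) ^ Suc (((n - \<nu> i) mod ?N) div ?M)" by simp
      also have "\<dots> \<le> 2 * ?D" using dv by (intro mult_left_mono power_decreasing) auto
      finally show ?thesis .
    qed
    have big: "a (n - ?N) \<le> ?D" if "?N \<le> n"
    proof -
      have "(n - ?N) mod ?N = n mod ?N" using that by (simp add: le_mod_geq)
      then show ?thesis using less.IH[of "n - ?N"] False \<nu>_pos[of "Suc j"] less.prems by simp
    qed
    have "a n = (\<Sum>i<Suc (Suc j). if \<nu> i \<le> n then (1 / 4) ^ Suc i * a (n - \<nu> i) else 0)"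
      by (rule a_letters) (use False less.prems in auto)
    also have "\<dots> = (\<Sum>i<Suc j. if \<nu> i \<le> n then (1 / 4) ^ Suc i * a (n - \<nu> i) else 0)
        + (if ?N \<le> n then (1 / 4) ^ Suc (Suc j) * a (n - ?N) else 0)"
      by (rule sum.lessThan_Suc)
    also have "\<dots> \<le> (\<Sum>i<Suc j. (1 / 4) ^ Suc i * (2 * ?D)) + (1 / 4) ^ Suc (Suc j) * ?D"
    proof (rule add_mono)
      show "(\<Sum>i<Suc j. if \<nu> i \<le> n then (1 / 4) ^ Suc i * a (n - \<nu> i) else 0) \<le> (\<Sum>i<Suc j. (1 / 4) ^ Suc i * (2 * ?D))"
      proof (rule sum_mono)
        fix i assume "i \<in> {..<Suc j}"
        then have i: "i \<le> j" by simp
        show "(if \<nu> i \<le> n then (1 / 4) ^ Suc i * a (n - \<nu> i) else 0) \<le> (1 / 4) ^ Suc i * (2 * ?D)"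
        proof (cases "\<nu> i \<le> n")
          case True
          have "(1 / 4) ^ Suc i * a (n - \<nu> i) \<le> (1 / 4) ^ Suc i * (2 * ?D)"
            by (rule mult_left_mono[OF small[OF i True]]) simp
          then show ?thesis by (simp only: True if_True)
        qed simp
      qed
      show "(if ?N \<le> n then (1 / 4) ^ Suc (Suc j) * a (n - ?N) else 0) \<le> (1 / 4) ^ Suc (Suc j) * ?D"
        by (auto intro!: mult_left_mono big simp del: power_Suc)
    qed
    also have "(\<Sum>i<Suc j. (1 / 4) ^ Suc i * (2 * ?D)) = (\<Sum>i<Suc j. (1 / 4) ^ Suc i) * (2 * ?D)"
      by (rule sum_distrib_right[symmetric])
    also have "\<dots> + (1 / 4) ^ Suc (Suc j) * ?D \<le> 1 / 3 * (2 * ?D) + 1 / 16 * ?D"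
    proof (intro add_mono mult_right_mono geometric_quarter_le)
      have "(1 / 4 :: real) ^ Suc (Suc j) \<le> (1 / 4) ^ 2" by (rule power_decreasing) auto
      then show "(1 / 4 :: real) ^ Suc (Suc j) \<le> 1 / 16" by (simp add: power2_eq_square)
    qed auto
    also have "\<dots> \<le> ?D" by simp
    finally show ?thesis .
  qed simp
qed

lemma a_lattice_ge: "(1 / 4) ^ (Suc j * i) \<le> a (\<nu> j * i)"
proof (induction i)
  case (Suc i)
  have "(1 / 4 :: real) ^ (Suc j * Suc i) = (1 / 4) ^ Suc j * (1 / 4) ^ (Suc j * i)"
    by (simp only: mult_Suc_right power_add)
  also have "\<dots> \<le> b (\<nu> j) * a (\<nu> j * i)"
    unfolding b_\<nu> by (intro mult_left_mono Suc) auto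
  also have "\<dots> \<le> a (\<nu> j * i + \<nu> j)" by (rule a_ge_mult[OF \<nu>_pos])
  finally show ?case by (simp add: add.commute)
qed simp

text \<open>
  The main term is the word consisting of \<open>i\<close> copies of the big letter. All other words contain small letters of total
  length at least \<open>\<nu> (j + 1)\<close>.
\<close>

lemma a_lattice_le:
  assumes "\<nu> (Suc j) * i < \<nu> (Suc (Suc j))"
  shows "a (\<nu> (Suc j) * i) \<le> (1 / 4) ^ (Suc (Suc j) * i) + (1 / 2) ^ (T j - 1)"
  using assms
proof (induction i)
  case (Suc i)
  let ?M = "\<nu> j" and ?N = "\<nu> (Suc j)" and ?\<delta> = "(1 / 2 :: real) ^ (T j - 1)"
  let ?n = "?N * Suc i"
  have small: "a (?n - \<nu> l) \<le> ?\<delta>" if l: "l < Suc j" for l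
  proof -
    have le: "\<nu> l \<le> ?M" using l strict_mono_less_eq[OF \<nu>_mono] by simp
    have MN: "?M < ?N" by (rule strict_monoD[OF \<nu>_mono]) simp
    have "?n - \<nu> l = ?N * i + (?N - \<nu> l)" using le MN by simp
    then have "(?n - \<nu> l) mod ?N = (?N * i + (?N - \<nu> l)) mod ?N" by (simp only:)
    also have "\<dots> = ?N - \<nu> l" using \<nu>_pos[of l] le MN by (simp only: mod_mult_self4 mod_less)
    finally have "(?n - \<nu> l) mod ?N = ?N - \<nu> l" .
    moreover have "(?N - ?M) div ?M \<le> (?N - \<nu> l) div ?M" using le by (intro div_le_mono) simp
    moreover have "(?N - ?M) div ?M = T j - 1"
    proof -
      have "?N - ?M = ?M * (T j - 1)" by (simp add: \<nu>_Suc right_diff_distrib')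
      then show ?thesis using \<nu>_pos[of j] by simp
    qed
    ultimately have "T j - 1 \<le> ((?n - \<nu> l) mod ?N) div ?M" by simp
    then have "(1 / 2 :: real) ^ (((?n - \<nu> l) mod ?N) div ?M) \<le> ?\<delta>" by (intro power_decreasing) auto
    moreover have "a (?n - \<nu> l) \<le> (1 / 2) ^ (((?n - \<nu> l) mod ?N) div ?M)"
      by (rule a_decay) (use Suc.prems in simp)
    ultimately show ?thesis by linarith
  qed
  have "a ?n = (\<Sum>l<Suc (Suc j). if \<nu> l \<le> ?n then (1 / 4) ^ Suc l * a (?n - \<nu> l) else 0)"
    by (rule a_letters) (use Suc.prems \<nu>_pos in auto)
  also have "\<dots> = (\<Sum>l<Suc j. if \<nu> l \<le> ?n then (1 / 4) ^ Suc l * a (?n - \<nu> l) else 0)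
      + (if ?N \<le> ?n then (1 / 4) ^ Suc (Suc j) * a (?n - ?N) else 0)"
    by (rule sum.lessThan_Suc)
  also have "\<dots> \<le> (\<Sum>l<Suc j. (1 / 4) ^ Suc l * ?\<delta>) + (1 / 4) ^ Suc (Suc j) * ((1 / 4) ^ (Suc (Suc j) * i) + ?\<delta>)"
  proof (rule add_mono)
    show "(\<Sum>l<Suc j. if \<nu> l \<le> ?n then (1 / 4) ^ Suc l * a (?n - \<nu> l) else 0) \<le> (\<Sum>l<Suc j. (1 / 4) ^ Suc l * ?\<delta>)"
    proof (rule sum_mono)
      fix l assume "l \<in> {..<Suc j}"
      then have l: "l < Suc j" by simp
      have "(1 / 4) ^ Suc l * a (?n - \<nu> l) \<le> (1 / 4) ^ Suc l * ?\<delta>"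
        by (rule mult_left_mono[OF small[OF l]]) simp
      then show "(if \<nu> l \<le> ?n then (1 / 4) ^ Suc l * a (?n - \<nu> l) else 0) \<le> (1 / 4) ^ Suc l * ?\<delta>"
        by (cases "\<nu> l \<le> ?n") (simp_all only: if_True if_False, simp)
    qed
    have "a (?n - ?N) \<le> (1 / 4) ^ (Suc (Suc j) * i) + ?\<delta>"
      using Suc.IH Suc.prems by simp
    then show "(if ?N \<le> ?n then (1 / 4) ^ Suc (Suc j) * a (?n - ?N) else 0) \<le> (1 / 4) ^ Suc (Suc j) * ((1 / 4) ^ (Suc (Suc j) * i) + ?\<delta>)"
      by (auto intro!: mult_left_mono simp del: power_Suc mult_Suc_right mult_Suc)
  qed
  also have "(\<Sum>l<Suc j. (1 / 4) ^ Suc l * ?\<delta>) = (\<Sum>l<Suc j. (1 / 4) ^ Suc l) * ?\<delta>"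
    by (rule sum_distrib_right[symmetric])
  also have "\<dots> + (1 / 4) ^ Suc (Suc j) * ((1 / 4) ^ (Suc (Suc j) * i) + ?\<delta>)
      = (\<Sum>l<Suc j. (1 / 4) ^ Suc l) * ?\<delta> + (1 / 4) ^ Suc (Suc j) * ?\<delta> + (1 / 4) ^ (Suc (Suc j) * Suc i)"
    unfolding mult_Suc_right[of "Suc (Suc j)" i] power_add by (simp only: distrib_left add_ac)
  also have "\<dots> \<le> 1 / 3 * ?\<delta> + 1 / 16 * ?\<delta> + (1 / 4) ^ (Suc (Suc j) * Suc i)"
  proof (intro add_mono mult_right_mono geometric_quarter_le order_refl)
    have "(1 / 4 :: real) ^ Suc (Suc j) \<le> (1 / 4) ^ 2" by (rule power_decreasing) auto
    then show "(1 / 4 :: real) ^ Suc (Suc j) \<le> 1 / 16" by (simp add: power2_eq_square)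
  qed auto
  also have "\<dots> \<le> (1 / 4) ^ (Suc (Suc j) * Suc i) + ?\<delta>" by simp
  finally show ?case .
qed simp

lemma lattice_in_range: "s \<le> I (Suc j) \<Longrightarrow> \<nu> (Suc j) * s < \<nu> (Suc (Suc j))"
  using T_gt[of "Suc j"] \<nu>_pos[of "Suc j"] by (simp add: \<nu>_Suc[of "Suc j"])

lemma a_lattice_le_double:
  assumes "s \<le> I (Suc j)"
  shows "a (\<nu> (Suc j) * s) \<le> 2 * (1 / 4) ^ (Suc (Suc j) * s)"
proof -
  have "(1 / 4 :: real) ^ (Suc (Suc j) * I (Suc j)) \<le> (1 / 4) ^ (Suc (Suc j) * s)"
    using assms by (intro power_decreasing mult_le_mono2) auto
  then show ?thesis
    using a_lattice_le[OF lattice_in_range[OF assms]] T_decay[of j] by linarith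
qed

text \<open>
  If \<open>m\<close> is not a multiple of the big letter, the remainders of \<open>m\<close> and of its complement add up to the big
  letter, so that both factors together decay by the full amount.
\<close>

lemma a_off_lattice:
  assumes s: "s \<le> I (Suc j)" and m: "m \<le> \<nu> (Suc j) * s" "\<not> \<nu> (Suc j) dvd m"
  shows "a m * a (\<nu> (Suc j) * s - m) \<le> (1 / 2) ^ (T j - 1)"
proof -
  let ?M = "\<nu> j" and ?N = "\<nu> (Suc j)"
  let ?m' = "?N * s - m"
  let ?r = "m mod ?N"
  have N: "0 < ?N" and M: "0 < ?M" by (simp_all add: \<nu>_pos)
  have r: "0 < ?r" "?r < ?N" using m(2) N by (simp_all add: dvd_eq_mod_eq_0)
  have "?m' mod ?N = ?N - ?r"
  proof -
    have mq: "m = ?N * (m div ?N) + ?r" by simp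
    have "m div ?N < s"
    proof (rule ccontr)
      assume "\<not> m div ?N < s"
      then have "?N * s \<le> ?N * (m div ?N)" by simp
      then show False using m(1) mq r by linarith
    qed
    then obtain t where t: "s = Suc (m div ?N + t)" using less_imp_Suc_add by blast
    have "?N * s = ?N * t + ?N + ?N * (m div ?N)" unfolding t by (simp add: algebra_simps)
    then have eq: "?m' = ?N * t + (?N - ?r)" using mq r by linarith
    have lt: "?N - ?r < ?N" using r by simp
    show ?thesis by (simp only: eq mod_mult_self4 mod_less[OF lt])
  qed
  then have a': "a ?m' \<le> (1 / 2) ^ ((?N - ?r) div ?M)"
    using a_decay[of ?m' j] lattice_in_range[OF s] by simp
  have "a m \<le> (1 / 2) ^ (?r div ?M)"
    using m(1) lattice_in_range[OF s] by (intro a_decay) simp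
  then have "a m * a ?m' \<le> (1 / 2) ^ (?r div ?M) * (1 / 2) ^ ((?N - ?r) div ?M)"
    using a' by (intro mult_mono) auto
  also have "\<dots> = (1 / 2) ^ (?r div ?M + (?N - ?r) div ?M)" by (rule power_add[symmetric])
  also have "\<dots> \<le> (1 / 2) ^ (T j - 1)"
  proof (rule power_decreasing)
    let ?q = "?r div ?M"
    have "?r < ?M * Suc ?q" using M by (simp add: dividend_less_times_div)
    moreover have "?N = ?M * T j" by (simp add: \<nu>_Suc)
    ultimately have "?M * (T j - Suc ?q) \<le> ?N - ?r" by (simp add: diff_mult_distrib2)
    then have "T j - Suc ?q \<le> (?N - ?r) div ?M"
      using M by (metis div_le_mono nonzero_mult_div_cancel_left less_not_refl2)
    then show "T j - 1 \<le> ?q + (?N - ?r) div ?M" by linarith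
  qed auto
  finally show ?thesis .
qed

text \<open>
  Multiplication by the average of the powers \<open>u, u^2, \<dots>, u^(4^(j+1))\<close> of the letter \<open>u = up (\<nu> j)\<close>. As a
  function of an independent variable \<open>u\<close> it is bounded by \<open>1\<close> on the unit disc and close to \<open>1\<close> near \<open>u = 1\<close>, while
  its Hardy space norm is only \<open>2^-(j+1)\<close>.
\<close>

section \<open>A multiplier that is small on the disc\<close>

definition avg :: "nat \<Rightarrow> (nat \<Rightarrow> complex) \<Rightarrow> nat \<Rightarrow> complex" where
  "avg j f n = (\<Sum>i=1..4 ^ Suc j. complex_of_real ((1 / 4) ^ Suc j) * (up (\<nu> j) ^^ i) f n)"

definition phi_part :: "nat \<Rightarrow> nat \<Rightarrow> real" where
  "phi_part j n = (1 / 4) ^ Suc j * (\<Sum>i=1..4 ^ Suc j. if n = i * \<nu> j then ((1 / 2) ^ Suc j) ^ i else 0)"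

text \<open>
  Summands with \<open>j > n\<close> vanish in degree \<open>n\<close>, so the finite sum is the full sum over all letters.
\<close>

definition phi_re :: "nat \<Rightarrow> real" where
  "phi_re n = (\<Sum>j\<le>n. phi_part j n)"

definition phi :: "nat \<Rightarrow> complex" where
  "phi n = complex_of_real (phi_re n)"

lemma sqrt_b: "sqrt (b (\<nu> j)) = (1 / 2) ^ Suc j"
proof -
  have "b (\<nu> j) = ((1 / 2) ^ Suc j)\<^sup>2"
    unfolding b_\<nu> by (simp add: power_divide power2_eq_square flip: power_mult_distrib)
  then show ?thesis by (simp only: real_sqrt_abs) simp
qed

lemma phi_part_nonneg: "0 \<le> phi_part j n"
  by (auto simp: phi_part_def intro!: mult_nonneg_nonneg sum_nonneg)

lemma phi_part_eq_0:
  assumes "n < \<nu> j"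
  shows "phi_part j n = 0"
proof -
  have "n \<noteq> i * \<nu> j" if "1 \<le> i" for i
    using assms that by (metis leD mult_le_mono1 nat_mult_1)
  then show ?thesis by (auto simp: phi_part_def intro!: sum.neutral)
qed

lemma phi_re_eq:
  assumes "n \<le> N"
  shows "phi_re n = (\<Sum>j\<le>N. phi_part j n)"
proof -
  have "phi_part j n = 0" if "\<not> j \<le> n" for j
    using that \<nu>_gt[of j] by (intro phi_part_eq_0) linarith
  then show ?thesis unfolding phi_re_def
    using assms by (intro sum.mono_neutral_left) auto
qed

lemma conv_up_pow: "conv c ((up l ^^ i) d) = (up l ^^ i) (conv c d)"
proof (induction i)
  case (Suc i)
  have "conv c (up l ((up l ^^ i) d)) = up l (conv c ((up l ^^ i) d))" by (rule ext) (rule conv_up)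
  then show ?case by (simp add: Suc)
qed simp

lemma phi_part_avg: "complex_of_real (phi_part j n) = avg j (delta 0) n"
proof -
  have "(up (\<nu> j) ^^ i) (delta 0) n = complex_of_real (if n = i * \<nu> j then ((1 / 2) ^ Suc j) ^ i else 0)" for i
    unfolding up_pow sqrt_b by (auto simp: delta_def)
  then show ?thesis unfolding avg_def phi_part_def by (simp add: sum_distrib_left del: power_Suc)
qed

lemma conv_phi:
  assumes "n \<le> N"
  shows "conv f phi n = (\<Sum>j\<le>N. avg j f n)"
proof -
  have "conv f phi n = conv f (\<lambda>n. \<Sum>j\<in>{..N}. 1 * avg j (delta 0) n) n"
    by (rule conv_cong) (use assms in \<open>simp add: phi_def phi_re_eq[of _ N] flip: phi_part_avg\<close>)
  also have "\<dots> = (\<Sum>j\<le>N. conv f (avg j (delta 0)) n)"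
    by (subst conv_sum_right) simp
  also have "\<dots> = (\<Sum>j\<le>N. avg j f n)"
  proof (rule sum.cong)
    fix j
    have d0: "conv f (delta 0) = f" by (rule ext) (simp add: conv_delta)
    have "conv f (avg j (delta 0)) n = (\<Sum>i=1..4 ^ Suc j. complex_of_real ((1 / 4) ^ Suc j) * conv f ((up (\<nu> j) ^^ i) (delta 0)) n)"
      unfolding avg_def[abs_def] by (rule conv_sum_right)
    then show "conv f (avg j (delta 0)) n = avg j f n"
      unfolding avg_def conv_up_pow d0 .
  qed simp
  finally show ?thesis .
qed

lemma Q_up_pow: "1 \<le> l \<Longrightarrow> Q N ((up l ^^ i) f) \<le> Q N f"
proof (induction i)
  case (Suc i)
  then show ?case using Q_up[of l N "(up l ^^ i) f"] by simp
qed simp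

lemma Q_avg: "Q N (avg j f) \<le> Q N f"
proof -
  let ?c = "complex_of_real ((1 / 4) ^ Suc j)"
  have c: "cmod ?c = (1 / 4) ^ Suc j" by (simp only: norm_of_real) simp
  have "sqrt (Q N (avg j f)) \<le> (\<Sum>i=1..4 ^ Suc j. sqrt (Q N (\<lambda>n. ?c * (up (\<nu> j) ^^ i) f n)))"
    unfolding avg_def[abs_def] by (rule Q_triangle_sum) simp
  also have "\<dots> \<le> (\<Sum>i\<in>{1..4 ^ Suc j :: nat}. (1 / 4) ^ Suc j * sqrt (Q N f))"
  proof (rule sum_mono)
    fix i
    show "sqrt (Q N (\<lambda>n. ?c * (up (\<nu> j) ^^ i) f n)) \<le> (1 / 4) ^ Suc j * sqrt (Q N f)"
      unfolding sqrt_Q_scale c using Q_up_pow[of "\<nu> j" N i f] \<nu>_pos[of j]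
      by (intro mult_left_mono) auto
  qed
  also have "\<dots> = sqrt (Q N f)"
    by (simp add: power_divide del: power_Suc)
  finally show ?thesis by simp
qed

text \<open>
  The orthogonality expressed by the prefix bound replaces the sup norm \<open>1\<close> of the average by its
  \<open>l^2\<close> norm \<open>2^-(j+1)\<close>.
\<close>

lemma avg_prefix: "sqrt (Q N (avg j (\<lambda>n. f n - up (\<nu> j) (part f (\<nu> j)) n))) \<le> (1 / 2) ^ Suc j * sqrt (Q N f)"
proof -
  let ?h = "\<lambda>n. f n - up (\<nu> j) (part f (\<nu> j)) n"
  let ?K = "4 ^ Suc j :: nat"
  define x where "x i = (if 1 \<le> i then complex_of_real ((1 / 4) ^ Suc j) else 0)" for i :: nat
  have "avg j ?h = (\<lambda>n. \<Sum>i\<le>?K. x i * (up (\<nu> j) ^^ i) ?h n)"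
  proof
    fix n
    show "avg j ?h n = (\<Sum>i\<le>?K. x i * (up (\<nu> j) ^^ i) ?h n)"
      unfolding avg_def by (rule sum.mono_neutral_cong_left) (auto simp: x_def)
  qed
  then have "Q N (avg j ?h) \<le> (\<Sum>i\<le>?K. (cmod (x i))\<^sup>2) * Q N f"
    using prefix_bound[where l="\<nu> j" and N=N and M="?K" and x=x and f=f] \<nu>_pos[of j] by simp
  also have "(\<Sum>i\<le>?K. (cmod (x i))\<^sup>2) = (\<Sum>i=1..?K. ((1 / 4) ^ Suc j)\<^sup>2)"
    by (rule sum.mono_neutral_cong_right) (auto simp: x_def norm_power norm_mult norm_divide)
  also have "\<dots> = ((1 / 2) ^ Suc j)\<^sup>2"
  proof -
    have one: "(4::real) ^ Suc j * (1 / 4) ^ Suc j = 1"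
      unfolding power_mult_distrib[symmetric] by simp
    have "(\<Sum>i=1..?K. ((1 / 4 :: real) ^ Suc j)\<^sup>2) = 4 ^ Suc j * (1 / 4) ^ Suc j * (1 / 4) ^ Suc j"
      by (simp add: power2_eq_square del: power_Suc)
    also have "\<dots> = (1 / 4) ^ Suc j" unfolding one by simp
    also have "\<dots> = ((1 / 2) ^ Suc j)\<^sup>2"
      unfolding power2_eq_square power_mult_distrib[symmetric] by simp
    finally show ?thesis .
  qed
  finally have "sqrt (Q N (avg j ?h)) \<le> sqrt (((1 / 2) ^ Suc j)\<^sup>2 * Q N f)" by (rule real_sqrt_le_mono)
  then show ?thesis by (simp add: real_sqrt_mult del: power_Suc)
qed

lemma up_pow_add: "(up l ^^ i) (\<lambda>n. c n + d n) n = (up l ^^ i) c n + (up l ^^ i) d n"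
  unfolding up_pow by (simp add: distrib_left)

lemma avg_add: "avg j (\<lambda>n. c n + d n) n = avg j c n + avg j d n"
  unfolding avg_def up_pow_add by (simp add: distrib_left sum.distrib)

lemma avg_up: "avg j (up (\<nu> j) g) n = up (\<nu> j) (avg j g) n"
proof -
  have "(up (\<nu> j) ^^ i) (up (\<nu> j) g) n = up (\<nu> j) ((up (\<nu> j) ^^ i) g) n" for i
    by (metis comp_apply funpow_swap1)
  then show ?thesis unfolding avg_def up_sum up_scale by simp
qed

text \<open>
  For each letter, with \<open>v j = u (\<nu> j)\<close>, split \<open>f = h j + v j g j\<close>. The images of the \<open>h j\<close> are summable in norm.
  The images of \<open>v j g j\<close> have the form \<open>v j\<close> times a vector no longer than \<open>g j\<close>, so the row contraction bounds their sum by the norm of the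
  family \<open>g\<close>, which is at most the norm of \<open>f\<close>.
\<close>

lemma phi_bounded: "Q N (conv phi f) \<le> 2\<^sup>2 * Q N f"
proof -
  let ?g = "\<lambda>j. part f (\<nu> j)"
  let ?h = "\<lambda>j n. f n - up (\<nu> j) (?g j) n"
  have "Q N (conv phi f) = Q N (\<lambda>n. (\<Sum>j\<le>N. avg j (?h j) n) + ((if n = 0 then 0 else 0) + (\<Sum>j\<in>{..N}. up (\<nu> j) (avg j (?g j)) n)))"
  proof (rule Q_cong)
    fix n assume "n \<le> N"
    then have "conv phi f n = (\<Sum>j\<le>N. avg j f n)" by (subst conv_commute) (rule conv_phi)
    also have "\<dots> = (\<Sum>j\<le>N. avg j (?h j) n + up (\<nu> j) (avg j (?g j)) n)"
    proof (rule sum.cong)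
      fix j
      have "avg j f n = avg j (\<lambda>n. ?h j n + up (\<nu> j) (?g j) n) n" by simp
      also have "\<dots> = avg j (?h j) n + up (\<nu> j) (avg j (?g j)) n" unfolding avg_add avg_up ..
      finally show "avg j f n = avg j (?h j) n + up (\<nu> j) (avg j (?g j)) n" .
    qed simp
    finally show "conv phi f n = (\<Sum>j\<le>N. avg j (?h j) n) + ((if n = 0 then 0 else 0) + (\<Sum>j\<in>{..N}. up (\<nu> j) (avg j (?g j)) n))"
      by (simp add: sum.distrib)
  qed
  then have "sqrt (Q N (conv phi f)) \<le> sqrt (Q N (\<lambda>n. \<Sum>j\<le>N. avg j (?h j) n))
      + sqrt (Q N (\<lambda>n. (if n = 0 then 0 else 0) + (\<Sum>j\<in>{..N}. up (\<nu> j) (avg j (?g j)) n)))"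
    by (simp only: Q_triangle)
  moreover have "sqrt (Q N (\<lambda>n. \<Sum>j\<le>N. avg j (?h j) n)) \<le> sqrt (Q N f)"
  proof -
    have "sqrt (Q N (\<lambda>n. \<Sum>j\<le>N. avg j (?h j) n)) \<le> (\<Sum>j\<le>N. sqrt (Q N (avg j (?h j))))"
      by (rule Q_triangle_sum) simp
    also have "\<dots> \<le> (\<Sum>j\<le>N. (1 / 2) ^ Suc j * sqrt (Q N f))" by (intro sum_mono avg_prefix)
    also have "\<dots> = (\<Sum>j\<le>N. (1 / 2) ^ Suc j) * sqrt (Q N f)" by (rule sum_distrib_right[symmetric])
    also have "\<dots> \<le> 1 * sqrt (Q N f)"
    proof (rule mult_right_mono)
      have "(\<Sum>j\<le>N. (1 / 2 :: real) ^ Suc j) = 1 - (1 / 2) ^ Suc N" by (induction N) simp_all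
      then show "(\<Sum>j\<le>N. (1 / 2 :: real) ^ Suc j) \<le> 1" by (simp del: power_Suc)
    qed (simp add: Q_nonneg)
    finally show ?thesis by simp
  qed
  moreover have "sqrt (Q N (\<lambda>n. (if n = 0 then 0 else 0) + (\<Sum>j\<in>{..N}. up (\<nu> j) (avg j (?g j)) n))) \<le> sqrt (Q N f)"
  proof (rule real_sqrt_le_mono)
    have "Q N (\<lambda>n. (if n = 0 then 0 else 0) + (\<Sum>j\<in>{..N}. up (\<nu> j) (avg j (?g j)) n))
       \<le> (cmod 0)\<^sup>2 + (\<Sum>j\<in>{..N}. Qs N (\<nu> j) (avg j (?g j)))"
      by (rule row_contraction) (use \<nu>_pos in \<open>auto simp: Suc_le_eq intro: inj_on_subset[OF \<nu>_inj]\<close>)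
    also have "\<dots> \<le> (\<Sum>j\<in>{..N}. Qs N (\<nu> j) (?g j))"
      by (simp, intro sum_mono) (auto simp: Qs_def Q_avg)
    also have "\<dots> = (\<Sum>l\<in>\<nu> ` {..N}. Qs N l (part f l))"
      by (rule sum.reindex_cong[symmetric, of \<nu>]) (auto intro: inj_on_subset[OF \<nu>_inj])
    also have "\<dots> \<le> (cmod (f 0))\<^sup>2 + (\<Sum>l\<in>\<nu> ` {..N}. Qs N l (part f l))" by simp
    also have "\<dots> \<le> Q N f"
      by (rule part_norm) (use \<nu>_pos in \<open>auto simp: image_iff\<close>)
    finally show "Q N (\<lambda>n. (if n = 0 then 0 else 0) + (\<Sum>j\<in>{..N}. up (\<nu> j) (avg j (?g j)) n)) \<le> Q N f" .
  qed
  ultimately have "sqrt (Q N (conv phi f)) \<le> 2 * sqrt (Q N f)" by linarith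
  then have "(sqrt (Q N (conv phi f)))\<^sup>2 \<le> (2 * sqrt (Q N f))\<^sup>2" by (rule power_mono) (simp add: Q_nonneg)
  then show ?thesis by (simp add: power_mult_distrib Q_nonneg)
qed

lemma phi_re_nonneg: "0 \<le> phi_re n"
  by (auto simp: phi_re_def phi_part_nonneg intro!: sum_nonneg)

lemma sum_phi_re: "(\<Sum>n<K. phi_re n) \<le> 1 / 3"
proof -
  have "(\<Sum>n<K. phi_re n) = (\<Sum>n<K. \<Sum>j\<le>K. phi_part j n)"
    by (rule sum.cong) (auto simp: phi_re_eq)
  also have "\<dots> = (\<Sum>j\<le>K. \<Sum>n<K. phi_part j n)" by (rule sum.swap)
  also have "\<dots> \<le> (\<Sum>j\<le>K. (1 / 4) ^ Suc j * 1)"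
  proof (rule sum_mono)
    fix j
    let ?y = "(1 / 2 :: real) ^ Suc j"
    have "(\<Sum>n<K. phi_part j n) = (1 / 4) ^ Suc j * (\<Sum>i=1..4 ^ Suc j. \<Sum>n<K. if n = i * \<nu> j then ?y ^ i else 0)"
      unfolding phi_part_def sum_distrib_left[symmetric] by (subst sum.swap) simp
    also have "\<dots> \<le> (1 / 4) ^ Suc j * (\<Sum>i=1..4 ^ Suc j. ?y ^ i)"
      by (intro mult_left_mono sum_mono) auto
    also have "\<dots> \<le> (1 / 4) ^ Suc j * 1"
    proof (intro mult_left_mono geometric_half_le)
      have "?y \<le> (1 / 2) ^ 1" by (rule power_decreasing) auto
      then show "?y \<le> 1 / 2" by simp
    qed auto
    finally show "(\<Sum>n<K. phi_part j n) \<le> (1 / 4) ^ Suc j * 1" .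
  qed
  also have "\<dots> \<le> 1 / 3" using geometric_quarter_le[of "Suc K"] by (simp add: lessThan_Suc_atMost)
  finally show ?thesis .
qed

lemma phi_abs_summable: "summable (\<lambda>n. cmod (phi n))"
  and phi_abs_sum: "(\<Sum>n. cmod (phi n)) \<le> 1 / 3"
proof -
  have eq: "(\<lambda>n. cmod (phi n)) = phi_re" using phi_re_nonneg by (auto simp: phi_def)
  show s: "summable (\<lambda>n. cmod (phi n))"
    unfolding eq by (rule summableI_nonneg_bounded[OF phi_re_nonneg sum_phi_re])
  show "(\<Sum>n. cmod (phi n)) \<le> 1 / 3"
    using suminf_le_const[OF s] sum_phi_re unfolding eq by blast
qed

lemma phi_multiplier: "disc_fun phi \<in> Mult (cball 0 1) space"
proof (rule disc_fun_multiplier[OF phi_abs_summable])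
  fix f assume f: "f \<in> ell"
  show "conv phi f \<in> ell"
  proof (rule ellI_bounded)
    fix N show "Q N (conv phi f) \<le> 2\<^sup>2 * nsq f"
      by (rule order_trans[OF phi_bounded mult_left_mono[OF Q_le_nsq[OF f]]]) simp
  qed
qed

lemma phi_sup: "cmod (disc_fun phi z) \<le> 1 / 3"
  using disc_fun_cmod_le[OF phi_abs_summable, of z] phi_abs_sum by linarith

lemma phi_lattice_ge:
  assumes "1 \<le> s" "s \<le> 4 ^ Suc j"
  shows "(1 / 4) ^ Suc j * ((1 / 2) ^ Suc j) ^ s \<le> phi_re (\<nu> j * s)"
proof -
  have "((1 / 2) ^ Suc j) ^ s \<le> (\<Sum>i=1..4 ^ Suc j. if \<nu> j * s = i * \<nu> j then ((1 / 2 :: real) ^ Suc j) ^ i else 0)"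
    using member_le_sum[of s "{1..4 ^ Suc j}" "\<lambda>i. if \<nu> j * s = i * \<nu> j then ((1 / 2 :: real) ^ Suc j) ^ i else 0"] assms
    by (simp add: mult.commute del: power_Suc)
  then have "(1 / 4) ^ Suc j * ((1 / 2) ^ Suc j) ^ s \<le> phi_part j (\<nu> j * s)"
    unfolding phi_part_def by (rule mult_left_mono) simp
  also have "\<dots> \<le> phi_re (\<nu> j * s)"
  proof -
    have "j \<le> \<nu> j * 1" using \<nu>_gt[of j] by simp
    also have "\<dots> \<le> \<nu> j * s" using assms by (intro mult_le_mono2) simp
    finally show ?thesis unfolding phi_re_def
      by (intro member_le_sum) (auto simp: phi_part_nonneg)
  qed
  finally show ?thesis .
qed

end

section \<open>A character outside the disc\<close>

lemma sum_multiples: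
  fixes G :: "nat \<Rightarrow> 'a::comm_monoid_add"
  assumes "0 < N"
  shows "(\<Sum>m\<le>N * s. G m) = (\<Sum>u\<le>s. G (N * u)) + (\<Sum>m | m \<le> N * s \<and> \<not> N dvd m. G m)"
proof -
  have "{..N * s} = (\<lambda>u. N * u) ` {..s} \<union> {m. m \<le> N * s \<and> \<not> N dvd m}"
    using assms by (auto elim!: dvdE)
  then have "(\<Sum>m\<le>N * s. G m) = (\<Sum>m\<in>(\<lambda>u. N * u) ` {..s} \<union> {m. m \<le> N * s \<and> \<not> N dvd m}. G m)" by simp
  also have "\<dots> = (\<Sum>m\<in>(\<lambda>u. N * u) ` {..s}. G m) + (\<Sum>m | m \<le> N * s \<and> \<not> N dvd m. G m)"
    by (rule sum.union_disjoint) auto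
  also have "(\<Sum>m\<in>(\<lambda>u. N * u) ` {..s}. G m) = (\<Sum>u\<le>s. G (N * u))"
    by (rule sum.reindex_cong[of "\<lambda>u. N * u"]) (use assms in \<open>auto simp: inj_on_def\<close>)
  finally show ?thesis .
qed

text \<open>
  Compares the product of two truncated series with the truncation of their product.
\<close>

lemma square_minus_triangle:
  fixes F :: "nat \<Rightarrow> nat \<Rightarrow> complex"
  assumes F: "\<And>u v. u \<le> J \<Longrightarrow> v \<le> J \<Longrightarrow> J < u + v \<Longrightarrow> cmod (F u v) \<le> B" and B: "0 \<le> B"
  shows "cmod ((\<Sum>u\<le>J. \<Sum>v\<le>J. F u v) - (\<Sum>s\<le>J. \<Sum>u\<le>s. F u (s - u))) \<le> (real J + 1)\<^sup>2 * B"
proof -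
  have "(\<Sum>s\<le>J. \<Sum>u\<le>s. F u (s - u)) = (\<Sum>s\<le>J. \<Sum>u\<le>J. if u \<le> s then F u (s - u) else 0)"
  proof (rule sum.cong)
    fix s assume "s \<in> {..J}"
    then show "(\<Sum>u\<le>s. F u (s - u)) = (\<Sum>u\<le>J. if u \<le> s then F u (s - u) else 0)"
      by (intro sum.mono_neutral_cong_left) auto
  qed simp
  also have "\<dots> = (\<Sum>u\<le>J. \<Sum>s\<le>J. if u \<le> s then F u (s - u) else 0)" by (rule sum.swap)
  also have "\<dots> = (\<Sum>u\<le>J. \<Sum>v\<le>J - u. F u v)"
    by (rule sum.cong) (auto simp: sum_shift)
  finally have "(\<Sum>u\<le>J. \<Sum>v\<le>J. F u v) - (\<Sum>s\<le>J. \<Sum>u\<le>s. F u (s - u)) = (\<Sum>u\<le>J. (\<Sum>v\<le>J. F u v) - (\<Sum>v\<le>J - u. F u v))"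
    by (simp add: sum_subtractf)
  also have "\<dots> = (\<Sum>u\<le>J. \<Sum>v\<in>{..J} - {..J - u}. F u v)"
    by (intro sum.cong refl) (simp add: sum_diff)
  also have "cmod \<dots> \<le> (\<Sum>u\<le>J. \<Sum>v\<in>{..J} - {..J - u}. B)"
    by (intro sum_norm_le) (auto intro!: F)
  also have "\<dots> \<le> (\<Sum>u\<le>J. \<Sum>v\<le>J. B)"
    using B by (intro sum_mono sum_mono2) auto
  also have "\<dots> = (real J + 1)\<^sup>2 * B" by (simp add: power2_eq_square algebra_simps)
  finally show ?thesis .
qed

context renewal
begin

lemma bounded_by_coeff:
  assumes "bounded_by c C"
  shows "cmod (c n) \<le> C * sqrt (a n)"
proof -
  have d0: "conv c (delta 0) = c" by (rule ext) (simp add: conv_delta)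
  have "Q n (delta 0) = (\<Sum>i\<le>n. if i = 0 then 1 else 0)"
    unfolding Q_def by (rule sum.cong) (auto simp: delta_def)
  then have "Q n (delta 0) = 1" by simp
  then have "Q n c \<le> C\<^sup>2"
    using assms unfolding bounded_by_def by (metis d0 mult.right_neutral)
  then have "sqrt (Q n c) \<le> C"
    using assms by (intro real_le_lsqrt) (auto simp: bounded_by_def Q_nonneg)
  then have "sqrt (a n) * sqrt (Q n c) \<le> sqrt (a n) * C" by (rule mult_left_mono) simp
  then show ?thesis using coeff_le_sqrt_Q[of n n c] by (simp add: mult.commute)
qed

end

context lacunary
begin

text \<open>
  The factor \<open>b (\<nu> (j + 1))^(-s/2)\<close>, which turns the coefficient of \<open>z^(\<nu> (j + 1) s)\<close> into the coefficient of
  \<open>u^s\<close>, where \<open>u\<close> is the independent variable attached to the letter \<open>\<nu> (j + 1)\<close>.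
\<close>

definition wt :: "nat \<Rightarrow> nat \<Rightarrow> real" where
  "wt j s = (2 ^ Suc (Suc j)) ^ s"

text \<open>
  The value of \<open>u\<close> at which the multipliers are evaluated. It is close enough to \<open>1\<close> for its power with exponent
  \<open>4^(j+2)\<close> to stay above \<open>1/2\<close>, and far enough from \<open>1\<close> for the tail beyond \<open>I (j + 1)\<close> to be negligible.
\<close>

definition node :: "nat \<Rightarrow> real" where
  "node j = 1 - 1 / (2 * 4 ^ Suc (Suc j))"

text \<open>
  Evaluation at the point of the Drury-Arveson ball whose coordinate belonging to the letter \<open>\<nu> (j + 1)\<close> is
  \<open>node j\<close> and whose other coordinates vanish, truncated to degree \<open>I (j + 1)\<close>. The first letter \<open>\<nu> 0\<close> is left out
  since the estimates for a letter refer to the one before it.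
\<close>

definition chi :: "nat \<Rightarrow> (nat \<Rightarrow> complex) \<Rightarrow> complex" where
  "chi j c = (\<Sum>s\<le>I (Suc j). c (\<nu> (Suc j) * s) * complex_of_real (wt j s * node j ^ s))"

lemma wt_pos: "0 < wt j s"
  by (simp add: wt_def)

lemma wt_add: "wt j (u + v) = wt j u * wt j v"
  unfolding wt_def by (rule power_add)

lemma wt_mono: "u \<le> v \<Longrightarrow> wt j u \<le> wt j v"
  unfolding wt_def by (intro power_increasing one_le_power) auto

lemma wt_square: "(1 / 4) ^ (Suc (Suc j) * s) * (wt j s)\<^sup>2 = 1"
proof -
  have "(1 / 4 :: real) ^ (Suc (Suc j) * s) * (wt j s)\<^sup>2 = ((1 / 4) ^ Suc (Suc j) * (2 ^ Suc (Suc j))\<^sup>2) ^ s"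
    unfolding wt_def by (simp only: power_mult power_mult_distrib power_even_eq[symmetric] power_commutes)
  also have "(1 / 4 :: real) ^ Suc (Suc j) * (2 ^ Suc (Suc j))\<^sup>2 = 1"
    unfolding power2_eq_square power_mult_distrib[symmetric] by simp
  finally show ?thesis by simp
qed

lemma node_nonneg: "0 \<le> node j" and node_le_1: "node j \<le> 1"
proof -
  have "(1::real) \<le> 4 ^ Suc (Suc j)" by (rule one_le_power) simp
  then have "1 / (2 * 4 ^ Suc (Suc j)) \<le> (1::real)" by (simp add: divide_le_eq del: power_Suc)
  then show "0 \<le> node j" by (simp add: node_def del: power_Suc)
  show "node j \<le> 1" by (simp add: node_def)
qed

lemma node_power_le_1: "node j ^ n \<le> 1"
  by (intro power_le_one node_nonneg node_le_1)

lemma node_tail: "(real (I (Suc j)) + 1)\<^sup>2 * node j ^ I (Suc j) \<le> (1 / 2) ^ Suc j"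
  unfolding node_def by (rule I_tail)

lemma a_wt:
  assumes "s \<le> I (Suc j)"
  shows "1 \<le> a (\<nu> (Suc j) * s) * (wt j s)\<^sup>2" "a (\<nu> (Suc j) * s) * (wt j s)\<^sup>2 \<le> 2"
proof -
  have "(1 / 4) ^ (Suc (Suc j) * s) * (wt j s)\<^sup>2 \<le> a (\<nu> (Suc j) * s) * (wt j s)\<^sup>2"
    by (intro mult_right_mono a_lattice_ge) simp
  then show "1 \<le> a (\<nu> (Suc j) * s) * (wt j s)\<^sup>2" by (simp only: wt_square)
  have "a (\<nu> (Suc j) * s) * (wt j s)\<^sup>2 \<le> 2 * (1 / 4) ^ (Suc (Suc j) * s) * (wt j s)\<^sup>2"
    by (intro mult_right_mono a_lattice_le_double assms) simp
  then show "a (\<nu> (Suc j) * s) * (wt j s)\<^sup>2 \<le> 2" by (simp only: mult.assoc wt_square)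
qed

lemma coeff_wt:
  assumes "bounded_by c C" "s \<le> I (Suc j)"
  shows "cmod (c (\<nu> (Suc j) * s)) * wt j s \<le> 2 * C"
proof -
  have C: "0 \<le> C" using assms(1) by (simp add: bounded_by_def)
  have "(sqrt (a (\<nu> (Suc j) * s)) * wt j s)\<^sup>2 \<le> 2\<^sup>2"
    using a_wt(2)[OF assms(2)] by (simp add: power_mult_distrib)
  then have "sqrt (a (\<nu> (Suc j) * s)) * wt j s \<le> 2" by (rule power2_le_imp_le) simp
  then have "C * (sqrt (a (\<nu> (Suc j) * s)) * wt j s) \<le> C * 2" by (rule mult_left_mono[OF _ C])
  moreover have "cmod (c (\<nu> (Suc j) * s)) * wt j s \<le> C * sqrt (a (\<nu> (Suc j) * s)) * wt j s"
    by (intro mult_right_mono bounded_by_coeff assms) (simp add: less_imp_le wt_pos)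
  ultimately show ?thesis by (simp add: mult_ac)
qed

text \<open>
  The coefficients of a multiplier of norm \<open>C\<close> are at most \<open>C sqrt (a n)\<close>, so the terms that do not come from multiples
  of the letter are small by the estimate for \<open>a\<close> off the lattice.
\<close>

lemma conv_lattice:
  assumes c: "bounded_by c C" and d: "bounded_by d D" and s: "s \<le> I (Suc j)"
  shows "cmod (conv c d (\<nu> (Suc j) * s) - (\<Sum>u\<le>s. c (\<nu> (Suc j) * u) * d (\<nu> (Suc j) * (s - u))))
    \<le> real (\<nu> (Suc j) * s) * (C * D * sqrt (1 / 2) ^ (T j - 1))"
proof -
  let ?N = "\<nu> (Suc j)"
  let ?S = "{m. m \<le> ?N * s \<and> \<not> ?N dvd m}"
  let ?q = "sqrt (1 / 2) ^ (T j - 1)"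
  have CD: "0 \<le> C" "0 \<le> D" using c d by (simp_all add: bounded_by_def)
  have "conv c d (?N * s) = (\<Sum>u\<le>s. c (?N * u) * d (?N * s - ?N * u)) + (\<Sum>m\<in>?S. c m * d (?N * s - m))"
    unfolding conv_def by (rule sum_multiples[OF \<nu>_pos])
  then have "conv c d (?N * s) - (\<Sum>u\<le>s. c (?N * u) * d (?N * (s - u))) = (\<Sum>m\<in>?S. c m * d (?N * s - m))"
    by (simp add: diff_mult_distrib2)
  also have "cmod \<dots> \<le> (\<Sum>m\<in>?S. C * D * ?q)"
  proof (rule sum_norm_le)
    fix m assume "m \<in> ?S"
    then have "a m * a (?N * s - m) \<le> (1 / 2) ^ (T j - 1)" using a_off_lattice[OF s] by blast
    then have "sqrt (a m * a (?N * s - m)) \<le> sqrt ((1 / 2) ^ (T j - 1))" by (rule real_sqrt_le_mono)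
    then have q: "sqrt (a m) * sqrt (a (?N * s - m)) \<le> ?q" by (simp only: real_sqrt_mult real_sqrt_power)
    have "cmod (c m * d (?N * s - m)) \<le> (C * sqrt (a m)) * (D * sqrt (a (?N * s - m)))"
      unfolding norm_mult using CD by (intro mult_mono bounded_by_coeff c d) auto
    also have "\<dots> = C * D * (sqrt (a m) * sqrt (a (?N * s - m)))" by (simp only: mult_ac)
    also have "\<dots> \<le> C * D * ?q" using CD by (intro mult_left_mono q) simp
    finally show "cmod (c m * d (?N * s - m)) \<le> C * D * ?q" .
  qed
  also have "\<dots> = real (card ?S) * (C * D * ?q)" by simp
  also have "\<dots> \<le> real (?N * s) * (C * D * ?q)"
  proof (rule mult_right_mono)
    have "?S \<subseteq> {1..?N * s}" by (auto simp: Suc_le_eq intro: gr0I)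
    then have "card ?S \<le> card {1..?N * s}" by (intro card_mono) auto
    then have "card ?S \<le> ?N * s" by simp
    then show "real (card ?S) \<le> real (?N * s)" by (rule of_nat_mono)
  qed (use CD in simp)
  finally show ?thesis .
qed

text \<open>
  On the lattice of multiples of the letter the coefficients convolve, so that the only errors are the terms off
  the lattice and the difference between the product of the truncations and the truncation of the product.
\<close>

lemma chi_approx_multiplicative:
  assumes c: "bounded_by c C" and d: "bounded_by d D"
  shows "cmod (chi j (conv c d) - chi j c * chi j d) \<le> 5 * C * D * (1 / 2) ^ j"
proof -
  let ?N = "\<nu> (Suc j)" and ?J = "I (Suc j)" and ?x = "node j"
  let ?q = "sqrt (1 / 2) ^ (T j - 1)"
  have CD: "0 \<le> C" "0 \<le> D" using c d by (simp_all add: bounded_by_def)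
  define \<gamma> where "\<gamma> c s = c (?N * s) * complex_of_real (wt j s * ?x ^ s)" for c :: "nat \<Rightarrow> complex" and s
  define F where "F u v = \<gamma> c u * \<gamma> d v" for u v
  define off where "off s = conv c d (?N * s) - (\<Sum>u\<le>s. c (?N * u) * d (?N * (s - u)))" for s
  have prod: "chi j c * chi j d = (\<Sum>u\<le>?J. \<Sum>v\<le>?J. F u v)"
    by (simp add: chi_def \<gamma>_def F_def sum_product)
  have tri: "chi j (conv c d) = (\<Sum>s\<le>?J. \<Sum>u\<le>s. F u (s - u)) + (\<Sum>s\<le>?J. off s * complex_of_real (wt j s * ?x ^ s))"
  proof -
    have "conv c d (?N * s) * complex_of_real (wt j s * ?x ^ s)
        = (\<Sum>u\<le>s. F u (s - u)) + off s * complex_of_real (wt j s * ?x ^ s)" for s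
    proof -
      have "F u (s - u) = c (?N * u) * d (?N * (s - u)) * complex_of_real (wt j s * ?x ^ s)" if "u \<le> s" for u
      proof -
        have "wt j s * ?x ^ s = (wt j u * wt j (s - u)) * (?x ^ u * ?x ^ (s - u))"
          using that by (simp flip: wt_add power_add)
        then show ?thesis unfolding F_def \<gamma>_def by (simp add: mult_ac)
      qed
      then have "(\<Sum>u\<le>s. F u (s - u)) = (\<Sum>u\<le>s. c (?N * u) * d (?N * (s - u))) * complex_of_real (wt j s * ?x ^ s)"
        unfolding sum_distrib_right by (intro sum.cong) auto
      then show ?thesis by (simp add: off_def left_diff_distrib)
    qed
    then show ?thesis by (simp add: chi_def sum.distrib)
  qed
  have \<gamma>_bound: "cmod (\<gamma> e s) \<le> 2 * E * ?x ^ s" if "bounded_by e E" "s \<le> ?J" for e E s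
  proof -
    have "cmod (\<gamma> e s) = cmod (e (?N * s)) * wt j s * ?x ^ s"
      using wt_pos[of j s] node_nonneg[of j] by (simp add: \<gamma>_def norm_mult norm_power)
    also have "\<dots> \<le> 2 * E * ?x ^ s"
      by (intro mult_right_mono coeff_wt that zero_le_power node_nonneg)
    finally show ?thesis .
  qed
  have "cmod ((\<Sum>u\<le>?J. \<Sum>v\<le>?J. F u v) - (\<Sum>s\<le>?J. \<Sum>u\<le>s. F u (s - u))) \<le> (real ?J + 1)\<^sup>2 * (4 * C * D * ?x ^ ?J)"
  proof (rule square_minus_triangle)
    fix u v assume uv: "u \<le> ?J" "v \<le> ?J" "?J < u + v"
    have "cmod (F u v) \<le> (2 * C * ?x ^ u) * (2 * D * ?x ^ v)"
      unfolding F_def norm_mult using CD node_nonneg[of j]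
      by (intro mult_mono \<gamma>_bound c d uv) auto
    also have "\<dots> = 4 * C * D * ?x ^ (u + v)" by (simp add: power_add)
    also have "\<dots> \<le> 4 * C * D * ?x ^ ?J"
      using CD uv node_nonneg[of j] node_le_1[of j] by (intro mult_left_mono power_decreasing) auto
    finally show "cmod (F u v) \<le> 4 * C * D * ?x ^ ?J" .
  qed (use CD node_nonneg[of j] in simp)
  also have "\<dots> = 4 * C * D * ((real ?J + 1)\<^sup>2 * ?x ^ ?J)" by (simp only: mult_ac)
  also have "\<dots> \<le> 4 * C * D * (1 / 2) ^ Suc j" using CD by (intro mult_left_mono node_tail) simp
  also have "\<dots> \<le> 4 * C * D * (1 / 2) ^ j" using CD by (intro mult_left_mono power_decreasing) auto
  finally have 1: "cmod ((\<Sum>u\<le>?J. \<Sum>v\<le>?J. F u v) - (\<Sum>s\<le>?J. \<Sum>u\<le>s. F u (s - u))) \<le> 4 * C * D * (1 / 2) ^ j" .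
  have "cmod (\<Sum>s\<le>?J. off s * complex_of_real (wt j s * ?x ^ s)) \<le> (\<Sum>s\<le>?J. real (?N * ?J) * (C * D * ?q) * wt j ?J)"
  proof (rule sum_norm_le)
    fix s assume "s \<in> {..?J}"
    then have s: "s \<le> ?J" by simp
    have "cmod (off s * complex_of_real (wt j s * ?x ^ s)) = cmod (off s) * (wt j s * ?x ^ s)"
      using wt_pos[of j s] node_nonneg[of j] by (simp add: norm_mult norm_power)
    also have "\<dots> \<le> (real (?N * ?J) * (C * D * ?q)) * (wt j ?J * 1)"
    proof (intro mult_mono node_power_le_1 wt_mono s)
      have "cmod (off s) \<le> real (?N * s) * (C * D * ?q)" unfolding off_def by (rule conv_lattice[OF c d s])
      also have "\<dots> \<le> real (?N * ?J) * (C * D * ?q)"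
        using CD by (intro mult_right_mono of_nat_mono mult_le_mono2 s) simp
      finally show "cmod (off s) \<le> real (?N * ?J) * (C * D * ?q)" .
    qed (use CD wt_pos[of j s] wt_pos[of j ?J] node_nonneg[of j] in \<open>auto simp: less_imp_le\<close>)
    finally show "cmod (off s * complex_of_real (wt j s * ?x ^ s)) \<le> real (?N * ?J) * (C * D * ?q) * wt j ?J" by simp
  qed
  also have "\<dots> = C * D * (real (?N * ?J * (?J + 1)) * ?q * wt j ?J)" by (simp add: algebra_simps)
  also have "wt j ?J = 2 ^ (Suc (Suc j) * ?J)" unfolding wt_def by (simp only: power_mult)
  also have "C * D * (real (?N * ?J * (?J + 1)) * ?q * 2 ^ (Suc (Suc j) * ?J)) \<le> C * D * (1 / 2) ^ j"
    using CD by (intro mult_left_mono T_off) simp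
  finally have 2: "cmod (\<Sum>s\<le>?J. off s * complex_of_real (wt j s * ?x ^ s)) \<le> C * D * (1 / 2) ^ j" .
  have "chi j (conv c d) - chi j c * chi j d = (\<Sum>s\<le>?J. off s * complex_of_real (wt j s * ?x ^ s))
      - ((\<Sum>u\<le>?J. \<Sum>v\<le>?J. F u v) - (\<Sum>s\<le>?J. \<Sum>u\<le>s. F u (s - u)))"
    unfolding prod tri by simp
  then have "cmod (chi j (conv c d) - chi j c * chi j d) \<le> cmod (\<Sum>s\<le>?J. off s * complex_of_real (wt j s * ?x ^ s))
      + cmod ((\<Sum>u\<le>?J. \<Sum>v\<le>?J. F u v) - (\<Sum>s\<le>?J. \<Sum>u\<le>s. F u (s - u)))"
    by (simp only: norm_triangle_ineq4)
  then show ?thesis using 1 2 by linarith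
qed

text \<open>
  In the ball, evaluation at \<open>x\<close> is \<open>\<langle>\<psi> f, g\<rangle> / \<langle>f, g\<rangle>\<close> for \<open>f = g = (1, x, x^2, \<dots>)\<close>, which is bounded by the operator norm.
  The proof transplants \<open>f\<close> and \<open>g\<close> to the multiples of the letter, where the squared norms change by
  at most a factor \<open>2\<close>, and compares \<open>\<sigma> \<chi>(\<psi>)\<close> with \<open>\<langle>\<psi> f, g\<rangle>\<close>, where \<open>\<sigma> = \<Sum> x^(2 i)\<close>.
  Estimating \<open>\<chi>\<close> term by term would only give a bound that grows with \<open>j\<close>.
\<close>

lemma chi_bounded:
  assumes c: "bounded_by c C"
  shows "cmod (chi j c) \<le> 3 * C"
proof -
  let ?N = "\<nu> (Suc j)" and ?J = "I (Suc j)" and ?x = "node j"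
  have C: "0 \<le> C" using c by (simp add: bounded_by_def)
  have N: "0 < ?N" by (rule \<nu>_pos)
  define \<sigma> where "\<sigma> = (\<Sum>i\<le>?J. (?x ^ i)\<^sup>2)"
  define \<gamma> where "\<gamma> s = c (?N * s) * complex_of_real (wt j s * ?x ^ s)" for s
  define F where "F i s = complex_of_real ((?x ^ i)\<^sup>2) * \<gamma> s" for i s
  \<comment> \<open>Dividing by \<open>wt\<close> makes \<open>f\<close> the image of the truncated geometric series in \<open>u\<close>.\<close>
  define f where "f n = (if ?N dvd n \<and> n div ?N \<le> ?J then complex_of_real (?x ^ (n div ?N) / wt j (n div ?N)) else 0)" for n
  define w where "w t = conv c f (?N * t)" for t
  have f_lat: "f (?N * i) = complex_of_real (?x ^ i / wt j i)" if "i \<le> ?J" for i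
    using that N by (simp add: f_def)
  have \<sigma>1: "1 \<le> \<sigma>"
    using member_le_sum[of 0 "{..?J}" "\<lambda>i. (?x ^ i)\<^sup>2"] by (simp add: \<sigma>_def)
  have prod: "complex_of_real \<sigma> * chi j c = (\<Sum>i\<le>?J. \<Sum>s\<le>?J. F i s)"
    by (simp add: \<sigma>_def chi_def \<gamma>_def F_def sum_product)
  have tri: "(\<Sum>t\<le>?J. w t * complex_of_real (wt j t * ?x ^ t)) = (\<Sum>t\<le>?J. \<Sum>i\<le>t. F i (t - i))"
  proof (rule sum.cong)
    fix t assume "t \<in> {..?J}"
    then have t: "t \<le> ?J" by simp
    have "w t = (\<Sum>i\<le>t. f (?N * i) * c (?N * t - ?N * i)) + (\<Sum>m | m \<le> ?N * t \<and> \<not> ?N dvd m. f m * c (?N * t - m))"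
      unfolding w_def conv_commute[of c] conv_def by (rule sum_multiples[OF N])
    also have "(\<Sum>m | m \<le> ?N * t \<and> \<not> ?N dvd m. f m * c (?N * t - m)) = 0"
      by (rule sum.neutral) (simp add: f_def)
    finally have "w t * complex_of_real (wt j t * ?x ^ t) = (\<Sum>i\<le>t. f (?N * i) * c (?N * (t - i)) * complex_of_real (wt j t * ?x ^ t))"
      by (simp add: sum_distrib_right diff_mult_distrib2)
    also have "\<dots> = (\<Sum>i\<le>t. F i (t - i))"
    proof (rule sum.cong)
      fix i assume "i \<in> {..t}"
      then have i: "i \<le> t" by simp
      have "wt j t = wt j i * wt j (t - i)" "?x ^ t = ?x ^ i * ?x ^ (t - i)"
        using i by (simp_all flip: wt_add power_add)
      then have "?x ^ i / wt j i * (wt j t * ?x ^ t) = (?x ^ i)\<^sup>2 * (wt j (t - i) * ?x ^ (t - i))"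
        using wt_pos[of j i] by (simp add: power2_eq_square)
      then have "complex_of_real (?x ^ i / wt j i) * complex_of_real (wt j t * ?x ^ t)
          = complex_of_real ((?x ^ i)\<^sup>2) * complex_of_real (wt j (t - i) * ?x ^ (t - i))"
        by (metis of_real_mult)
      then show "f (?N * i) * c (?N * (t - i)) * complex_of_real (wt j t * ?x ^ t) = F i (t - i)"
        unfolding F_def \<gamma>_def using f_lat[of i] i t by (simp only: mult_ac le_trans)
    qed simp
    finally show "w t * complex_of_real (wt j t * ?x ^ t) = (\<Sum>i\<le>t. F i (t - i))" .
  qed simp
  have "cmod ((\<Sum>i\<le>?J. \<Sum>s\<le>?J. F i s) - (\<Sum>t\<le>?J. \<Sum>i\<le>t. F i (t - i))) \<le> (real ?J + 1)\<^sup>2 * (2 * C * ?x ^ ?J)"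
  proof (rule square_minus_triangle)
    fix i s assume le: "i \<le> ?J" "s \<le> ?J" "?J < i + s"
    have "cmod (F i s) = (?x ^ i)\<^sup>2 * (cmod (c (?N * s)) * wt j s * ?x ^ s)"
      using wt_pos[of j s] node_nonneg[of j] by (simp add: F_def \<gamma>_def norm_mult norm_power)
    also have "\<dots> \<le> ?x ^ i * (2 * C * ?x ^ s)"
    proof (rule mult_mono)
      show "(?x ^ i)\<^sup>2 \<le> ?x ^ i"
        unfolding power2_eq_square using node_power_le_1[of j i] node_nonneg[of j] by (intro mult_left_le) auto
      show "cmod (c (?N * s)) * wt j s * ?x ^ s \<le> 2 * C * ?x ^ s"
        by (intro mult_right_mono coeff_wt c le zero_le_power node_nonneg)
    qed (use wt_pos[of j s] node_nonneg[of j] in auto)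
    also have "\<dots> = 2 * C * ?x ^ (i + s)" by (simp add: power_add)
    also have "\<dots> \<le> 2 * C * ?x ^ ?J"
      using C le node_nonneg[of j] node_le_1[of j] by (intro mult_left_mono power_decreasing) auto
    finally show "cmod (F i s) \<le> 2 * C * ?x ^ ?J" .
  qed (use C node_nonneg[of j] in simp)
  also have "\<dots> = 2 * C * ((real ?J + 1)\<^sup>2 * ?x ^ ?J)" by (simp only: mult_ac)
  also have "\<dots> \<le> 2 * C * (1 / 2) ^ Suc j" using C by (intro mult_left_mono node_tail) simp
  also have "\<dots> \<le> 2 * C * (1 / 2) ^ 1" using C by (intro mult_left_mono power_decreasing) auto
  finally have 1: "cmod ((\<Sum>i\<le>?J. \<Sum>s\<le>?J. F i s) - (\<Sum>t\<le>?J. \<Sum>i\<le>t. F i (t - i))) \<le> C" by simp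
  have 2: "cmod (\<Sum>t\<le>?J. w t * complex_of_real (wt j t * ?x ^ t)) \<le> 2 * C * \<sigma>"
  proof -
    let ?u = "\<lambda>t. cmod (w t) / sqrt (a (?N * t))" and ?v = "\<lambda>t. sqrt (a (?N * t)) * (wt j t * ?x ^ t)"
    have lat: "(\<Sum>t\<le>?J. G (?N * t)) \<le> (\<Sum>m\<le>?N * ?J. G m)" if "\<And>m. 0 \<le> G m" for G :: "nat \<Rightarrow> real"
      unfolding sum_multiples[OF N] by (simp add: that sum_nonneg)
    have "cmod (\<Sum>t\<le>?J. w t * complex_of_real (wt j t * ?x ^ t)) \<le> (\<Sum>t\<le>?J. ?u t * ?v t)"
    proof (rule sum_norm_le)
      fix t
      have "cmod (w t * complex_of_real (wt j t * ?x ^ t)) = cmod (w t) * (wt j t * ?x ^ t)"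
        using wt_pos[of j t] node_nonneg[of j] by (simp add: norm_mult norm_power)
      then show "cmod (w t * complex_of_real (wt j t * ?x ^ t)) \<le> ?u t * ?v t" by simp
    qed
    then have "(cmod (\<Sum>t\<le>?J. w t * complex_of_real (wt j t * ?x ^ t)))\<^sup>2 \<le> (\<Sum>t\<le>?J. ?u t * ?v t)\<^sup>2"
      by (rule power_mono) simp
    also have "\<dots> \<le> (\<Sum>t\<le>?J. (?u t)\<^sup>2) * (\<Sum>t\<le>?J. (?v t)\<^sup>2)" by (rule Cauchy_Schwarz_ineq_sum)
    also have "\<dots> \<le> (C\<^sup>2 * \<sigma>) * (2 * \<sigma>)"
    proof (rule mult_mono)
      have "(\<Sum>t\<le>?J. (?u t)\<^sup>2) = (\<Sum>t\<le>?J. (cmod (conv c f (?N * t)))\<^sup>2 / a (?N * t))"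
        by (simp add: w_def power_divide)
      also have "\<dots> \<le> Q (?N * ?J) (conv c f)"
        unfolding Q_def by (rule lat) simp
      also have "\<dots> \<le> C\<^sup>2 * Q (?N * ?J) f" using c by (simp add: bounded_by_def)
      also have "\<dots> \<le> C\<^sup>2 * \<sigma>"
      proof (rule mult_left_mono)
        have "Q (?N * ?J) f = (\<Sum>i\<le>?J. (cmod (f (?N * i)))\<^sup>2 / a (?N * i)) + (\<Sum>m | m \<le> ?N * ?J \<and> \<not> ?N dvd m. (cmod (f m))\<^sup>2 / a m)"
          unfolding Q_def by (rule sum_multiples[OF N])
        also have "(\<Sum>m | m \<le> ?N * ?J \<and> \<not> ?N dvd m. (cmod (f m))\<^sup>2 / a m) = 0"
          by (rule sum.neutral) (simp add: f_def)
        also have "(\<Sum>i\<le>?J. (cmod (f (?N * i)))\<^sup>2 / a (?N * i)) \<le> \<sigma>"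
          unfolding \<sigma>_def
        proof (rule sum_mono)
          fix i assume "i \<in> {..?J}"
          then have i: "i \<le> ?J" by simp
          have fi: "cmod (f (?N * i)) = ?x ^ i / wt j i"
            unfolding f_lat[OF i] using wt_pos[of j i] node_nonneg[of j] by (simp add: norm_divide norm_power)
          have "(cmod (f (?N * i)))\<^sup>2 / a (?N * i) = (?x ^ i)\<^sup>2 / (a (?N * i) * (wt j i)\<^sup>2)"
            unfolding fi power_divide by (simp only: divide_divide_eq_left mult.commute[of "(wt j i)\<^sup>2"])
          also have "\<dots> \<le> (?x ^ i)\<^sup>2 / 1"
            by (rule divide_left_mono) (use a_wt(1)[OF i] in auto)
          finally show "(cmod (f (?N * i)))\<^sup>2 / a (?N * i) \<le> (?x ^ i)\<^sup>2" by simp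
        qed
        finally show "Q (?N * ?J) f \<le> \<sigma>" by simp
      qed simp
      finally show "(\<Sum>t\<le>?J. (?u t)\<^sup>2) \<le> C\<^sup>2 * \<sigma>" .
      have "(\<Sum>t\<le>?J. (?v t)\<^sup>2) \<le> (\<Sum>t\<le>?J. 2 * (?x ^ t)\<^sup>2)"
      proof (rule sum_mono)
        fix t assume "t \<in> {..?J}"
        then have "(a (?N * t) * (wt j t)\<^sup>2) * (?x ^ t)\<^sup>2 \<le> 2 * (?x ^ t)\<^sup>2"
          by (intro mult_right_mono a_wt) auto
        then show "(?v t)\<^sup>2 \<le> 2 * (?x ^ t)\<^sup>2" by (simp add: power_mult_distrib mult.assoc)
      qed
      then show "(\<Sum>t\<le>?J. (?v t)\<^sup>2) \<le> 2 * \<sigma>" by (simp add: \<sigma>_def sum_distrib_left)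
    qed (use \<sigma>1 in \<open>auto intro!: sum_nonneg\<close>)
    also have "\<dots> \<le> (2 * C * \<sigma>)\<^sup>2" using C \<sigma>1 by (simp add: power2_eq_square)
    finally show ?thesis by (rule power2_le_imp_le) (use C \<sigma>1 in simp)
  qed
  have "complex_of_real \<sigma> * chi j c = ((\<Sum>i\<le>?J. \<Sum>s\<le>?J. F i s) - (\<Sum>t\<le>?J. \<Sum>i\<le>t. F i (t - i)))
      + (\<Sum>t\<le>?J. w t * complex_of_real (wt j t * ?x ^ t))"
    unfolding prod tri by simp
  then have "cmod (complex_of_real \<sigma> * chi j c) \<le> C + 2 * C * \<sigma>"
    using norm_triangle_ineq[of "(\<Sum>i\<le>?J. \<Sum>s\<le>?J. F i s) - (\<Sum>t\<le>?J. \<Sum>i\<le>t. F i (t - i))"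
        "\<Sum>t\<le>?J. w t * complex_of_real (wt j t * ?x ^ t)"] 1 2 by simp
  also have "\<dots> \<le> C * \<sigma> + 2 * C * \<sigma>" using C \<sigma>1 mult_left_mono[OF \<sigma>1 C] by simp
  finally have "\<sigma> * cmod (chi j c) \<le> \<sigma> * (3 * C)" using \<sigma>1 by (simp add: norm_mult mult_ac)
  then show ?thesis using \<sigma>1 by simp
qed

lemma chi_add: "chi j (\<lambda>n. c n + d n) = chi j c + chi j d"
  by (simp add: chi_def distrib_right sum.distrib)

lemma chi_scale: "chi j (\<lambda>n. x * c n) = x * chi j c"
  by (simp add: chi_def sum_distrib_left mult.assoc)

lemma chi_one: "chi j (delta 0) = 1"
proof -
  have "chi j (delta 0) = (\<Sum>s\<le>I (Suc j). if s = 0 then 1 else 0)"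
    unfolding chi_def by (rule sum.cong) (use \<nu>_pos[of "Suc j"] in \<open>auto simp: delta_def wt_def\<close>)
  then show ?thesis by simp
qed

text \<open>
  All coefficients are nonnegative, so the letter belonging to \<open>\<chi> j\<close> already gives the bound: its average, evaluated at
  \<open>x = node j\<close>, is at least \<open>x^(4^(j+2))\<close>, which is at least \<open>1/2\<close> by Bernoulli.
\<close>

lemma chi_phi: "1 / 2 \<le> Re (chi j phi)"
proof -
  let ?N = "\<nu> (Suc j)" and ?J = "I (Suc j)" and ?x = "node j" and ?k = "Suc (Suc j)"
  let ?K = "4 ^ ?k :: nat"
  have KJ: "?K \<le> ?J" by (rule I_ge)
  have "Re (chi j phi) = (\<Sum>s\<le>?J. phi_re (?N * s) * (wt j s * ?x ^ s))"
    by (simp add: chi_def phi_def flip: of_real_mult)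
  also have "\<dots> \<ge> (\<Sum>s\<in>{1..?K}. phi_re (?N * s) * (wt j s * ?x ^ s))"
    using KJ wt_pos node_nonneg[of j] by (intro sum_mono2) (auto intro!: mult_nonneg_nonneg phi_re_nonneg simp: less_imp_le)
  moreover have "(\<Sum>s\<in>{1..?K}. phi_re (?N * s) * (wt j s * ?x ^ s)) \<ge> (\<Sum>s\<in>{1..?K}. (1 / 4) ^ ?k * ?x ^ ?K)"
  proof (rule sum_mono)
    fix s assume "s \<in> {1..?K}"
    then have s: "1 \<le> s" "s \<le> ?K" by simp_all
    have "(1 / 4) ^ ?k * ?x ^ ?K \<le> (1 / 4) ^ ?k * ?x ^ s"
      using s node_nonneg[of j] node_le_1[of j] by (intro mult_left_mono power_decreasing) auto
    also have "\<dots> = ((1 / 4) ^ ?k * ((1 / 2) ^ ?k) ^ s) * (wt j s * ?x ^ s)"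
    proof -
      have "((1 / 2 :: real) ^ ?k) ^ s * wt j s = 1"
        unfolding wt_def power_mult_distrib[symmetric] by simp
      then have "((1 / 4) ^ ?k * ((1 / 2) ^ ?k) ^ s) * (wt j s * ?x ^ s) = (1 / 4) ^ ?k * (1 * ?x ^ s)"
        by (metis mult.assoc)
      then show ?thesis by (simp del: power_Suc)
    qed
    also have "\<dots> \<le> phi_re (?N * s) * (wt j s * ?x ^ s)"
      using wt_pos[of j s] node_nonneg[of j] by (intro mult_right_mono phi_lattice_ge s) (auto simp: less_imp_le)
    finally show "(1 / 4) ^ ?k * ?x ^ ?K \<le> phi_re (?N * s) * (wt j s * ?x ^ s)" .
  qed
  moreover have "(\<Sum>s\<in>{1..?K}. (1 / 4) ^ ?k * ?x ^ ?K) = ?x ^ ?K"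
  proof -
    have "(4::real) ^ ?k * (1 / 4) ^ ?k = 1" unfolding power_mult_distrib[symmetric] by simp
    then have "real ?K * ((1 / 4) ^ ?k * ?x ^ ?K) = ?x ^ ?K"
      by (simp add: mult.assoc[symmetric] del: power_Suc)
    then show ?thesis by (simp del: power_Suc)
  qed
  moreover have "1 / 2 \<le> ?x ^ ?K"
  proof -
    let ?d = "- (1 / (2 * 4 ^ ?k)) :: real"
    have "(1::real) \<le> 4 ^ ?k" by (rule one_le_power) simp
    then have "-1 \<le> ?d" by (simp add: divide_le_eq del: power_Suc)
    from Bernoulli_inequality[OF this, of ?K] have "1 + real ?K * ?d \<le> ?x ^ ?K"
      by (simp add: node_def del: power_Suc)
    moreover have "real ?K * ?d = - 1 / 2" by (simp del: power_Suc)
    ultimately show ?thesis by simp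
  qed
  ultimately show ?thesis by linarith
qed

text \<open>
  The functionals \<open>\<chi> j\<close> lie in a product of discs, which is compact, and hence have a cluster point. Linearity,
  multiplicativity in the limit and the lower bound at \<open>phi\<close> are inherited by it.
\<close>

lemma exists_character:
  "\<exists>\<eta>\<in>characters (cball 0 1) space. 1 / 2 \<le> Re (\<eta> (disc_fun phi))"
proof -
  let ?M = "Mult (cball 0 1) space"
  define X where "X j \<phi> = (if \<phi> \<in> ?M then chi j (coef \<phi>) else 0)" for j \<phi>
  have "\<exists>C. \<forall>\<phi>\<in>?M. bounded_by (coef \<phi>) (C \<phi>)"
    using Mult_bounded unfolding bounded_by_def by (intro bchoice) blast
  then obtain C where C: "\<And>\<phi>. \<phi> \<in> ?M \<Longrightarrow> bounded_by (coef \<phi>) (C \<phi>)" by blast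
  define U where "U = (\<Pi>\<^sub>E \<phi>\<in>UNIV. cball (0::complex) (if \<phi> \<in> ?M then 3 * C \<phi> else 0))"
  have "compactin (product_topology (\<lambda>_. euclidean) UNIV) U"
    unfolding U_def compactin_PiE by auto
  then have "compact U" by (simp add: euclidean_product_topology)
  moreover have XU: "X j \<in> U" for j
    unfolding U_def using chi_bounded[OF C] by (auto simp: X_def)
  then have "\<forall>\<^sub>F \<eta> in filtermap X sequentially. \<eta> \<in> U"
    by (simp add: eventually_filtermap)
  moreover have "filtermap X sequentially \<noteq> bot" by (simp add: filtermap_bot_iff)
  ultimately obtain \<eta> where \<eta>: "inf (nhds \<eta>) (filtermap X sequentially) \<noteq> bot"
    unfolding compact_filter by blast
  define G where "G = inf (nhds \<eta>) (filtermap X sequentially)"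
  have G: "G \<noteq> bot" using \<eta> by (simp add: G_def)
  have coord: "((\<lambda>h. h \<phi>) \<longlongrightarrow> \<eta> \<phi>) G" for \<phi>
  proof -
    have "((\<lambda>h. h \<phi>) \<longlongrightarrow> \<eta> \<phi>) (nhds \<eta>)"
    proof (rule topological_tendstoI)
      fix S :: "complex set" assume S: "open S" "\<eta> \<phi> \<in> S"
      have "open ((\<lambda>h::(complex \<Rightarrow> complex) \<Rightarrow> complex. h \<phi>) -` S)"
        by (rule open_vimage[OF S(1) continuous_on_product_coordinates])
      then show "\<forall>\<^sub>F h in nhds \<eta>. h \<phi> \<in> S"
        unfolding eventually_nhds using S(2)
        by (intro exI[of _ "(\<lambda>h::(complex \<Rightarrow> complex) \<Rightarrow> complex. h \<phi>) -` S"]) auto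
    qed
    then show ?thesis by (rule tendsto_mono[rotated]) (simp add: G_def)
  qed
  have along: "(g \<longlongrightarrow> l) G" if "(\<lambda>j. g (X j)) \<longlonglongrightarrow> l" for g :: "((complex \<Rightarrow> complex) \<Rightarrow> complex) \<Rightarrow> complex" and l
  proof -
    have "(g \<longlongrightarrow> l) (filtermap X sequentially)" using that by (simp add: filterlim_filtermap)
    then show ?thesis by (rule tendsto_mono[rotated]) (simp add: G_def)
  qed
  have limit_eq: "l' = l" if "(g \<longlongrightarrow> l') G" "(\<lambda>j. g (X j)) \<longlonglongrightarrow> l" for g :: "((complex \<Rightarrow> complex) \<Rightarrow> complex) \<Rightarrow> complex" and l l'
    using tendsto_unique[OF G that(1) along[OF that(2)]] .
  have add: "\<eta> (\<lambda>x. \<phi> x + \<psi> x) = \<eta> \<phi> + \<eta> \<psi>" if "\<phi> \<in> ?M" "\<psi> \<in> ?M" for \<phi> \<psi>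
  proof -
    have "\<eta> (\<lambda>x. \<phi> x + \<psi> x) - (\<eta> \<phi> + \<eta> \<psi>) = 0"
    proof (rule limit_eq)
      show "((\<lambda>h. h (\<lambda>x. \<phi> x + \<psi> x) - (h \<phi> + h \<psi>)) \<longlongrightarrow> \<eta> (\<lambda>x. \<phi> x + \<psi> x) - (\<eta> \<phi> + \<eta> \<psi>)) G"
        by (intro tendsto_intros coord)
      show "(\<lambda>j. X j (\<lambda>x. \<phi> x + \<psi> x) - (X j \<phi> + X j \<psi>)) \<longlonglongrightarrow> 0"
        using that by (simp add: X_def Mult_add coef_add Mult_in_space chi_add)
    qed
    then show ?thesis by simp
  qed
  have scale: "\<eta> (\<lambda>x. c * \<phi> x) = c * \<eta> \<phi>" if "\<phi> \<in> ?M" for c \<phi>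
  proof -
    have "\<eta> (\<lambda>x. c * \<phi> x) - c * \<eta> \<phi> = 0"
    proof (rule limit_eq)
      show "((\<lambda>h. h (\<lambda>x. c * \<phi> x) - c * h \<phi>) \<longlongrightarrow> \<eta> (\<lambda>x. c * \<phi> x) - c * \<eta> \<phi>) G"
        by (intro tendsto_intros coord)
      show "(\<lambda>j. X j (\<lambda>x. c * \<phi> x) - c * X j \<phi>) \<longlonglongrightarrow> 0"
        using that by (simp add: X_def Mult_scale coef_scale Mult_in_space chi_scale)
    qed
    then show ?thesis by simp
  qed
  have times: "\<eta> (\<lambda>x. \<phi> x * \<psi> x) = \<eta> \<phi> * \<eta> \<psi>" if m: "\<phi> \<in> ?M" "\<psi> \<in> ?M" for \<phi> \<psi>
  proof -
    have "\<eta> (\<lambda>x. \<phi> x * \<psi> x) - \<eta> \<phi> * \<eta> \<psi> = 0"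
    proof (rule limit_eq)
      show "((\<lambda>h. h (\<lambda>x. \<phi> x * \<psi> x) - h \<phi> * h \<psi>) \<longlongrightarrow> \<eta> (\<lambda>x. \<phi> x * \<psi> x) - \<eta> \<phi> * \<eta> \<psi>) G"
        by (intro tendsto_intros coord)
      show "(\<lambda>j. X j (\<lambda>x. \<phi> x * \<psi> x) - X j \<phi> * X j \<psi>) \<longlonglongrightarrow> 0"
      proof (rule Lim_null_comparison[OF always_eventually], rule allI)
        fix j
        show "cmod (X j (\<lambda>x. \<phi> x * \<psi> x) - X j \<phi> * X j \<psi>) \<le> 5 * C \<phi> * C \<psi> * (1 / 2) ^ j"
          using chi_approx_multiplicative[OF C[OF m(1)] C[OF m(2)], of j] m
          by (simp add: X_def Mult_times coef_Mult_times)
        show "(\<lambda>j. 5 * C \<phi> * C \<psi> * (1 / 2) ^ j) \<longlonglongrightarrow> 0"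
          by (intro tendsto_mult_right_zero LIMSEQ_power_zero) simp
      qed
    qed
    then show ?thesis by simp
  qed
  have one: "\<eta> (disc_fun (delta 0)) = 1"
  proof (rule limit_eq[OF coord])
    show "(\<lambda>j. X j (disc_fun (delta 0))) \<longlonglongrightarrow> 1"
      by (simp add: X_def Mult_one delta_ell chi_one)
  qed
  have phi_ell: "phi \<in> ell"
    using Mult_in_space[OF phi_multiplier] by (simp add: disc_fun_in_space_iff phi_abs_summable)
  have phi: "1 / 2 \<le> Re (\<eta> (disc_fun phi))"
  proof (rule tendsto_lowerbound[OF _ _ G])
    show "((\<lambda>h. Re (h (disc_fun phi))) \<longlongrightarrow> Re (\<eta> (disc_fun phi))) G"
      by (intro tendsto_intros coord)
    have "\<forall>\<^sub>F h in filtermap X sequentially. 1 / 2 \<le> Re (h (disc_fun phi))"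
      using chi_phi by (simp add: eventually_filtermap X_def phi_multiplier phi_ell)
    then show "\<forall>\<^sub>F h in G. 1 / 2 \<le> Re (h (disc_fun phi))"
      by (rule filter_leD[rotated]) (simp add: G_def)
  qed
  have "restrict \<eta> ?M \<in> characters (cball 0 1) space"
    unfolding characters_def
    by (auto simp: Mult_add Mult_scale Mult_times add scale times intro!: bexI[OF _ Mult_one] simp: one Mult_one)
  moreover have "1 / 2 \<le> Re (restrict \<eta> ?M (disc_fun phi))" using phi phi_multiplier by simp
  ultimately show ?thesis by blast
qed

lemma character_not_evaluation:
  assumes "1 / 2 \<le> Re (\<eta> (disc_fun phi))"
  shows "\<eta> \<notin> point_evaluation (cball 0 1) space ` cball 0 1"
proof
  assume "\<eta> \<in> point_evaluation (cball 0 1) space ` cball 0 1"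
  then obtain x where "\<eta> = point_evaluation (cball 0 1) space x" by blast
  then have "\<eta> (disc_fun phi) = disc_fun phi x" by (simp add: point_evaluation_def phi_multiplier)
  then show False using assms phi_sup[of x] complex_Re_le_cmod[of "disc_fun phi x"] by simp
qed

text \<open>
  With \<open>\<eta>\<close> the character above, \<open>\<eta>(phi) - phi\<close> is killed by \<open>\<eta>\<close> and hence not invertible, but
  its modulus is at least \<open>1/2 - 1/3\<close> on the disc.
\<close>

lemma corona_fails: "\<not> one_function_corona (cball 0 1) space"
proof
  assume corona: "one_function_corona (cball 0 1) space"
  let ?M = "Mult (cball 0 1) space"
  obtain \<eta> where \<eta>: "\<eta> \<in> characters (cball 0 1) space" "1 / 2 \<le> Re (\<eta> (disc_fun phi))"
    using exists_character by blast
  then have add: "\<And>\<phi> \<psi>. \<phi> \<in> ?M \<Longrightarrow> \<psi> \<in> ?M \<Longrightarrow> \<eta> (\<lambda>x. \<phi> x + \<psi> x) = \<eta> \<phi> + \<eta> \<psi>"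
    and scale: "\<And>c \<phi>. \<phi> \<in> ?M \<Longrightarrow> \<eta> (\<lambda>x. c * \<phi> x) = c * \<eta> \<phi>"
    and times: "\<And>\<phi> \<psi>. \<phi> \<in> ?M \<Longrightarrow> \<psi> \<in> ?M \<Longrightarrow> \<eta> (\<lambda>x. \<phi> x * \<psi> x) = \<eta> \<phi> * \<eta> \<psi>"
    and nz: "\<exists>\<phi>\<in>?M. \<eta> \<phi> \<noteq> 0"
    unfolding characters_def by blast+
  let ?one = "disc_fun (delta 0)" and ?c = "\<eta> (disc_fun phi)"
  obtain \<phi> where \<phi>: "\<phi> \<in> ?M" "\<eta> \<phi> \<noteq> 0" using nz by blast
  have "(\<lambda>x. ?one x * \<phi> x) = \<phi>"
    using \<phi>(1) by (auto simp: Mult_def functions_on_def disc_fun_delta fun_eq_iff)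
  then have "\<eta> \<phi> = \<eta> ?one * \<eta> \<phi>" using times[OF Mult_one \<phi>(1)] by simp
  then have one: "\<eta> ?one = 1" using \<phi>(2) by simp
  define \<psi> where "\<psi> x = ?c * ?one x + (-1) * disc_fun phi x" for x
  have \<psi>: "\<psi> \<in> ?M"
    unfolding \<psi>_def[abs_def] by (intro Mult_add Mult_scale Mult_one phi_multiplier)
  have zero: "\<eta> \<psi> = 0"
  proof -
    have "\<eta> \<psi> = \<eta> (\<lambda>x. ?c * ?one x) + \<eta> (\<lambda>x. (-1) * disc_fun phi x)"
      unfolding \<psi>_def[abs_def] by (rule add) (intro Mult_scale Mult_one phi_multiplier)+
    also have "\<eta> (\<lambda>x. ?c * ?one x) = ?c" by (simp add: scale Mult_one one)
    also have "\<eta> (\<lambda>x. (-1) * disc_fun phi x) = - ?c" by (subst scale[OF phi_multiplier]) simp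
    finally show ?thesis by simp
  qed
  have lower: "1 / 6 \<le> cmod (\<psi> x)" if "x \<in> cball 0 1" for x
  proof -
    have "\<psi> x = ?c - disc_fun phi x" using that by (simp add: \<psi>_def disc_fun_delta)
    then have "cmod ?c - cmod (disc_fun phi x) \<le> cmod (\<psi> x)" by (simp add: norm_triangle_ineq2)
    then show ?thesis using phi_sup[of x] \<eta>(2) complex_Re_le_cmod[of ?c] by linarith
  qed
  have "1 / 6 \<le> (INF x\<in>cball 0 1. cmod (\<psi> x))"
    by (rule cINF_greatest) (use lower in auto)
  then have "0 < (INF x\<in>cball 0 1. cmod (\<psi> x))" by simp
  then have inv: "(\<lambda>x. 1 / \<psi> x) \<in> ?M" using corona \<psi> by (simp add: one_function_corona_def)
  have "(\<lambda>x. \<psi> x * (1 / \<psi> x)) = ?one"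
  proof
    fix x show "\<psi> x * (1 / \<psi> x) = ?one x"
    proof (cases "x \<in> cball 0 1")
      case True
      then show ?thesis using lower[OF True] by (auto simp: disc_fun_delta)
    next
      case False
      then show ?thesis using \<psi> by (auto simp: Mult_def functions_on_def disc_fun_delta)
    qed
  qed
  then have "1 = \<eta> \<psi> * \<eta> (\<lambda>x. 1 / \<psi> x)" using times[OF \<psi> inv] one by simp
  then show False using zero by simp
qed

lemma evaluations_proper:
  "point_evaluation (cball 0 1) space ` cball 0 1 \<subset> topspace (maximal_ideal_space (cball 0 1) space)"
proof -
  have top: "topspace (maximal_ideal_space (cball 0 1) space) = characters (cball 0 1) space"
    by (auto simp: maximal_ideal_space_def PiE_def characters_def)
  show ?thesis
    unfolding top using exists_character character_not_evaluation point_evaluation_character by blast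
qed

end

section \<open>Existence of lacunary parameters and conclusion\<close>

lemma geometric_dominates_square:
  fixes x e :: real
  assumes "0 \<le> x" "x < 1" "0 < e"
  shows "\<exists>i\<ge>k. (real i + 1)\<^sup>2 * x ^ i \<le> e"
proof -
  let ?y = "sqrt x"
  have y: "norm ?y < 1" "0 \<le> ?y" "?y\<^sup>2 = x" using assms by simp_all
  have "(\<lambda>n. real n * ?y ^ n + ?y ^ n) \<longlonglongrightarrow> 0 + 0"
    by (rule tendsto_add[OF powser_times_n_limit_0[OF y(1)] LIMSEQ_power_zero[OF y(1)]])
  then have "(\<lambda>n. (real n * ?y ^ n + ?y ^ n)\<^sup>2) \<longlonglongrightarrow> (0 + 0)\<^sup>2" by (rule tendsto_power)
  then have "(\<lambda>n. (real n * ?y ^ n + ?y ^ n)\<^sup>2) \<longlonglongrightarrow> 0" by simp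
  then have "\<forall>\<^sub>F n in sequentially. (real n * ?y ^ n + ?y ^ n)\<^sup>2 < e"
    using assms(3) by (rule order_tendstoD)
  then have "\<forall>\<^sub>F n in sequentially. (real n * ?y ^ n + ?y ^ n)\<^sup>2 < e \<and> k \<le> n"
    using eventually_ge_at_top[of k] by eventually_elim simp
  then obtain n where n: "(real n * ?y ^ n + ?y ^ n)\<^sup>2 < e" "k \<le> n"
    unfolding eventually_sequentially by blast
  have "real n * ?y ^ n + ?y ^ n = (real n + 1) * ?y ^ n" by (simp add: distrib_right)
  moreover have "(?y ^ n)\<^sup>2 = x ^ n" by (metis power_mult mult.commute y(3))
  ultimately have "(real n * ?y ^ n + ?y ^ n)\<^sup>2 = (real n + 1)\<^sup>2 * x ^ n"
    by (simp only: power_mult_distrib)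
  then show ?thesis using n by (intro exI[of _ n]) simp
qed

lemma geometric_dominates_linear:
  fixes q A e d :: real
  assumes "0 \<le> q" "q < 1" "0 < e" "0 < d"
  shows "\<exists>t>k. q ^ (2 * (t - 1)) \<le> d \<and> A * real t * q ^ (t - 1) \<le> e"
proof -
  have q: "norm q < 1" using assms by simp
  have "(\<lambda>n. A * (real n * q ^ n + q ^ n)) \<longlonglongrightarrow> A * (0 + 0)"
    using powser_times_n_limit_0[OF q] by (intro tendsto_intros LIMSEQ_power_zero q) simp
  then have "(\<lambda>n. A * (real n * q ^ n + q ^ n)) \<longlonglongrightarrow> 0" by simp
  then have 1: "\<forall>\<^sub>F n in sequentially. A * (real n * q ^ n + q ^ n) < e"
    using assms(3) by (rule order_tendstoD)
  have "(\<lambda>n. q ^ n * q ^ n) \<longlonglongrightarrow> 0 * 0" by (intro tendsto_mult LIMSEQ_power_zero q)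
  then have "(\<lambda>n. q ^ n * q ^ n) \<longlonglongrightarrow> 0" by simp
  then have 2: "\<forall>\<^sub>F n in sequentially. q ^ n * q ^ n < d"
    using assms(4) by (rule order_tendstoD)
  have "\<forall>\<^sub>F n in sequentially. A * (real n * q ^ n + q ^ n) < e \<and> q ^ n * q ^ n < d \<and> k \<le> n"
    using 1 2 eventually_ge_at_top[of k] by eventually_elim simp
  then obtain n where n: "A * (real n * q ^ n + q ^ n) < e" "q ^ n * q ^ n < d" "k \<le> n"
    unfolding eventually_sequentially by blast
  have "A * real (Suc n) * q ^ n = A * (real n * q ^ n + q ^ n)" by (simp add: distrib_left distrib_right mult.assoc)
  then have "A * real (Suc n) * q ^ n \<le> e" using n(1) by (simp only: less_imp_le)
  moreover have "q ^ (2 * n) \<le> d" using n(2) by (simp add: mult_2 power_add)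
  ultimately show ?thesis
    using n(3) by (intro exI[of _ "Suc n"]) (simp only: diff_Suc_1 less_Suc_eq_le simp_thms)
qed

lemma lacunary_exists: "\<exists>\<nu> T I. lacunary \<nu> T I"
proof -
  have "\<exists>i\<ge>4 ^ Suc j. (real i + 1)\<^sup>2 * (1 - 1 / (2 * 4 ^ Suc j)) ^ i \<le> (1 / 2) ^ j" for j :: nat
  proof (rule geometric_dominates_square)
    have "(1::real) \<le> 4 ^ Suc j" by (rule one_le_power) simp
    then show "0 \<le> 1 - 1 / (2 * 4 ^ Suc j :: real)" by (simp add: divide_le_eq del: power_Suc)
  qed auto
  then obtain I where I: "\<And>j. 4 ^ Suc j \<le> I j"
    "\<And>j. (real (I j) + 1)\<^sup>2 * (1 - 1 / (2 * 4 ^ Suc j)) ^ I j \<le> (1 / 2) ^ j"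
    by metis
  define good where "good j v t \<longleftrightarrow> I j < t
      \<and> (1 / 2 :: real) ^ (t - 1) \<le> (1 / 4) ^ (Suc (Suc j) * I (Suc j))
      \<and> real (v * t * I (Suc j) * (I (Suc j) + 1)) * sqrt (1 / 2) ^ (t - 1)
        * 2 ^ (Suc (Suc j) * I (Suc j)) \<le> (1 / 2) ^ j" for j v t :: nat
  have ex: "\<exists>t. good j v t" for j v
  proof -
    let ?A = "real v * real (I (Suc j) * (I (Suc j) + 1)) * 2 ^ (Suc (Suc j) * I (Suc j))"
    have "\<exists>t>I j. sqrt (1 / 2) ^ (2 * (t - 1)) \<le> (1 / 4) ^ (Suc (Suc j) * I (Suc j))
        \<and> ?A * real t * sqrt (1 / 2) ^ (t - 1) \<le> (1 / 2) ^ j"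
      by (rule geometric_dominates_linear) auto
    then obtain t where t: "I j < t" "sqrt (1 / 2) ^ (2 * (t - 1)) \<le> (1 / 4) ^ (Suc (Suc j) * I (Suc j))"
      "?A * real t * sqrt (1 / 2) ^ (t - 1) \<le> (1 / 2) ^ j" by blast
    have half: "sqrt (1 / 2) ^ (2 * (t - 1)) = (1 / 2) ^ (t - 1)" unfolding power_mult by simp
    have off: "real (v * t * I (Suc j) * (I (Suc j) + 1)) * sqrt (1 / 2) ^ (t - 1) * 2 ^ (Suc (Suc j) * I (Suc j))
        = ?A * real t * sqrt (1 / 2) ^ (t - 1)"
      by (simp only: of_nat_mult mult_ac)
    have "good j v t"
      unfolding good_def off using t unfolding half by (intro conjI)
    then show ?thesis ..
  qed
  \<comment> \<open>\<open>T j\<close> depends on \<open>\<nu> j\<close>, which is built from the earlier values of \<open>T\<close>, so both are chosen in one recursion.\<close>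
  define next_t where "next_t j v = (SOME t. good j v t)" for j v
  define \<nu> where "\<nu> = rec_nat 1 (\<lambda>j v. v * next_t j v)"
  define T where "T j = next_t j (\<nu> j)" for j
  have \<nu>: "\<nu> 0 = 1" "\<nu> (Suc j) = \<nu> j * T j" for j by (simp_all add: \<nu>_def T_def)
  have good: "good j (\<nu> j) (T j)" for j
    unfolding T_def next_t_def by (rule someI_ex) (rule ex)
  have "lacunary \<nu> T I"
    by unfold_locales (use \<nu> I good in \<open>auto simp: good_def\<close>)
  then show ?thesis by blast
qed

theorem theorem1p6:
  shows "\<exists>(H :: (complex \<Rightarrow> complex) set) ip k (a :: nat \<Rightarrow> real).
    complete_Pick_space (cball 0 1) H ip k \<and>
    maximal_domain (cball 0 1) H ip \<and>
    (\<forall>z \<in> cball 0 1. \<forall>w \<in> cball 0 1.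
       (\<lambda>n. complex_of_real (a n) * (z * cnj w) ^ n) sums k z w) \<and>
    \<not> one_function_corona (cball 0 1) H \<and>
    separates_points (Mult (cball 0 1) H) (cball 0 1) \<and>
    compactin (maximal_ideal_space (cball 0 1) H)
      (point_evaluation (cball 0 1) H ` cball 0 1) \<and>
    point_evaluation (cball 0 1) H ` cball 0 1
      \<subset> topspace (maximal_ideal_space (cball 0 1) H)"
proof -
  obtain \<nu> T I where "lacunary \<nu> T I" using lacunary_exists by blast
  then interpret lacunary \<nu> T I .
  show ?thesis
  proof (intro exI conjI ballI)
    show "complete_Pick_space (cball 0 1) space ip ker" by (rule complete_Pick)
    show "maximal_domain (cball 0 1) space ip" by (rule maximal_domain_disc) (rule unbounded_radius)
    show "(\<lambda>n. complex_of_real (a n) * (z * cnj w) ^ n) sums ker z w"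
      if "z \<in> cball 0 1" "w \<in> cball 0 1" for z w by (rule ker_sums[OF that])
    show "\<not> one_function_corona (cball 0 1) space" by (rule corona_fails)
    show "separates_points (Mult (cball 0 1) space) (cball 0 1)" by (rule Mult_separates_points)
    show "compactin (maximal_ideal_space (cball 0 1) space) (point_evaluation (cball 0 1) space ` cball 0 1)"
      by (rule compact_point_evaluations)
    show "point_evaluation (cball 0 1) space ` cball 0 1 \<subset> topspace (maximal_ideal_space (cball 0 1) space)"
      by (rule evaluations_proper)
  qed
qed

end
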